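(* In the setting described in the context, let $f_t:=\Pi_0\circ\Phi_t\circ\iota:M\to M$ (for $t$ with $-t\in E$) and let $\omega_t$ be the symplectic form on $M$ defined by $\omega=f_t^*\omega_t$. Then $$\dot f_t\circ f_t^{-1}=\Xi^{\omega_t}_{\operatorname{Re}h\circ f_t^{-1}}+J_0\left(\Xi^{\omega_t}_{\operatorname{Im}h\circ f_t^{-1}}\right),$$ where $J_0=J$ and $\Xi^{\omega_t}_{g}$ denotes the Hamilton vector field of $g$ with respect to $\omega_t$.
   Context: Setting. $(M,J,\omega)$ is a real-analytic Kähler manifold of real dimension $2n$. $(X,I)$ is a complex manifold of complex dimension $2n$ with a holomorphic symplectic form $\Omega$, together with: a real-analytic embedding $\iota:M\hookrightarrow X$ with $\iota^*\Omega=\omega$; an anti-holomorphic involution $\tau:X\to X$ whose fixed point set is $\iota(M)$ and with $\tau^*\Omega=\overline{\Omega}$; and a holomorphic projection (submersion) $\Pi:(X,I)\to(M,J)$ with $\Pi\circ\iota=\mathrm{Id}_M$, whose fibers are holomorphic Lagrangian submanifolds. $M$ is identified with $\iota(M)$. $h:M\to\mathbb{C}$ is a function with real-analytic real and imaginary parts, and $H:X\to\mathbb{C}$ is its holomorphic extension, $H\circ\iota=h$ ($X$ is shrunk around $\iota(M)$ if necessary, without change of notation). For a real symplectic form $\sigma$ and a real function $f$, $\Xi^\sigma_f$ denotes the Hamilton vector field, $\sigma(\Xi^\sigma_f,\cdot)=df$. $\Phi_t:X\to X$ is the Hamilton flow of $\operatorname{Re}H$ with respect to the real symplectic form $\operatorname{Re}\Omega$.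 $\mathcal{F}=\mathcal{F}_0$ is the holomorphic foliation of $X$ whose leaves are the fibers of $\Pi$, and $\mathcal{F}_t$ is its image under $\Phi_t$ (leaves $\Phi_t(\Pi^{-1}(x))$, $x\in M$). $E\subset\mathbb{R}$ is an open interval containing $0$ such that for all $t\in E$ the flow $\Phi_t:X\to X$ is defined (hence so is $\Phi_{-t}=\Phi_t^{-1}$) and the leaves of $\mathcal{F}_t$ are the fibers of a projection $\Pi_t:X\to M$, i.e. a smooth submersion with $\Pi_t\circ\iota=\mathrm{Id}_M$ ($\Pi_0=\Pi$). *)

theory Defs
  imports "HOL-Analysis.Analysis"
begin

section \<open>Regularity classes on open subsets of Euclidean spaces\<close>

primrec Ck_on :: "nat \<Rightarrow> ('a::real_normed_vector \<Rightarrow> 'b::real_normed_vector) \<Rightarrow> 'a set \<Rightarrow> bool" where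
  "Ck_on 0 f S \<longleftrightarrow> continuous_on S f"
| "Ck_on (Suc k) f S \<longleftrightarrow> (\<forall>x\<in>S. f differentiable at x) \<and>
     (\<forall>v. Ck_on k (\<lambda>x. frechet_derivative f (at x) v) S)"

definition smooth_on :: "('a::real_normed_vector \<Rightarrow> 'b::real_normed_vector) \<Rightarrow> 'a set \<Rightarrow> bool" where
  "smooth_on f S \<longleftrightarrow> (\<forall>k. Ck_on k f S)"

text \<open>Local expansion in an unconditionally convergent power series; the multi-indices
  are the functions \<open>Basis \<rightarrow>\<^sub>E UNIV\<close>.\<close>

definition real_analytic_on :: "('a::euclidean_space \<Rightarrow> 'b::real_normed_vector) \<Rightarrow> 'a set \<Rightarrow> bool" where
  "real_analytic_on f S \<longleftrightarrow> (\<forall>a\<in>S. \<exists>r>0. \<exists>c :: ('a \<Rightarrow> nat) \<Rightarrow> 'b. \<forall>x\<in>ball a r.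
     ((\<lambda>\<alpha>. (\<Prod>b\<in>Basis. ((x - a) \<bullet> b) ^ \<alpha> b) *\<^sub>R c \<alpha>) has_sum f x) (Basis \<rightarrow>\<^sub>E (UNIV :: nat set)))"

definition J_std :: "complex^'n \<Rightarrow> complex^'n" where
  "J_std v = \<i> *s v"

text \<open>Differentiability with a derivative that intertwines the complex structures \<open>J\<close> and \<open>J'\<close>
  (Cauchy--Riemann equations). On open sets this is holomorphy for the standard structures,
  and antiholomorphy if \<open>J'\<close> is the negative of the standard one.\<close>

definition CR_on :: "('a::real_normed_vector \<Rightarrow> 'a) \<Rightarrow> ('b::real_normed_vector \<Rightarrow> 'b) \<Rightarrow>
    ('a \<Rightarrow> 'b) \<Rightarrow> 'a set \<Rightarrow> bool" where
  "CR_on J J' f S \<longleftrightarrow>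
     (\<forall>z\<in>S. \<exists>D. (f has_derivative D) (at z) \<and> (\<forall>v. D (J v) = J' (D v)))"

abbreviation hol_map_on :: "(complex^'n \<Rightarrow> complex^'m) \<Rightarrow> (complex^'n) set \<Rightarrow> bool" where
  "hol_map_on \<equiv> CR_on J_std J_std"

abbreviation antihol_map_on :: "(complex^'n \<Rightarrow> complex^'m) \<Rightarrow> (complex^'n) set \<Rightarrow> bool" where
  "antihol_map_on \<equiv> CR_on J_std (\<lambda>v. - J_std v)"

abbreviation hol_fun_on :: "(complex^'n \<Rightarrow> complex) \<Rightarrow> (complex^'n) set \<Rightarrow> bool" where
  "hol_fun_on \<equiv> CR_on J_std ((*) \<i>)"


section \<open>Complex manifolds\<close>

text \<open>A chart is a pair of its domain and its coordinate map, whose values outside the domain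
  are irrelevant.\<close>

type_synonym ('m, 'e) chart = "'m set \<times> ('m \<Rightarrow> 'e)"

definition chart_inv :: "('m, 'e) chart \<Rightarrow> 'e \<Rightarrow> 'm" where
  "chart_inv c = inv_into (fst c) (snd c)"

definition is_chart :: "('m::topological_space, 'e::topological_space) chart \<Rightarrow> bool" where
  "is_chart c \<longleftrightarrow> open (fst c) \<and> open (snd c ` fst c) \<and>
     homeomorphism (fst c) (snd c ` fst c) (snd c) (chart_inv c)"

definition complex_manifold ::
    "('m::{t2_space,second_countable_topology}, complex^'n) chart set \<Rightarrow> bool" where
  "complex_manifold A \<longleftrightarrow> (\<forall>c\<in>A. is_chart c) \<and> (\<Union>c\<in>A. fst c) = UNIV \<and>
     (\<forall>c\<in>A. \<forall>d\<in>A. hol_map_on (snd d \<circ> chart_inv c) (snd c ` (fst c \<inter> fst d)))"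

definition holomorphic_chart ::
    "('m::topological_space, complex^'n) chart set \<Rightarrow> ('m, complex^'n) chart \<Rightarrow> bool" where
  "holomorphic_chart A c \<longleftrightarrow> is_chart c \<and>
     (\<forall>d\<in>A. hol_map_on (snd d \<circ> chart_inv c) (snd c ` (fst c \<inter> fst d)) \<and>
            hol_map_on (snd c \<circ> chart_inv d) (snd d ` (fst c \<inter> fst d)))"

definition chartwise_map :: "(('e \<Rightarrow> 'f) \<Rightarrow> 'e set \<Rightarrow> bool) \<Rightarrow>
    ('m::topological_space, 'e) chart set \<Rightarrow> ('k::topological_space, 'f) chart set \<Rightarrow>
    ('m \<Rightarrow> 'k) \<Rightarrow> bool" where
  "chartwise_map P A B f \<longleftrightarrow> continuous_on UNIV f \<and>
     (\<forall>c\<in>A. \<forall>d\<in>B. P (snd d \<circ> f \<circ> chart_inv c) (snd c ` (fst c \<inter> f -` fst d)))"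

definition chartwise_fun :: "(('e \<Rightarrow> 'v) \<Rightarrow> 'e set \<Rightarrow> bool) \<Rightarrow>
    ('m, 'e) chart set \<Rightarrow> ('m \<Rightarrow> 'v) \<Rightarrow> bool" where
  "chartwise_fun P A g \<longleftrightarrow> (\<forall>c\<in>A. P (g \<circ> chart_inv c) (snd c ` fst c))"


section \<open>Tangent vectors and differentials\<close>

text \<open>The tangent space at \<open>p\<close> is the model space, read in a chart around \<open>p\<close> that is selected
  once and for all. For a holomorphic atlas, the complex structure of every tangent space is then
  \<^const>\<open>J_std\<close>. Tangent vectors at different points must not be compared directly; their
  coordinates in a common chart are obtained by differentiating transition maps
  (see \<open>form_rep\<close> below).\<close>

definition chart_at :: "('m, 'e) chart set \<Rightarrow> 'm \<Rightarrow> ('m, 'e) chart" where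
  "chart_at A p = (SOME c. c \<in> A \<and> p \<in> fst c)"

definition coord_at :: "('m, 'e) chart set \<Rightarrow> 'm \<Rightarrow> 'm \<Rightarrow> 'e" where
  "coord_at A p = snd (chart_at A p)"

definition mderiv :: "('m, 'e::real_normed_vector) chart set \<Rightarrow>
    ('k, 'f::real_normed_vector) chart set \<Rightarrow> ('m \<Rightarrow> 'k) \<Rightarrow> 'm \<Rightarrow> 'e \<Rightarrow> 'f" where
  "mderiv A B f p = frechet_derivative
     (coord_at B (f p) \<circ> f \<circ> chart_inv (chart_at A p)) (at (coord_at A p p))"

definition fun_deriv :: "('m, 'e::real_normed_vector) chart set \<Rightarrow>
    ('m \<Rightarrow> 'v::real_normed_vector) \<Rightarrow> 'm \<Rightarrow> 'e \<Rightarrow> 'v" where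
  "fun_deriv A g p = frechet_derivative (g \<circ> chart_inv (chart_at A p)) (at (coord_at A p p))"

definition has_velocity :: "('m::topological_space, 'e::real_normed_vector) chart set \<Rightarrow>
    (real \<Rightarrow> 'm) \<Rightarrow> real \<Rightarrow> 'e \<Rightarrow> bool" where
  "has_velocity A \<gamma> t v \<longleftrightarrow>
     isCont \<gamma> t \<and> ((coord_at A (\<gamma> t) \<circ> \<gamma>) has_vector_derivative v) (at t)"

definition is_flow_on :: "('m::topological_space, 'e::real_normed_vector) chart set \<Rightarrow>
    ('m \<Rightarrow> 'e) \<Rightarrow> real set \<Rightarrow> (real \<Rightarrow> 'm \<Rightarrow> 'm) \<Rightarrow> bool" where
  "is_flow_on A V T \<Phi> \<longleftrightarrow>
     (\<forall>p. \<Phi> 0 p = p \<and> (\<forall>t\<in>T. has_velocity A (\<lambda>s. \<Phi> s p) t (V (\<Phi> t p))))"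

definition submersive :: "('m, 'e::real_normed_vector) chart set \<Rightarrow>
    ('k, 'f::real_normed_vector) chart set \<Rightarrow> ('m \<Rightarrow> 'k) \<Rightarrow> bool" where
  "submersive A B f \<longleftrightarrow> (\<forall>p. surj (mderiv A B f p))"

definition real_analytic_embedding ::
    "('m::topological_space, 'e::euclidean_space) chart set \<Rightarrow>
     ('k::topological_space, 'f::euclidean_space) chart set \<Rightarrow> ('m \<Rightarrow> 'k) \<Rightarrow> bool" where
  "real_analytic_embedding A B f \<longleftrightarrow> chartwise_map real_analytic_on A B f \<and>
     (\<forall>p. inj (mderiv A B f p)) \<and> (\<exists>g. homeomorphism UNIV (range f) f g)"


section \<open>Two-forms\<close>

type_synonym ('m, 'e, 'v) two_form = "'m \<Rightarrow> 'e \<Rightarrow> 'e \<Rightarrow> 'v"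

definition pullback_form :: "('m, 'e::real_normed_vector) chart set \<Rightarrow>
    ('k, 'f::real_normed_vector) chart set \<Rightarrow> ('m \<Rightarrow> 'k) \<Rightarrow>
    ('k, 'f, 'v) two_form \<Rightarrow> ('m, 'e, 'v) two_form" where
  "pullback_form A B f \<sigma> = (\<lambda>p u v. \<sigma> (f p) (mderiv A B f p u) (mderiv A B f p v))"

text \<open>The coordinate expression of \<open>\<sigma>\<close> in the chart \<open>c\<close>, i.e. its pullback under the inverse
  of the coordinate map.\<close>

definition form_rep :: "('m, 'e::real_normed_vector) chart set \<Rightarrow> ('m, 'e, 'v) two_form \<Rightarrow>
    ('m, 'e) chart \<Rightarrow> 'e \<Rightarrow> 'e \<Rightarrow> 'e \<Rightarrow> 'v" where
  "form_rep A \<sigma> c z u v =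
     (let p = chart_inv c z; T = frechet_derivative (coord_at A p \<circ> chart_inv c) (at z)
      in \<sigma> p (T u) (T v))"

definition chartwise_form :: "(('e \<Rightarrow> 'v) \<Rightarrow> 'e set \<Rightarrow> bool) \<Rightarrow>
    ('m, 'e::real_normed_vector) chart set \<Rightarrow> ('m, 'e, 'v) two_form \<Rightarrow> bool" where
  "chartwise_form P A \<sigma> \<longleftrightarrow> (\<forall>c\<in>A. \<forall>u v. P (\<lambda>z. form_rep A \<sigma> c z u v) (snd c ` fst c))"

text \<open>The exterior derivative, evaluated on constant vector fields of a chart, vanishes.\<close>

definition closed_form :: "('m, 'e::real_normed_vector) chart set \<Rightarrow>
    ('m, 'e, 'v::real_normed_vector) two_form \<Rightarrow> bool" where
  "closed_form A \<sigma> \<longleftrightarrow> (\<forall>c\<in>A. \<forall>z\<in>snd c ` fst c. \<forall>u v w.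
     frechet_derivative (\<lambda>y. form_rep A \<sigma> c y v w) (at z) u +
     frechet_derivative (\<lambda>y. form_rep A \<sigma> c y w u) (at z) v +
     frechet_derivative (\<lambda>y. form_rep A \<sigma> c y u v) (at z) w = 0)"

definition nondegenerate_alternating ::
    "('m, 'e::real_normed_vector, 'v::real_normed_vector) two_form \<Rightarrow> bool" where
  "nondegenerate_alternating \<sigma> \<longleftrightarrow> (\<forall>p. bilinear (\<sigma> p) \<and> (\<forall>u. \<sigma> p u u = 0) \<and>
     (\<forall>u. (\<forall>v. \<sigma> p u v = 0) \<longrightarrow> u = 0))"

definition symplectic_form :: "('m, 'e::real_normed_vector) chart set \<Rightarrow>
    ('m, 'e, real) two_form \<Rightarrow> bool" where
  "symplectic_form A \<sigma> \<longleftrightarrow>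
     nondegenerate_alternating \<sigma> \<and> chartwise_form smooth_on A \<sigma> \<and> closed_form A \<sigma>"

definition holomorphic_symplectic_form :: "('m, complex^'n) chart set \<Rightarrow>
    ('m, complex^'n, complex) two_form \<Rightarrow> bool" where
  "holomorphic_symplectic_form A \<Omega> \<longleftrightarrow>
     nondegenerate_alternating \<Omega> \<and> (\<forall>p u v. \<Omega> p (J_std u) v = \<i> * \<Omega> p u v) \<and>
     chartwise_form hol_fun_on A \<Omega> \<and> closed_form A \<Omega>"

definition real_analytic_kaehler_manifold ::
    "('m::{t2_space,second_countable_topology}, complex^'n) chart set \<Rightarrow>
     ('m, complex^'n, real) two_form \<Rightarrow> bool" where
  "real_analytic_kaehler_manifold A \<omega> \<longleftrightarrow> complex_manifold A \<and> symplectic_form A \<omega> \<and>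
     chartwise_form real_analytic_on A \<omega> \<and>
     (\<forall>p u v. \<omega> p (J_std u) (J_std v) = \<omega> p u v) \<and>
     (\<forall>p u. u \<noteq> 0 \<longrightarrow> \<omega> p u (J_std u) > 0)"

definition Hamilton_field :: "('m, 'e::real_normed_vector) chart set \<Rightarrow>
    ('m, 'e, real) two_form \<Rightarrow> ('m \<Rightarrow> real) \<Rightarrow> 'm \<Rightarrow> 'e" where
  "Hamilton_field A \<sigma> f p = (THE v. \<forall>u. \<sigma> p v u = fun_deriv A f p u)"

text \<open>In a holomorphic slice chart \<open>c\<close> around \<open>p\<close>, the submanifold \<open>S\<close> is a piece of an affine
  complex subspace with direction \<open>W\<close>, and its tangent space \<open>T\<close> at \<open>p\<close> consists of the vectors
  whose coordinates in \<open>c\<close> lie in \<open>W\<close>. Lagrangian means that \<open>T\<close> is its own orthogonal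
  complement with respect to \<open>\<Omega>\<close>.\<close>

definition holomorphic_lagrangian_submanifold ::
    "('m::topological_space, complex^'n) chart set \<Rightarrow> ('m, complex^'n, complex) two_form \<Rightarrow>
     'm set \<Rightarrow> bool" where
  "holomorphic_lagrangian_submanifold A \<Omega> S \<longleftrightarrow>
     (\<forall>p\<in>S. \<exists>c W. holomorphic_chart A c \<and> p \<in> fst c \<and> vec.subspace W \<and>
        snd c ` (S \<inter> fst c) = {z \<in> snd c ` fst c. z - snd c p \<in> W} \<and>
        (let T = {u. frechet_derivative (snd c \<circ> chart_inv (chart_at A p)) (at (coord_at A p p)) u \<in> W}
         in T = {u. \<forall>v\<in>T. \<Omega> p u v = 0}))"

end

theory Submission
  imports Defs "HOL-Complex_Analysis.Cauchy_Integral_Formula"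
begin

text \<open>The field \<open>V\<close> generating the flow satisfies \<open>\<Omega>(V, \<cdot>) = dH\<close> because \<open>H\<close> is holomorphic, so the flow
  preserves both \<open>H\<close> and \<open>\<Omega>\<close>. Hence \<open>s = \<Phi>\<^sub>t \<circ> \<iota> \<circ> f\<^sub>t\<^sup>-\<^sup>1\<close> is a section of \<open>\<pi>\<close> with \<open>s\<^sup>* \<Omega> = \<omega>\<^sub>t\<close>
  and \<open>H \<circ> s = h \<circ> f\<^sub>t\<^sup>-\<^sup>1\<close>. At a point of its image, decompose \<open>V = ds(w) + l\<close> with \<open>w = d\<pi>(V)\<close> and
  \<open>l\<close> tangent to the fibre of \<open>\<pi>\<close>. As the fibre is Lagrangian, \<open>\<alpha> = \<Omega>(l, ds \<cdot>)\<close> is complex linear, and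
  \<open>\<omega>\<^sub>t(w, \<cdot>) = d(h \<circ> f\<^sub>t\<^sup>-\<^sup>1) - \<alpha>\<close> is real; eliminating \<open>\<alpha>\<close> by means of \<open>J\<close>-invariance of \<open>\<omega>\<^sub>t\<close> gives the
  formula for \<open>w\<close>.

  The flow is given only pointwise as a family of integral curves. Its differentiability in the
  initial value is obtained without solving the variational equation: difference quotients satisfy
  that equation up to a small error, so by Gronwall's inequality they form a Cauchy net. The same
  quotients, inserted into \<open>\<Omega>\<close>, show that \<open>\<Omega>\<close> is preserved. Bijectivity of \<open>f\<^sub>t\<close> comes from
  \<open>\<Pi>\<^sub>-\<^sub>t\<close>: each leaf \<open>\<Phi>\<^sub>-\<^sub>t(\<pi>\<^sup>-\<^sup>1(x))\<close> is a fibre of \<open>\<Pi>\<^sub>-\<^sub>t\<close> and meets \<open>\<iota>(M)\<close> exactly once.\<close>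

section \<open>Holomorphic functions of several variables\<close>

text \<open>Regularity is the analytic obstacle: \<open>CR_on\<close> grants one derivative at each
  point and the Hamilton field is a pointwise definite description. Cauchy's estimates on complex
  lines yield second derivatives, their symmetry and a uniform quadratic Taylor remainder; Cramer's
  rule passes holomorphy from \<Omega> and dH to the field. These are the inputs of the Gronwall
  arguments and of Cartan's formula. On the geometric side, a slice chart of a fibre gives a
  Lagrangian space that is at first only contained in the kernel of the differential of \<pi>;
  equality comes from counting dimensions. Invariance of \<open>\<omega>\<^sub>t\<close> under J is
  derived: ds is complex linear modulo that kernel, and \<Omega>(ds, ds) is real. The elimination
  runs as follows. Since \<alpha>(J u) = i \<alpha>(u), Re \<alpha>(u) = Im \<alpha>(J u). As
  \<open>\<omega>\<^sub>t\<close> is real, Im \<alpha> is the differential of the imaginary part of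
  h after the inverse, so with Y its Hamilton field Re \<alpha>(u) =
  \<open>\<omega>\<^sub>t\<close>(Y, J u) = - \<open>\<omega>\<^sub>t\<close>(J Y, u). This is where
  J enters the formula.\<close>

lemma norm_vector_smult [simp]: "norm (c *s v) = cmod c * norm (v :: complex^'n)"
  by (simp add: norm_vec_def norm_mult L2_set_right_distrib)

lemma scaleR_eq_smult: "r *\<^sub>R (v :: complex^'n) = complex_of_real r *s v"
  by (simp add: vec_eq_iff) (simp add: scaleR_conv_of_real)

lemma bounded_linear_smult_left: "bounded_linear (\<lambda>\<zeta>. \<zeta> *s (v :: complex^'n))"
  by (rule bounded_linear_intro[where K = "norm v"])
     (auto simp: vec_eq_iff algebra_simps)

lemma J_std_commuting_imp_smult:
  fixes D :: "complex^'n \<Rightarrow> complex"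
  assumes "linear D" "\<And>v. D (J_std v) = \<i> * D v"
  shows "D (\<zeta> *s v) = \<zeta> * D v"
proof -
  have "\<zeta> *s v = Re \<zeta> *\<^sub>R v + Im \<zeta> *\<^sub>R J_std v"
    by (simp add: vec_eq_iff J_std_def complex_eq_iff)
  then show ?thesis
    using assms by (simp add: linear_add linear_scale complex_eq_iff)
qed

lemma CR_onD:
  assumes "CR_on J J' f S" "z \<in> S"
  shows "(f has_derivative frechet_derivative f (at z)) (at z)"
    and "frechet_derivative f (at z) (J v) = J' (frechet_derivative f (at z) v)"
proof -
  obtain D where D: "(f has_derivative D) (at z)" "\<And>v. D (J v) = J' (D v)"
    using assms unfolding CR_on_def by blast
  moreover have "frechet_derivative f (at z) = D"
    using frechet_derivative_at[OF D(1)] by simp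
  ultimately show "(f has_derivative frechet_derivative f (at z)) (at z)"
    "frechet_derivative f (at z) (J v) = J' (frechet_derivative f (at z) v)" by auto
qed

lemma hol_fun_onD:
  assumes "hol_fun_on f S" "z \<in> S"
  shows "(f has_derivative frechet_derivative f (at z)) (at z)"
    and "frechet_derivative f (at z) (J_std v) = \<i> * frechet_derivative f (at z) v"
    and "frechet_derivative f (at z) (\<zeta> *s v) = \<zeta> * frechet_derivative f (at z) v"
proof -
  show 1: "(f has_derivative frechet_derivative f (at z)) (at z)"
    and 2: "frechet_derivative f (at z) (J_std v) = \<i> * frechet_derivative f (at z) v" for v
    using CR_onD[OF assms] by auto
  show "frechet_derivative f (at z) (\<zeta> *s v) = \<zeta> * frechet_derivative f (at z) v"
    by (rule J_std_commuting_imp_smult[OF has_derivative_linear[OF 1] 2])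
qed

text \<open>Restriction to complex lines reduces all estimates below to functions of one complex
  variable.\<close>

lemma hol_fun_on_line:
  assumes "hol_fun_on f S" "z + \<zeta> *s v \<in> S"
  shows "((\<lambda>\<zeta>. f (z + \<zeta> *s v)) has_field_derivative frechet_derivative f (at (z + \<zeta> *s v)) v) (at \<zeta>)"
proof -
  have "((\<lambda>\<zeta>. z + \<zeta> *s v) has_derivative (\<lambda>\<zeta>. \<zeta> *s v)) (at \<zeta>)"
    by (auto intro!: derivative_eq_intros bounded_linear_imp_has_derivative bounded_linear_smult_left)
  from diff_chain_at[OF this hol_fun_onD(1)[OF assms]]
  have "((\<lambda>\<zeta>. f (z + \<zeta> *s v)) has_derivative
      (\<lambda>\<eta>. frechet_derivative f (at (z + \<zeta> *s v)) (\<eta> *s v))) (at \<zeta>)"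
    by (simp add: o_def)
  then show ?thesis
    by (simp add: has_field_derivative_def hol_fun_onD(3)[OF assms] mult.commute[of _ "frechet_derivative _ _ _"])
qed

text \<open>Both bounds are one-variable Cauchy inequalities for f on the complex line through z in
  the direction of v. The second one replaces a bound on second derivatives, whose existence is not
  yet known at this stage.\<close>

lemma hol_fun_on_cauchy_estimates:
  fixes f :: "complex^'n \<Rightarrow> complex"
  assumes f: "hol_fun_on f S" and S: "open S" and r: "r > 0" "cball z r \<subseteq> S"
    and B: "\<And>w. w \<in> cball z r \<Longrightarrow> cmod (f w) \<le> B"
  shows "cmod (frechet_derivative f (at z) v) \<le> B / r * norm v"
    and "norm v \<le> r / 2 \<Longrightarrow>
      cmod (f (z + v) - f z - frechet_derivative f (at z) v) \<le> 8 * B / r\<^sup>2 * (norm v)\<^sup>2"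
proof -
  have *: "cmod (frechet_derivative f (at z) v) \<le> B / r * norm v \<and> (norm v \<le> r / 2 \<longrightarrow>
      cmod (f (z + v) - f z - frechet_derivative f (at z) v) \<le> 8 * B / r\<^sup>2 * (norm v)\<^sup>2)"
  proof (cases "v = 0")
    case True
    have "z \<in> S" using r by auto
    then show ?thesis
      using hol_fun_onD(1)[OF f, THEN has_derivative_linear] True by (simp add: linear_0)
  next
    case False
    define e where "e = (1 / norm v) *\<^sub>R v"
    have e: "norm e = 1" "v = complex_of_real (norm v) *s e"
      using False by (auto simp: e_def scaleR_eq_smult[symmetric])
    define g where "g \<zeta> = f (z + \<zeta> *s e)" for \<zeta>
    define G where "G = (\<lambda>\<zeta>. z + \<zeta> *s e) -` S"
    have "open G"
      unfolding G_def using S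
      by (intro open_vimage continuous_intros linear_continuous_on bounded_linear_smult_left)
    have der: "(g has_field_derivative frechet_derivative f (at (z + \<zeta> *s e)) e) (at \<zeta>)" if "\<zeta> \<in> G" for \<zeta>
      unfolding g_def using hol_fun_on_line[OF f] that by (simp add: G_def)
    have holg: "g holomorphic_on G"
      using der \<open>open G\<close> by (auto simp: holomorphic_on_open)
    have in_ball: "z + \<zeta> *s e \<in> cball z r" if "\<zeta> \<in> cball 0 r" for \<zeta>
      using that e(1) by (simp add: dist_norm)
    have subG: "cball 0 r \<subseteq> G"
      unfolding G_def using in_ball r(2) by blast
    have gB: "cmod (g \<zeta>) \<le> B" if "\<zeta> \<in> cball 0 r" for \<zeta>
      using B in_ball that by (simp add: g_def)
    have zS: "z \<in> S" using r by auto
    have d0: "deriv g 0 = frechet_derivative f (at z) e"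
      using DERIV_imp_deriv[OF der[of 0]] zS by (simp add: G_def)
    have dv: "frechet_derivative f (at z) v = of_real (norm v) * deriv g 0"
      unfolding d0 using hol_fun_onD(3)[OF f zS] e(2) by metis
    have "cmod ((deriv ^^ 1) g 0) \<le> fact 1 * B / r ^ 1"
      using subG holg gB r(1)
      by (intro Cauchy_inequality)
         (auto intro!: holomorphic_on_subset[OF holg] continuous_on_subset[OF holomorphic_on_imp_continuous_on[OF holg]])
    then have 1: "cmod (frechet_derivative f (at z) v) \<le> B / r * norm v"
      unfolding dv using mult_left_mono[of "cmod (deriv g 0)" "B / r" "norm v"]
      by (simp add: norm_mult mult.commute)
    have 2: "cmod (f (z + v) - f z - frechet_derivative f (at z) v) \<le> 8 * B / r\<^sup>2 * (norm v)\<^sup>2"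
      if nv: "norm v \<le> r / 2"
    proof -
      let ?D = "\<lambda>i. (deriv ^^ i) g"
      have "cmod (?D 0 (of_real (norm v)) - (\<Sum>i\<le>1. ?D i 0 * (of_real (norm v) - 0) ^ i / fact i))
          \<le> (8 * B / r\<^sup>2) * cmod (of_real (norm v) - 0) ^ Suc 1 / fact 1"
      proof (rule complex_Taylor[where S = "cball 0 (r / 2)"])
        fix i \<zeta> assume "\<zeta> \<in> cball (0::complex) (r / 2)"
        then have "\<zeta> \<in> cball 0 r" using r by simp
      then have "\<zeta> \<in> G" using subG by blast
        moreover have "?D i holomorphic_on G"
          by (intro holomorphic_higher_deriv holg \<open>open G\<close>)
        ultimately show "(?D i has_field_derivative ?D (Suc i) \<zeta>) (at \<zeta> within cball 0 (r / 2))"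
          using \<open>open G\<close> by (auto intro!: holomorphic_derivI)
      next
        \<comment> \<open>Discs of radius \<open>r / 2\<close> about points of
          \<open>cball 0 (r / 2)\<close> stay inside \<open>cball 0 r\<close>. Cauchy's bound
          \<open>fact 2 * B / (r / 2) ^ 2\<close> is the origin of the constant 8; the factor 1/2 of
          Taylor's formula is given away.\<close>
        fix \<zeta> assume \<zeta>: "\<zeta> \<in> cball (0::complex) (r / 2)"
        have sub: "cball \<zeta> (r / 2) \<subseteq> cball 0 r"
          using \<zeta> by (subst cball_subset_cball_iff) auto
        have "cmod ((deriv ^^ 2) g \<zeta>) \<le> fact 2 * B / (r / 2) ^ 2"
        proof (rule Cauchy_inequality)
          show "g holomorphic_on ball \<zeta> (r / 2)"
            by (rule holomorphic_on_subset[OF holg]) (use sub subG ball_subset_cball in blast)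
          show "continuous_on (cball \<zeta> (r / 2)) g"
            by (rule continuous_on_subset[OF holomorphic_on_imp_continuous_on[OF holg]]) (use sub subG in blast)
          show "cmod (g x) \<le> B" if "cmod (\<zeta> - x) = r / 2" for x
          proof -
            have "x \<in> cball \<zeta> (r / 2)" using that by (simp add: dist_norm)
            then show ?thesis using sub gB by blast
          qed
        qed (use r in auto)
        then show "cmod (?D (Suc 1) \<zeta>) \<le> 8 * B / r\<^sup>2"
          by (simp add: power_divide numeral_2_eq_2)
      qed (use nv r in auto)
      moreover have "g (of_real (norm v)) = f (z + v)"
        using e(2) by (simp add: g_def)
      moreover have "g 0 = f z"
        by (simp add: g_def)
      ultimately show ?thesis
        by (simp add: dv numeral_2_eq_2 algebra_simps)
    qed
    show ?thesis using 1 2 by blast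
  qed
  show "cmod (frechet_derivative f (at z) v) \<le> B / r * norm v" using * by blast
  show "norm v \<le> r / 2 \<Longrightarrow>
      cmod (f (z + v) - f z - frechet_derivative f (at z) v) \<le> 8 * B / r\<^sup>2 * (norm v)\<^sup>2"
    using * by blast
qed

lemma hol_fun_on_imp_continuous_on:
  assumes "hol_fun_on f S" shows "continuous_on S f"
  by (meson assms continuous_at_imp_continuous_on has_derivative_continuous hol_fun_onD(1))

text \<open>The difference quotients in direction \<open>v\<close> are holomorphic and converge uniformly; by the Cauchy
  estimates so do their derivatives. The third conclusion describes the limit in a way that is
  visibly symmetric in \<open>u\<close> and \<open>v\<close>.\<close>

lemma hol_fun_on_directional_derivative:
  fixes f :: "complex^'n \<Rightarrow> complex"
  assumes f: "hol_fun_on f S" and S: "open S" and z0: "z0 \<in> S"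
  obtains g' where "((\<lambda>z. frechet_derivative f (at z) v) has_derivative g') (at z0)"
    and "\<And>u. g' (J_std u) = \<i> * g' u"
    and "\<And>u. \<exists>h. h \<longlonglongrightarrow> (0::real) \<and> (\<forall>n. h n > 0) \<and>
        (\<lambda>n. (1 / h n) *\<^sub>R (frechet_derivative f (at (z0 + h n *\<^sub>R v)) u - frechet_derivative f (at z0) u))
          \<longlonglongrightarrow> g' u"
proof -
  let ?D = "\<lambda>z. frechet_derivative f (at z)"
  obtain r where r: "r > 0" "cball z0 (3 * r) \<subseteq> S"
  proof -
    obtain e where "e > 0" "cball z0 e \<subseteq> S"
      using open_contains_cball[THEN iffD1, OF S] z0 by blast
    then show ?thesis using that[of "e / 3"] by simp
  qed
  have "compact (f ` cball z0 (3 * r))"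
    by (intro compact_continuous_image continuous_on_subset[OF hol_fun_on_imp_continuous_on[OF f]] r) auto
  then obtain B where B: "\<And>w. w \<in> cball z0 (3 * r) \<Longrightarrow> cmod (f w) \<le> B"
    by (meson bounded_iff compact_imp_bounded imageI)
  \<comment> \<open>Scaled so that translation by \<open>h n *\<^sub>R v\<close> moves points by at
    most \<open>r / 2\<close>; the summand 1 covers v = 0.\<close>
  define h where "h n = r / (2 * (norm v + 1)) / real (Suc n)" for n
  have hpos: "h n > 0" for n
    using r by (simp add: h_def add_nonneg_pos)
  have hlim: "h \<longlonglongrightarrow> 0"
    unfolding h_def by (intro tendsto_divide_0[OF tendsto_const] filterlim_at_top_imp_at_infinity
        filterlim_compose[OF filterlim_real_sequentially] filterlim_Suc)
  have hv: "h n * norm v \<le> r / 2" for n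
  proof -
    have v1: "norm v + 1 > 0" by (simp add: add_nonneg_pos)
    have "h n * norm v = r / 2 * (norm v / ((norm v + 1) * real (Suc n)))"
      by (simp add: h_def)
    also have "\<dots> \<le> r / 2 * 1"
    proof (rule mult_left_mono)
      have "norm v * 1 \<le> (norm v + 1) * real (Suc n)"
        by (rule mult_mono) auto
      then show "norm v / ((norm v + 1) * real (Suc n)) \<le> 1"
        using v1 by (subst divide_le_eq_1_pos) (auto intro: mult_pos_pos)
    qed (use r in simp)
    also have "\<dots> = r / 2" by simp
    finally show ?thesis .
  qed
  have hvr: "z + h n *\<^sub>R v \<in> cball z0 (3 * r)" if "z \<in> cball z0 (2 * r)" for z n
  proof -
    have "dist z0 (z + h n *\<^sub>R v) \<le> dist z0 z + norm (h n *\<^sub>R v)"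
      using dist_triangle[of z0 "z + h n *\<^sub>R v" z] by (simp add: dist_norm)
    then show ?thesis using that hv[of n] hpos[of n] r by auto
  qed
  define q where "q n z = (1 / h n) *\<^sub>R (f (z + h n *\<^sub>R v) - f z)" for n z
  define q' where "q' n z u = (1 / h n) *\<^sub>R (?D (z + h n *\<^sub>R v) u - ?D z u)" for n z u
  have big: "z \<in> S" "z + h n *\<^sub>R v \<in> S" if "z \<in> cball z0 (2 * r)" for z n
    using that hvr[OF that, of n] r by auto
  have q_der: "(q n has_derivative q' n z) (at z)" if "z \<in> cball z0 (2 * r)" for n z
  proof -
    have "((\<lambda>z. z + h n *\<^sub>R v) has_derivative (\<lambda>u. u)) (at z)"
      by (auto intro!: derivative_eq_intros)
    from diff_chain_at[OF this hol_fun_onD(1)[OF f big(2)[OF that, of n]]]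
    have 1: "((\<lambda>z. f (z + h n *\<^sub>R v)) has_derivative ?D (z + h n *\<^sub>R v)) (at z)"
      by (simp add: o_def)
    show ?thesis
      unfolding q_def q'_def
      using 1 hol_fun_onD(1)[OF f big(1)[OF that]]
      by (intro has_derivative_scaleR_right has_derivative_diff)
  qed
  have q'J: "q' n z (J_std u) = \<i> * q' n z u" if "z \<in> cball z0 (2 * r)" for n z u
    using hol_fun_onD(2)[OF f big(1)[OF that]] hol_fun_onD(2)[OF f big(2)[OF that, of n]]
    by (simp add: q'_def scaleR_conv_of_real algebra_simps)
  have q_hol: "hol_fun_on (\<lambda>z. q n z - q m z) (ball z0 (2 * r))" for n m
    unfolding CR_on_def
  proof
    fix z assume "z \<in> ball z0 (2 * r)"
    then have z: "z \<in> cball z0 (2 * r)" by simp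
    show "\<exists>D. ((\<lambda>z. q n z - q m z) has_derivative D) (at z) \<and> (\<forall>v. D (J_std v) = \<i> * D v)"
      by (intro exI[of _ "\<lambda>u. q' n z u - q' m z u"] conjI has_derivative_diff q_der z)
         (simp only: q'J[OF z] right_diff_distrib simp_thms)
  qed
  \<comment> \<open>Dividing the quadratic Taylor remainder for the increment
    \<open>h n *\<^sub>R v\<close> by \<open>h n\<close> leaves the error
    \<open>K * h n\<close>.\<close>
  define K where "K = 8 * B / r\<^sup>2 * (norm v)\<^sup>2"
  have "B \<ge> 0" using B[of z0] r by (auto intro: order_trans[OF norm_ge_zero])
  then have K: "K \<ge> 0" by (simp add: K_def)
  have q_lim: "cmod (q n z - ?D z v) \<le> K * h n" if z: "z \<in> cball z0 (2 * r)" for n z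
  proof -
    have sub: "cball z r \<subseteq> cball z0 (3 * r)"
      using z r by (subst cball_subset_cball_iff) (auto simp: dist_commute)
    have "cmod (f (z + h n *\<^sub>R v) - f z - ?D z (h n *\<^sub>R v)) \<le> 8 * B / r\<^sup>2 * (norm (h n *\<^sub>R v))\<^sup>2"
      using sub r B hv[of n] hpos[of n] by (intro hol_fun_on_cauchy_estimates[OF f S]) auto
    then have "1 / h n * cmod (f (z + h n *\<^sub>R v) - f z - ?D z (h n *\<^sub>R v)) \<le> 1 / h n * (8 * B / r\<^sup>2 * (norm (h n *\<^sub>R v))\<^sup>2)"
      using hpos[of n] by (intro mult_left_mono) auto
    also have "\<dots> = K * h n"
      using hpos[of n] by (simp add: K_def power_mult_distrib power2_eq_square)
    also have "1 / h n * cmod (f (z + h n *\<^sub>R v) - f z - ?D z (h n *\<^sub>R v)) =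
        cmod ((1 / h n) *\<^sub>R (f (z + h n *\<^sub>R v) - f z - ?D z (h n *\<^sub>R v)))"
      using hpos[of n] by simp
    also have "(1 / h n) *\<^sub>R (f (z + h n *\<^sub>R v) - f z - ?D z (h n *\<^sub>R v)) = q n z - ?D z v"
      using hpos[of n] hol_fun_onD(1)[OF f big(1)[OF z], THEN has_derivative_linear]
      by (simp add: q_def linear_scale scaleR_diff_right)
    finally show ?thesis .
  qed
  \<comment> \<open>The difference \<open>q n - q m\<close> is holomorphic and uniformly small on
    radius 2r, so the Cauchy estimate on a disc of radius \<open>r / 2\<close> makes its derivative
    small as well.\<close>
  have q'_cauchy: "cmod (q' n z u - q' m z u) \<le> K * (h n + h m) * 2 / r * norm u"
    if z: "z \<in> ball z0 r" for z u n m
  proof -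
    have sub: "cball z (r / 2) \<subseteq> ball z0 (2 * r)"
      using z r by (subst cball_subset_ball_iff) (auto simp: dist_commute)
    have zc: "z \<in> cball z0 (2 * r)" using z r by auto
    have eq: "frechet_derivative (\<lambda>z. q n z - q m z) (at z) = (\<lambda>u. q' n z u - q' m z u)"
      by (intro frechet_derivative_at[symmetric] has_derivative_diff q_der zc)
    have "cmod (frechet_derivative (\<lambda>z. q n z - q m z) (at z) u) \<le> K * (h n + h m) / (r / 2) * norm u"
    proof (rule hol_fun_on_cauchy_estimates(1)[OF q_hol _ _ sub])
      fix w assume "w \<in> cball z (r / 2)"
      then have w: "w \<in> cball z0 (2 * r)" using sub by auto
      have "cmod (q n w - q m w) \<le> cmod (q n w - ?D w v) + cmod (q m w - ?D w v)"
        using norm_triangle_ineq4[of "q n w - ?D w v" "q m w - ?D w v"] by simp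
      also have "\<dots> \<le> K * (h n + h m)"
        using q_lim[OF w, of n] q_lim[OF w, of m] by (simp add: algebra_simps)
      finally show "cmod (q n w - q m w) \<le> K * (h n + h m)" .
    qed (use r in auto)
    then show ?thesis by (simp add: eq)
  qed
  define g' where "g' z u = lim (\<lambda>n. q' n z u)" for z u
  have q'_lim: "(\<lambda>n. q' n z u) \<longlonglongrightarrow> g' z u" if z: "z \<in> ball z0 r" for z u
  proof -
    have "Cauchy (\<lambda>n. q' n z u)"
    proof (rule CauchyI)
      fix e :: real assume e: "e > 0"
      have "(\<lambda>n. K * h n * 2 / r * norm u) \<longlonglongrightarrow> K * 0 * 2 / r * norm u"
        using r by (intro tendsto_intros hlim) auto
      then have "\<forall>\<^sub>F n in sequentially. K * h n * 2 / r * norm u < e / 2"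
        using e by (intro order_tendstoD) auto
      then obtain M where M: "\<And>n. n \<ge> M \<Longrightarrow> K * h n * 2 / r * norm u < e / 2"
        by (auto simp: eventually_sequentially)
      have "cmod (q' m z u - q' n z u) < e" if "m \<ge> M" "n \<ge> M" for m n
      proof -
        have "K * (h m + h n) * 2 / r * norm u = K * h m * 2 / r * norm u + K * h n * 2 / r * norm u"
          by (simp add: algebra_simps add_divide_distrib)
        then show ?thesis
          using q'_cauchy[OF z, of m u n] M[OF that(1)] M[OF that(2)] by linarith
      qed
      then show "\<exists>M. \<forall>m\<ge>M. \<forall>n\<ge>M. cmod (q' m z u - q' n z u) < e" by blast
    qed
    then show ?thesis
      unfolding g'_def by (simp add: Cauchy_convergent_iff convergent_LIMSEQ_iff)
  qed
  have q'_unif: "cmod (q' n z u - g' z u) \<le> K * h n * 2 / r * norm u" if z: "z \<in> ball z0 r" for z u n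
  proof (rule LIMSEQ_le)
    show "(\<lambda>m. cmod (q' n z u - q' m z u)) \<longlonglongrightarrow> cmod (q' n z u - g' z u)"
      by (intro tendsto_intros q'_lim z)
    have "(\<lambda>m. K * (h n + h m) * 2 / r * norm u) \<longlonglongrightarrow> K * (h n + 0) * 2 / r * norm u"
      using r by (intro tendsto_intros hlim) auto
    then show "(\<lambda>m. K * (h n + h m) * 2 / r * norm u) \<longlonglongrightarrow> K * h n * 2 / r * norm u"
      by simp
  qed (use q'_cauchy[OF z] in blast)
  \<comment> \<open>Uniform convergence of the derivatives together with convergence at one point
    allows termwise differentiation; the limit function is identified with the directional
    derivative afterwards.\<close>
  have "\<exists>g. \<forall>z\<in>ball z0 r. (\<lambda>n. q n z) \<longlonglongrightarrow> g z \<and> (g has_derivative g' z) (at z within ball z0 r)"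
  proof (rule has_derivative_sequence)
    show "(q n has_derivative q' n z) (at z within ball z0 r)" if "z \<in> ball z0 r" for n z
      using that r by (intro has_derivative_at_withinI[OF q_der]) auto
    show "z0 \<in> ball z0 r" using r by simp
    fix e :: real assume e: "e > 0"
    have "(\<lambda>n. K * h n * 2 / r) \<longlonglongrightarrow> K * 0 * 2 / r"
      using r by (intro tendsto_intros hlim) auto
    then have "\<forall>\<^sub>F n in sequentially. K * h n * 2 / r < e"
      using e by (intro order_tendstoD) auto
    then show "\<forall>\<^sub>F n in sequentially. \<forall>z\<in>ball z0 r. \<forall>u. norm (q' n z u - g' z u) \<le> e * norm u"
    proof (rule eventually_mono)
      fix n assume n: "K * h n * 2 / r < e"
      show "\<forall>z\<in>ball z0 r. \<forall>u. norm (q' n z u - g' z u) \<le> e * norm u"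
        using n q'_unif by (meson less_imp_le mult_right_mono norm_ge_zero order_trans)
    qed
  next
    have "(\<lambda>n. q n z0 - ?D z0 v) \<longlonglongrightarrow> 0"
    proof (rule Lim_null_comparison)
      show "\<forall>\<^sub>F n in sequentially. norm (q n z0 - ?D z0 v) \<le> K * h n"
        using q_lim r by auto
      show "(\<lambda>n. K * h n) \<longlonglongrightarrow> 0"
        using tendsto_mult[OF tendsto_const hlim, of K] by simp
    qed
    then show "(\<lambda>n. q n z0) \<longlonglongrightarrow> ?D z0 v" by (simp add: Lim_null[symmetric])
  qed auto
  then obtain g where g: "\<And>z. z \<in> ball z0 r \<Longrightarrow> (\<lambda>n. q n z) \<longlonglongrightarrow> g z"
      "\<And>z. z \<in> ball z0 r \<Longrightarrow> (g has_derivative g' z) (at z within ball z0 r)"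
    by blast
  have g_eq: "g z = ?D z v" if z: "z \<in> ball z0 r" for z
  proof -
    have zc: "z \<in> cball z0 (2 * r)" using z r by auto
    have "(\<lambda>n. q n z - ?D z v) \<longlonglongrightarrow> 0"
    proof (rule Lim_null_comparison)
      show "\<forall>\<^sub>F n in sequentially. norm (q n z - ?D z v) \<le> K * h n"
        using q_lim[OF zc] by auto
      show "(\<lambda>n. K * h n) \<longlonglongrightarrow> 0"
        using tendsto_mult[OF tendsto_const hlim, of K] by simp
    qed
    then have "(\<lambda>n. q n z) \<longlonglongrightarrow> ?D z v" by (simp add: Lim_null[symmetric])
    then show ?thesis using g(1)[OF z] LIMSEQ_unique by blast
  qed
  have z0r: "z0 \<in> ball z0 r" using r by simp
  show thesis
  proof
    have "((\<lambda>z. ?D z v) has_derivative g' z0) (at z0 within ball z0 r)"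
      by (rule has_derivative_transform[OF z0r _ g(2)[OF z0r]]) (use g_eq in auto)
    then show "((\<lambda>z. ?D z v) has_derivative g' z0) (at z0)"
      using z0r by (simp add: at_within_open[OF _ open_ball])
    show "g' z0 (J_std u) = \<i> * g' z0 u" for u
    proof (rule LIMSEQ_unique[OF q'_lim[OF z0r]])
      have "(\<lambda>n. \<i> * q' n z0 u) \<longlonglongrightarrow> \<i> * g' z0 u"
        by (intro tendsto_intros q'_lim z0r)
      then show "(\<lambda>n. q' n z0 (J_std u)) \<longlonglongrightarrow> \<i> * g' z0 u"
        using r by (simp add: q'J)
    qed
    show "\<exists>h. h \<longlonglongrightarrow> 0 \<and> (\<forall>n. h n > 0) \<and>
        (\<lambda>n. (1 / h n) *\<^sub>R (?D (z0 + h n *\<^sub>R v) u - ?D z0 u)) \<longlonglongrightarrow> g' z0 u" for u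
      using hlim hpos q'_lim[OF z0r, of u] unfolding q'_def by blast
  qed
qed

lemma hol_fun_on_frechet_derivative:
  assumes "hol_fun_on f S" "open S"
  shows "hol_fun_on (\<lambda>z. frechet_derivative f (at z) v) S"
  unfolding CR_on_def
proof
  fix z assume "z \<in> S"
  obtain g' where "((\<lambda>z. frechet_derivative f (at z) v) has_derivative g') (at z)"
    and "\<And>u. g' (J_std u) = \<i> * g' u"
    by (rule hol_fun_on_directional_derivative[OF assms \<open>z \<in> S\<close>, of v]) blast
  then show "\<exists>D. ((\<lambda>z. frechet_derivative f (at z) v) has_derivative D) (at z) \<and> (\<forall>v. D (J_std v) = \<i> * D v)"
    by blast
qed

lemma has_derivative_imp_directional_sequence:
  assumes f: "(f has_derivative D) (at z)" and h: "h \<longlonglongrightarrow> 0" "\<And>n. h n > (0::real)"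
  shows "(\<lambda>n. (1 / h n) *\<^sub>R (f (z + h n *\<^sub>R v) - f z)) \<longlonglongrightarrow> D v"
proof (cases "v = 0")
  case True
  then show ?thesis using has_derivative_linear[OF f] by (simp add: linear_0)
next
  case False
  have "(\<lambda>k. norm (f (z + k) - f z - D k) / norm k) \<midarrow>0\<rightarrow> 0"
    using f by (simp add: has_derivative_at)
  moreover have "filterlim (\<lambda>n. h n *\<^sub>R v) (at 0) sequentially"
    unfolding filterlim_at using False h(2) tendsto_scaleR[OF h(1) tendsto_const, of v]
    by (auto simp: less_imp_neq[THEN not_sym])
  ultimately have "(\<lambda>n. norm (f (z + h n *\<^sub>R v) - f z - D (h n *\<^sub>R v)) / norm (h n *\<^sub>R v)) \<longlonglongrightarrow> 0"
    by (rule filterlim_compose)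
  then have "(\<lambda>n. norm v * (norm (f (z + h n *\<^sub>R v) - f z - D (h n *\<^sub>R v)) / norm (h n *\<^sub>R v))) \<longlonglongrightarrow> norm v * 0"
    by (rule tendsto_mult[OF tendsto_const])
  moreover have "norm v * (norm (f (z + h n *\<^sub>R v) - f z - D (h n *\<^sub>R v)) / norm (h n *\<^sub>R v)) =
      norm ((1 / h n) *\<^sub>R (f (z + h n *\<^sub>R v) - f z) - D v)" for n
  proof -
    have "f (z + h n *\<^sub>R v) - f z - D (h n *\<^sub>R v) = h n *\<^sub>R ((1 / h n) *\<^sub>R (f (z + h n *\<^sub>R v) - f z) - D v)"
      using h(2)[of n] has_derivative_linear[OF f] by (simp add: linear_scale scaleR_diff_right)
    then show ?thesis
      using h(2)[of n] False by (simp add: less_imp_neq[THEN not_sym])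
  qed
  ultimately have "(\<lambda>n. norm ((1 / h n) *\<^sub>R (f (z + h n *\<^sub>R v) - f z) - D v)) \<longlonglongrightarrow> 0"
    by simp
  then show ?thesis
    by (simp add: Lim_null[of _ "D v"] tendsto_norm_zero_iff)
qed

text \<open>One and the same sequence of quotients has two limits: \<open>g' u\<close> by the
  construction of the directional derivative, and the derivative in direction v of the map sending z
  to \<open>frechet_derivative f (at z) u\<close>, because that map is itself
  differentiable.\<close>

lemma hol_fun_on_second_derivative_symmetric:
  assumes f: "hol_fun_on f S" and S: "open S" and z: "z \<in> S"
  shows "frechet_derivative (\<lambda>z. frechet_derivative f (at z) v) (at z) u =
    frechet_derivative (\<lambda>z. frechet_derivative f (at z) u) (at z) v"
proof -
  obtain g' where g': "((\<lambda>z. frechet_derivative f (at z) v) has_derivative g') (at z)"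
    and seq: "\<And>u. \<exists>h. h \<longlonglongrightarrow> (0::real) \<and> (\<forall>n. h n > 0) \<and>
        (\<lambda>n. (1 / h n) *\<^sub>R (frechet_derivative f (at (z + h n *\<^sub>R v)) u - frechet_derivative f (at z) u))
          \<longlonglongrightarrow> g' u"
    by (rule hol_fun_on_directional_derivative[OF f S z, of v]) blast
  obtain h where h: "h \<longlonglongrightarrow> (0::real)" "\<And>n. h n > 0"
    and lim: "(\<lambda>n. (1 / h n) *\<^sub>R (frechet_derivative f (at (z + h n *\<^sub>R v)) u - frechet_derivative f (at z) u))
          \<longlonglongrightarrow> g' u"
    using seq[of u] by blast
  have "(\<lambda>n. (1 / h n) *\<^sub>R (frechet_derivative f (at (z + h n *\<^sub>R v)) u - frechet_derivative f (at z) u))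
          \<longlonglongrightarrow> frechet_derivative (\<lambda>z. frechet_derivative f (at z) u) (at z) v"
    by (rule has_derivative_imp_directional_sequence[OF hol_fun_onD(1)[OF hol_fun_on_frechet_derivative[OF f S] z] h])
  then have "frechet_derivative (\<lambda>z. frechet_derivative f (at z) u) (at z) v = g' u"
    using lim by (rule LIMSEQ_unique)
  then show ?thesis
    by (simp add: frechet_derivative_at[OF g', symmetric])
qed


section \<open>Algebra of holomorphic functions and holomorphic linear systems\<close>

lemma hol_fun_on_const: "hol_fun_on (\<lambda>z. c) S"
  unfolding CR_on_def by (auto intro!: exI[of _ "\<lambda>_. 0"])

lemma hol_fun_on_add:
  assumes "hol_fun_on f S" "hol_fun_on g S"
  shows "hol_fun_on (\<lambda>z. f z + g z) S"
  unfolding CR_on_def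
proof
  fix z assume "z \<in> S"
  note f = hol_fun_onD(1,2)[OF assms(1) this] and g = hol_fun_onD(1,2)[OF assms(2) this]
  show "\<exists>D. ((\<lambda>z. f z + g z) has_derivative D) (at z) \<and> (\<forall>v. D (J_std v) = \<i> * D v)"
    by (rule exI, rule conjI[OF has_derivative_add[OF f(1) g(1)]])
       (simp add: f(2) g(2) algebra_simps)
qed

lemma hol_fun_on_mult:
  assumes "hol_fun_on f S" "hol_fun_on g S"
  shows "hol_fun_on (\<lambda>z. f z * g z) S"
  unfolding CR_on_def
proof
  fix z assume "z \<in> S"
  note f = hol_fun_onD(1,2)[OF assms(1) this] and g = hol_fun_onD(1,2)[OF assms(2) this]
  show "\<exists>D. ((\<lambda>z. f z * g z) has_derivative D) (at z) \<and> (\<forall>v. D (J_std v) = \<i> * D v)"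
    by (rule exI, rule conjI[OF has_derivative_mult[OF f(1) g(1)]])
       (simp add: f(2) g(2) algebra_simps)
qed

lemma hol_fun_on_divide:
  assumes "hol_fun_on f S" "hol_fun_on g S" "\<And>z. z \<in> S \<Longrightarrow> g z \<noteq> 0"
  shows "hol_fun_on (\<lambda>z. f z / g z) S"
  unfolding CR_on_def
proof
  fix z assume z: "z \<in> S"
  note f = hol_fun_onD(1,2)[OF assms(1) this] and g = hol_fun_onD(1,2)[OF assms(2) this]
  show "\<exists>D. ((\<lambda>z. f z / g z) has_derivative D) (at z) \<and> (\<forall>v. D (J_std v) = \<i> * D v)"
    by (rule exI, rule conjI[OF has_derivative_divide'[OF f(1) g(1) assms(3)[OF z]]])
       (simp add: f(2) g(2) diff_divide_distrib algebra_simps)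
qed

lemma hol_fun_on_sum:
  "(\<And>i. i \<in> I \<Longrightarrow> hol_fun_on (f i) S) \<Longrightarrow> hol_fun_on (\<lambda>z. \<Sum>i\<in>I. f i z) S"
  by (induction I rule: infinite_finite_induct) (auto intro: hol_fun_on_const hol_fun_on_add)

lemma hol_fun_on_prod:
  "(\<And>i. i \<in> I \<Longrightarrow> hol_fun_on (f i) S) \<Longrightarrow> hol_fun_on (\<lambda>z. \<Prod>i\<in>I. f i z) S"
  by (induction I rule: infinite_finite_induct) (auto intro: hol_fun_on_const hol_fun_on_mult)

lemma hol_fun_on_det:
  fixes A :: "complex^'d \<Rightarrow> complex^'n^'n"
  assumes "\<And>i j. hol_fun_on (\<lambda>z. A z $ i $ j) S"
  shows "hol_fun_on (\<lambda>z. det (A z)) S"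
  unfolding det_def
  by (rule hol_fun_on_sum, rule hol_fun_on_mult[OF hol_fun_on_const], rule hol_fun_on_prod, rule assms)

lemma vec_eq_sum_axis: "v = (\<Sum>i\<in>UNIV. v $ i *s axis i (1::complex))"
  by (simp add: vec_eq_iff axis_def if_distrib[of "\<lambda>x. _ * x"] cong: if_cong)

lemma hol_fun_on_cong:
  assumes "open S" "\<And>z. z \<in> S \<Longrightarrow> f z = g z" "hol_fun_on f S"
  shows "hol_fun_on g S"
  using assms has_derivative_transform_within_open[of f _ _ UNIV S g]
  unfolding CR_on_def by (metis (no_types, lifting))

text \<open>Cramer's rule, applied to the coefficient matrix of the form.\<close>

lemma hol_fun_on_form_solution:
  fixes W :: "complex^'d \<Rightarrow> complex^'d \<Rightarrow> complex^'d \<Rightarrow> complex"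
  assumes S: "open S"
    and W: "\<And>u v. hol_fun_on (\<lambda>z. W z u v) S"
    and bil: "\<And>z. z \<in> S \<Longrightarrow> bilinear (W z)"
    and J1: "\<And>z u v. z \<in> S \<Longrightarrow> W z (J_std u) v = \<i> * W z u v"
    and J2: "\<And>z u v. z \<in> S \<Longrightarrow> W z u (J_std v) = \<i> * W z u v"
    and nondeg: "\<And>z u. z \<in> S \<Longrightarrow> (\<And>v. W z u v = 0) \<Longrightarrow> u = 0"
    and b: "\<And>v. hol_fun_on (\<lambda>z. b z v) S"
    and V: "\<And>z u. z \<in> S \<Longrightarrow> W z (V z) u = b z u"
  shows "hol_fun_on (\<lambda>z. V z $ k) S"
proof -
  \<comment> \<open>Rows are indexed by the second argument of the form, so \<open>A z *v u\<close>
    lists the values \<open>W z u (axis i 1)\<close>. A kernel vector then annihilates everything in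
    its first slot, which nondegeneracy excludes.\<close>
  define A :: "complex^'d \<Rightarrow> complex^'d^'d"
    where "A z = (\<chi> i j. W z (axis j 1) (axis i 1))" for z
  define B where "B z = (\<chi> i. b z (axis i 1))" for z
  have lin1: "linear (\<lambda>u. W z u v)" and lin2: "linear (W z u)" if "z \<in> S" for z u v
    using bil[OF that] by (auto simp: bilinear_def)
  have sm1: "W z (c *s u) v = c * W z u v" if "z \<in> S" for z c u v
    using J_std_commuting_imp_smult[of "\<lambda>u. W z u v"] lin1[OF that] J1[OF that] by blast
  have sm2: "W z u (c *s v) = c * W z u v" if "z \<in> S" for z c u v
    using J_std_commuting_imp_smult[of "W z u"] lin2[OF that] J2[OF that] by blast
  have mult: "(A z *v u) $ i = W z u (axis i 1)" if "z \<in> S" for z u i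
  proof -
    have "W z u (axis i 1) = W z (\<Sum>j\<in>UNIV. u $ j *s axis j 1) (axis i 1)"
      using vec_eq_sum_axis[of u] by simp
    also have "\<dots> = (\<Sum>j\<in>UNIV. u $ j * W z (axis j 1) (axis i 1))"
      by (simp add: linear_sum[OF lin1[OF that]] sm1[OF that])
    finally show ?thesis
      by (simp add: A_def matrix_vector_mult_def mult.commute)
  qed
  have det: "det (A z) \<noteq> 0" if "z \<in> S" for z
  proof -
    have "u = 0" if u: "A z *v u = 0" for u
    proof (rule nondeg[OF \<open>z \<in> S\<close>])
      fix v
      have "W z u (axis i 1) = 0" for i
        using mult[OF \<open>z \<in> S\<close>, of u i] u by simp
      then have "W z u (\<Sum>i\<in>UNIV. v $ i *s axis i 1) = 0"
        by (simp add: linear_sum[OF lin2[OF \<open>z \<in> S\<close>]] sm2[OF \<open>z \<in> S\<close>])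
      then show "W z u v = 0"
        using vec_eq_sum_axis[of v] by simp
    qed
    then have "\<exists>B. B ** A z = mat 1"
      by (simp add: matrix_left_invertible_ker)
    then have "invertible (A z)"
      using invertible_left_inverse by blast
    then show ?thesis
      using invertible_det_nz by blast
  qed
  have eq: "V z $ k = det (\<chi> i j. if j = k then B z $ i else A z $ i $ j) / det (A z)" if "z \<in> S" for z
  proof -
    have "A z *v V z = B z"
      using that by (simp add: vec_eq_iff mult V B_def)
    then show ?thesis
      using cramer[OF det[OF that]] by simp
  qed
  have hol: "hol_fun_on (\<lambda>z. det (\<chi> i j. if j = k then B z $ i else A z $ i $ j) / det (A z)) S"
  proof (rule hol_fun_on_divide[OF hol_fun_on_det hol_fun_on_det det])
    show "hol_fun_on (\<lambda>z. (\<chi> i j. if j = k then B z $ i else A z $ i $ j) $ i $ j) S" for i j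
      by (cases "j = k") (simp_all add: A_def B_def W b)
  qed (simp_all add: A_def W)
  show ?thesis
    by (rule hol_fun_on_cong[OF S _ hol]) (simp add: eq)
qed

section \<open>Uniform local bounds for vector-valued holomorphic maps\<close>

lemma norm_le_sum_component_bounds:
  fixes v :: "complex^'m" and c :: real
  assumes "\<And>k. cmod (v $ k) \<le> c"
  shows "norm v \<le> CARD('m) * c"
proof -
  have "norm v \<le> (\<Sum>k\<in>UNIV. cmod (v $ k))"
    unfolding norm_vec_def by (rule L2_set_le_sum) simp
  also have "\<dots> \<le> (\<Sum>k\<in>(UNIV::'m set). c)"
    by (intro sum_mono assms)
  finally show ?thesis by simp
qed

lemma has_derivative_vec_components:
  fixes V :: "'a::real_normed_vector \<Rightarrow> complex^'m"
  assumes "\<And>k. ((\<lambda>z. V z $ k) has_derivative D k) (at z)"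
  shows "(V has_derivative (\<lambda>u. \<chi> k. D k u)) (at z)"
proof -
  have "((\<lambda>z. \<Sum>k\<in>UNIV. V z $ k *s axis k 1) has_derivative (\<lambda>u. \<Sum>k\<in>UNIV. D k u *s axis k 1)) (at z)"
    by (intro has_derivative_sum bounded_linear.has_derivative[OF bounded_linear_smult_left] assms)
  moreover have "(\<lambda>u. \<Sum>k\<in>UNIV. D k u *s axis k 1) = (\<lambda>u. \<chi> k. D k u)"
    using vec_eq_sum_axis[of "\<chi> k. D k _"] by simp
  ultimately show ?thesis
    using vec_eq_sum_axis[of "V _"] by simp
qed

text \<open>Collects what Gronwall's inequality needs of a vector field: a bound on the derivative,
  a Lipschitz constant and a quadratic remainder, all uniform on one ball. They are the
  componentwise Cauchy estimates, the number of components entering as a factor.\<close>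

lemma hol_fun_components_local_estimates:
  fixes V :: "complex^'d \<Rightarrow> complex^'m"
  assumes V: "\<And>k. hol_fun_on (\<lambda>z. V z $ k) S" and S: "open S" and z0: "z0 \<in> S"
  obtains r L C V' where "r > 0" "ball z0 r \<subseteq> S" "L \<ge> 0" "C \<ge> 0"
    and "\<And>z. z \<in> ball z0 r \<Longrightarrow> (V has_derivative V' z) (at z)"
    and "\<And>z u. z \<in> ball z0 r \<Longrightarrow> norm (V' z u) \<le> L * norm u"
    and "\<And>z w. z \<in> ball z0 r \<Longrightarrow> w \<in> ball z0 r \<Longrightarrow>
      norm (V w - V z - V' z (w - z)) \<le> C * (norm (w - z))\<^sup>2"
    and "\<And>z w. z \<in> ball z0 r \<Longrightarrow> w \<in> ball z0 r \<Longrightarrow> norm (V w - V z) \<le> L * norm (w - z)"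
proof -
  obtain e where e: "e > 0" "cball z0 e \<subseteq> S"
    using open_contains_cball[THEN iffD1, OF S] z0 by blast
  define R where "R = e / 2"
  have R: "R > 0" "cball z0 (2 * R) \<subseteq> S" using e by (auto simp: R_def)
  define V' where "V' z u = (\<chi> k. frechet_derivative (\<lambda>z. V z $ k) (at z) u)" for z u
  have der: "(V has_derivative V' z) (at z)" if "z \<in> S" for z
    unfolding V'_def by (rule has_derivative_vec_components[OF hol_fun_onD(1)[OF V that]])
  then have "continuous_on S V"
    by (meson continuous_at_imp_continuous_on has_derivative_continuous)
  then have "compact (V ` cball z0 (2 * R))"
    by (intro compact_continuous_image continuous_on_subset[OF _ R(2)]) auto
  then obtain B where B: "\<And>w. w \<in> cball z0 (2 * R) \<Longrightarrow> norm (V w) \<le> B"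
    by (meson bounded_iff compact_imp_bounded imageI)
  have Bk: "cmod (V w $ k) \<le> B" if "w \<in> cball z0 (2 * R)" for w k
    using B[OF that] Finite_Cartesian_Product.norm_nth_le[of "V w" k] by simp
  have "B \<ge> 0" using B[of z0] R by (auto intro: order_trans[OF norm_ge_zero])
  \<comment> \<open>Points of \<open>ball z0 r\<close> have discs of radius R inside
    \<open>cball z0 (2 * R)\<close>, and any two of them are less than \<open>R / 2\<close> apart,
    as the quadratic estimate demands.\<close>
  define r where "r = R / 4"
  have sub: "cball z R \<subseteq> cball z0 (2 * R)" if "z \<in> ball z0 r" for z
    using that R by (subst cball_subset_cball_iff) (auto simp: r_def dist_commute)
  define L where "L = CARD('m) * (B / R)"
  define C where "C = CARD('m) * (8 * B / R\<^sup>2)"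
  have L: "L \<ge> 0" and C: "C \<ge> 0" using \<open>B \<ge> 0\<close> R by (auto simp: L_def C_def)
  have rS: "ball z0 r \<subseteq> S" using R by (auto simp: r_def)
  have V'L: "norm (V' z u) \<le> L * norm u" if z: "z \<in> ball z0 r" for z u
  proof -
    have "norm (V' z u) \<le> CARD('m) * (B / R * norm u)"
    proof (rule norm_le_sum_component_bounds)
      show "cmod (V' z u $ k) \<le> B / R * norm u" for k
        unfolding V'_def vec_lambda_beta
        by (rule hol_fun_on_cauchy_estimates(1)[OF V S R(1)]) (use sub[OF z] R(2) Bk in auto)
    qed
    then show ?thesis by (simp add: L_def mult.assoc)
  qed
  show thesis
  proof (rule that[OF _ rS L C der])
    show "r > 0" using R by (simp add: r_def)
    show "z \<in> S" if "z \<in> ball z0 r" for z using that rS by blast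
    show "norm (V' z u) \<le> L * norm u" if "z \<in> ball z0 r" for z u by (rule V'L[OF that])
    show "norm (V w - V z - V' z (w - z)) \<le> C * (norm (w - z))\<^sup>2"
      if z: "z \<in> ball z0 r" and w: "w \<in> ball z0 r" for z w
    proof -
      have "dist w z < R / 2"
        using z w dist_triangle[of w z z0] by (simp add: r_def dist_commute)
      then have wz: "norm (w - z) \<le> R / 2" by (simp add: dist_norm)
      have "norm (V w - V z - V' z (w - z)) \<le> CARD('m) * (8 * B / R\<^sup>2 * (norm (w - z))\<^sup>2)"
      proof (rule norm_le_sum_component_bounds)
        fix k
        have "cmod (V (z + (w - z)) $ k - V z $ k - frechet_derivative (\<lambda>z. V z $ k) (at z) (w - z))
            \<le> 8 * B / R\<^sup>2 * (norm (w - z))\<^sup>2"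
          by (rule hol_fun_on_cauchy_estimates(2)[OF V S R(1) _ _ wz]) (use sub[OF z] R(2) Bk in auto)
        then show "cmod ((V w - V z - V' z (w - z)) $ k) \<le> 8 * B / R\<^sup>2 * (norm (w - z))\<^sup>2"
          by (simp add: V'_def)
      qed
      then show ?thesis by (simp add: C_def mult.assoc)
    qed
    show "norm (V w - V z) \<le> L * norm (w - z)" if z: "z \<in> ball z0 r" and w: "w \<in> ball z0 r" for z w
    proof (rule differentiable_bound[OF convex_ball _ _ w z])
      show "(V has_derivative V' z) (at z within ball z0 r)" if "z \<in> ball z0 r" for z
        using der that rS by (blast intro: has_derivative_at_withinI)
      show "onorm (V' z) \<le> L" if "z \<in> ball z0 r" for z
        using V'L[OF that] L by (intro onorm_bound) auto
    qed
  qed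
qed

section \<open>Differentiability of local flows\<close>

text \<open>The square is used because the norm is not differentiable at 0. The summand
  \<open>e\<^sup>2\<close> absorbs the inhomogeneity: by Cauchy-Schwarz and
  \<open>2 * norm (u s) * e \<le> (norm (u s))\<^sup>2 + e\<^sup>2\<close>, the quantity
  \<open>(norm (u s))\<^sup>2 + e\<^sup>2\<close> grows at rate at most
  \<open>2 * L + 1\<close>.\<close>

lemma gronwall_norm_square:
  fixes u :: "real \<Rightarrow> 'a::real_inner"
  assumes ab: "a \<le> b" and L: "L \<ge> 0"
    and u: "\<And>s. s \<in> {a..b} \<Longrightarrow> (u has_vector_derivative u' s) (at s)"
    and u': "\<And>s. s \<in> {a..b} \<Longrightarrow> norm (u' s) \<le> L * norm (u s) + e"
  shows "(norm (u b))\<^sup>2 + e\<^sup>2 \<le> ((norm (u a))\<^sup>2 + e\<^sup>2) * exp ((2 * L + 1) * (b - a))"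
proof -
  let ?W = "\<lambda>s. (u s \<bullet> u s + e\<^sup>2) * exp (- (2 * L + 1) * s)"
  have "?W b \<le> ?W a"
  proof (rule deriv_nonpos_imp_antimono[OF _ _ ab])
    fix s assume s: "s \<in> {a..b}"
    show "(?W has_real_derivative
        (2 * (u s \<bullet> u' s) - (2 * L + 1) * (u s \<bullet> u s + e\<^sup>2)) * exp (- (2 * L + 1) * s)) (at s)"
    proof -
      have "((\<lambda>s. u s \<bullet> u s) has_derivative (\<lambda>h. u s \<bullet> (h *\<^sub>R u' s) + (h *\<^sub>R u' s) \<bullet> u s)) (at s)"
        using u[OF s] unfolding has_vector_derivative_def by (intro has_derivative_inner)
      then have "((\<lambda>s. u s \<bullet> u s) has_real_derivative 2 * (u s \<bullet> u' s)) (at s)"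
        unfolding has_field_derivative_def by (rule has_derivative_eq_rhs) (auto simp: inner_commute algebra_simps)
      then show ?thesis
        by (auto intro!: derivative_eq_intros simp: algebra_simps)
    qed
    have "2 * (u s \<bullet> u' s) \<le> 2 * (norm (u s) * norm (u' s))"
      using norm_cauchy_schwarz by auto
    also have "\<dots> \<le> 2 * (norm (u s) * (L * norm (u s) + e))"
      using u'[OF s] by (intro mult_left_mono) auto
    also have "\<dots> = 2 * L * (norm (u s))\<^sup>2 + 2 * norm (u s) * e"
      by (simp add: power2_eq_square algebra_simps)
    also have "\<dots> \<le> 2 * L * (norm (u s))\<^sup>2 + ((norm (u s))\<^sup>2 + e\<^sup>2)"
      using sum_squares_bound[of "norm (u s)" e] by simp
    also have "\<dots> \<le> (2 * L + 1) * (u s \<bullet> u s + e\<^sup>2)"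
      using L by (simp add: power2_norm_eq_inner algebra_simps)
    finally show "(2 * (u s \<bullet> u' s) - (2 * L + 1) * (u s \<bullet> u s + e\<^sup>2)) * exp (- (2 * L + 1) * s) \<le> 0"
      by (intro mult_nonpos_nonneg) auto
  qed
  then have "?W b * exp ((2 * L + 1) * b) \<le> ?W a * exp ((2 * L + 1) * b)"
    by (rule mult_right_mono) simp
  moreover have "?W b * exp ((2 * L + 1) * b) = u b \<bullet> u b + e\<^sup>2"
    by (simp add: mult.assoc mult_exp_exp algebra_simps)
  moreover have "?W a * exp ((2 * L + 1) * b) = (u a \<bullet> u a + e\<^sup>2) * exp ((2 * L + 1) * (b - a))"
    by (simp add: mult.assoc mult_exp_exp algebra_simps)
  ultimately show ?thesis
    by (simp only: power2_norm_eq_inner)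
qed

text \<open>A square root of the previous bound, with \<open>2 * L + 1\<close> enlarged to
  \<open>2 * (L + 1)\<close> so that the exponential is a square. Backward time is reduced to
  forward time by reflection, whence the formulation with \<open>closed_segment\<close>.\<close>

lemma gronwall:
  fixes u :: "real \<Rightarrow> 'a::real_inner"
  assumes L: "L \<ge> 0" and e: "e \<ge> 0"
    and u: "\<And>s. s \<in> closed_segment a b \<Longrightarrow> (u has_vector_derivative u' s) (at s)"
    and u': "\<And>s. s \<in> closed_segment a b \<Longrightarrow> norm (u' s) \<le> L * norm (u s) + e"
  shows "norm (u b) \<le> (norm (u a) + e) * exp ((L + 1) * \<bar>b - a\<bar>)"
proof -
  have sq: "(norm (u b))\<^sup>2 + e\<^sup>2 \<le> ((norm (u a))\<^sup>2 + e\<^sup>2) * exp ((2 * L + 1) * \<bar>b - a\<bar>)"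
  proof (cases "a \<le> b")
    case True
    then show ?thesis
      using gronwall_norm_square[OF True L, of u u' e] u u' by (simp add: closed_segment_eq_real_ivl)
  next
    case False
    have seg: "- s \<in> closed_segment a b" if "s \<in> {-a..-b}" for s
      using that False by (auto simp: closed_segment_eq_real_ivl)
    have "((\<lambda>s. u (- s)) has_vector_derivative - u' (- s)) (at s)" if "s \<in> {-a..-b}" for s
      using vector_diff_chain_at[of uminus "-1" s u "u' (- s)"] u[OF seg[OF that]]
      by (simp add: o_def has_vector_derivative_minus has_vector_derivative_id
          has_vector_derivative_minus[OF has_vector_derivative_id, simplified])
    then have "(norm (u (- (- b))))\<^sup>2 + e\<^sup>2 \<le> ((norm (u (- (- a))))\<^sup>2 + e\<^sup>2) * exp ((2 * L + 1) * (- b - (- a)))"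
      using False L u'[OF seg]
      by (intro gronwall_norm_square[where u = "\<lambda>s. u (- s)" and u' = "\<lambda>s. - u' (- s)"]) auto
    then show ?thesis using False by simp
  qed
  have "(norm (u b))\<^sup>2 \<le> ((norm (u a))\<^sup>2 + e\<^sup>2) * exp ((2 * L + 1) * \<bar>b - a\<bar>)"
    using sq by (smt (verit) zero_le_power2)
  also have "\<dots> \<le> (norm (u a) + e)\<^sup>2 * exp (2 * ((L + 1) * \<bar>b - a\<bar>))"
    using e by (intro mult_mono) (auto simp: power2_sum algebra_simps)
  also have "\<dots> = ((norm (u a) + e) * exp ((L + 1) * \<bar>b - a\<bar>))\<^sup>2"
    by (simp add: power_mult_distrib exp_double)
  finally show ?thesis
    by (rule power2_le_imp_le) (use e in simp)
qed

text \<open>The approximating linear maps form a Cauchy net, whose limit is the derivative.\<close>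

lemma differentiable_of_linear_approximations:
  fixes f :: "'a::euclidean_space \<Rightarrow> 'b::banach"
  assumes approx: "\<And>e. e > 0 \<Longrightarrow>
      \<exists>A. linear A \<and> (\<exists>d>0. \<forall>y. norm (y - x) < d \<longrightarrow> norm (f y - f x - A (y - x)) \<le> e * norm (y - x))"
  shows "f differentiable (at x)"
proof -
  have "\<exists>A d. linear A \<and> d > 0 \<and>
      (\<forall>y. norm (y - x) < d \<longrightarrow> norm (f y - f x - A (y - x)) \<le> inverse (real (Suc n)) * norm (y - x))" for n
    using approx[of "inverse (real (Suc n))"] by auto
  then obtain A d where A: "\<And>n. linear (A n)" and d: "\<And>n. d n > (0::real)"
    and le: "\<And>n y. norm (y - x) < d n \<Longrightarrow> norm (f y - f x - A n (y - x)) \<le> inverse (real (Suc n)) * norm (y - x)"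
    by metis
  \<comment> \<open>Both maps approximate the same increment of f at a point x + s v close to x;
    linearity divides out s, so that a bound proved for short vectors holds for every v.\<close>
  have close: "norm (A n v - A m v) \<le> (inverse (real (Suc n)) + inverse (real (Suc m))) * norm v" for n m v
  proof (cases "v = 0")
    case True
    then show ?thesis by (simp add: linear_0[OF A])
  next
    case False
    define s where "s = min (d n) (d m) / (2 * norm v)"
    have s: "s > 0" using d[of n] d[of m] False by (simp add: s_def)
    have sv: "norm (x + s *\<^sub>R v - x) < d n" "norm (x + s *\<^sub>R v - x) < d m"
      using s False d[of n] d[of m] by (auto simp: s_def)
    have "s * norm (A n v - A m v) = norm (A n (s *\<^sub>R v) - A m (s *\<^sub>R v))"
      using s by (simp add: linear_scale[OF A] scaleR_diff_right[symmetric])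
    also have "\<dots> \<le> norm (f (x + s *\<^sub>R v) - f x - A m (s *\<^sub>R v)) + norm (f (x + s *\<^sub>R v) - f x - A n (s *\<^sub>R v))"
      using norm_triangle_ineq4[of "f (x + s *\<^sub>R v) - f x - A m (s *\<^sub>R v)" "f (x + s *\<^sub>R v) - f x - A n (s *\<^sub>R v)"]
      by simp
    also have "\<dots> \<le> inverse (real (Suc m)) * norm (s *\<^sub>R v) + inverse (real (Suc n)) * norm (s *\<^sub>R v)"
      using le[OF sv(1)] le[OF sv(2)] by simp
    also have "\<dots> = s * ((inverse (real (Suc n)) + inverse (real (Suc m))) * norm v)"
      using s by (simp add: algebra_simps)
    finally show ?thesis using s by simp
  qed
  define D where "D v = lim (\<lambda>n. A n v)" for v
  have inv0: "(\<lambda>n. inverse (real (Suc n))) \<longlonglongrightarrow> 0"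
    by (rule LIMSEQ_inverse_real_of_nat)
  have lim: "(\<lambda>n. A n v) \<longlonglongrightarrow> D v" for v
  proof -
    have "Cauchy (\<lambda>n. A n v)"
    proof (rule CauchyI)
      fix e :: real assume e: "e > 0"
      have "(\<lambda>n. inverse (real (Suc n)) * norm v) \<longlonglongrightarrow> 0"
        using tendsto_mult[OF inv0 tendsto_const] by simp
      then have "\<forall>\<^sub>F n in sequentially. inverse (real (Suc n)) * norm v < e / 2"
        using e by (intro order_tendstoD) auto
      then obtain M where M: "\<And>n. n \<ge> M \<Longrightarrow> inverse (real (Suc n)) * norm v < e / 2"
        by (auto simp: eventually_sequentially)
      have "norm (A m v - A n v) < e" if "m \<ge> M" "n \<ge> M" for m n
        using close[of m v n] M[OF that(1)] M[OF that(2)] by (simp add: distrib_right)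
      then show "\<exists>M. \<forall>m\<ge>M. \<forall>n\<ge>M. norm (A m v - A n v) < e" by blast
    qed
    then show ?thesis
      unfolding D_def by (simp add: Cauchy_convergent_iff convergent_LIMSEQ_iff)
  qed
  have D: "linear D"
  proof (rule linearI)
    show "D (u + v) = D u + D v" for u v
      using LIMSEQ_unique[OF lim[of "u + v"]] tendsto_add[OF lim[of u] lim[of v]] by (simp add: linear_add[OF A])
    show "D (r *\<^sub>R v) = r *\<^sub>R D v" for r v
      using LIMSEQ_unique[OF lim[of "r *\<^sub>R v"]] tendsto_scaleR[OF tendsto_const lim[of v]] by (simp add: linear_scale[OF A])
  qed
  have near: "norm (A n v - D v) \<le> inverse (real (Suc n)) * norm v" for n v
  proof (rule LIMSEQ_le)
    show "(\<lambda>m. norm (A n v - A m v)) \<longlonglongrightarrow> norm (A n v - D v)"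
      by (intro tendsto_intros lim)
    show "(\<lambda>m. (inverse (real (Suc n)) + inverse (real (Suc m))) * norm v) \<longlonglongrightarrow> inverse (real (Suc n)) * norm v"
      using tendsto_mult[OF tendsto_add[OF tendsto_const inv0] tendsto_const] by (simp del: of_nat_Suc)
  qed (use close in blast)
  have "(f has_derivative D) (at x)"
    unfolding has_derivative_at_alt
  proof (intro conjI allI impI)
    show "bounded_linear D" using D linear_conv_bounded_linear by blast
    fix e :: real assume "e > 0"
    then obtain n where n: "inverse (real (Suc n)) < e / 2"
      using reals_Archimedean[of "e / 2"] by auto
    show "\<exists>d>0. \<forall>y. norm (y - x) < d \<longrightarrow> norm (f y - f x - D (y - x)) \<le> e * norm (y - x)"
    proof (intro exI conjI allI impI)
      show "d n > 0" by (rule d)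
      fix y assume y: "norm (y - x) < d n"
      have "norm (f y - f x - D (y - x)) \<le> norm (f y - f x - A n (y - x)) + norm (A n (y - x) - D (y - x))"
        using norm_triangle_ineq[of "f y - f x - A n (y - x)" "A n (y - x) - D (y - x)"] by simp
      also have "\<dots> \<le> 2 * inverse (real (Suc n)) * norm (y - x)"
        using le[OF y] near[of n "y - x"] by simp
      also have "\<dots> \<le> e * norm (y - x)"
        using n by (intro mult_right_mono) auto
      finally show "norm (f y - f x - D (y - x)) \<le> e * norm (y - x)" .
    qed
  qed
  then show ?thesis unfolding differentiable_def by blast
qed

section \<open>Differentiating families of bilinear forms\<close>

lemma bilinear_eq_sum_Basis:
  fixes B :: "'a::euclidean_space \<Rightarrow> 'b::euclidean_space \<Rightarrow> 'c::real_normed_vector"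
  assumes "bilinear B"
  shows "B u v = (\<Sum>b\<in>Basis. \<Sum>c\<in>Basis. ((u \<bullet> b) * (v \<bullet> c)) *\<^sub>R B b c)"
proof -
  have l1: "linear (\<lambda>u. B u v)" and l2: "linear (B u)" for u v
    using assms by (auto simp: bilinear_def)
  have "B u v = B (\<Sum>b\<in>Basis. (u \<bullet> b) *\<^sub>R b) v"
    by (simp add: euclidean_representation)
  also have "\<dots> = (\<Sum>b\<in>Basis. (u \<bullet> b) *\<^sub>R B b v)"
    by (simp add: linear_sum[OF l1] linear_scale[OF l1])
  also have "\<dots> = (\<Sum>b\<in>Basis. (u \<bullet> b) *\<^sub>R B b (\<Sum>c\<in>Basis. (v \<bullet> c) *\<^sub>R c))"
    by (simp add: euclidean_representation)
  also have "\<dots> = (\<Sum>b\<in>Basis. (u \<bullet> b) *\<^sub>R (\<Sum>c\<in>Basis. (v \<bullet> c) *\<^sub>R B b c))"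
    by (simp only: linear_sum[OF l2] linear_scale[OF l2])
  finally show ?thesis by (simp add: scaleR_sum_right)
qed

text \<open>Only the scalar functions obtained by fixing u and v are assumed differentiable.
  Expanding in a basis near z shows that their derivatives inherit bilinearity in u and v.\<close>

lemma bilinear_family_derivative:
  fixes W :: "'e::euclidean_space \<Rightarrow> 'e \<Rightarrow> 'e \<Rightarrow> 'f::real_normed_vector"
  assumes K: "open K" "z \<in> K" and bil: "\<And>z. z \<in> K \<Longrightarrow> bilinear (W z)"
    and W': "\<And>u v. ((\<lambda>z. W z u v) has_derivative (\<lambda>w. W' w u v)) (at z)"
  shows "W' w u v = (\<Sum>b\<in>Basis. \<Sum>c\<in>Basis. ((u \<bullet> b) * (v \<bullet> c)) *\<^sub>R W' w b c)"
proof -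
  have "((\<lambda>z. \<Sum>b\<in>Basis. \<Sum>c\<in>Basis. ((u \<bullet> b) * (v \<bullet> c)) *\<^sub>R W z b c) has_derivative
      (\<lambda>w. \<Sum>b\<in>Basis. \<Sum>c\<in>Basis. ((u \<bullet> b) * (v \<bullet> c)) *\<^sub>R W' w b c)) (at z)"
    by (intro has_derivative_sum has_derivative_scaleR_right W')
  then have "((\<lambda>z. W z u v) has_derivative
      (\<lambda>w. \<Sum>b\<in>Basis. \<Sum>c\<in>Basis. ((u \<bullet> b) * (v \<bullet> c)) *\<^sub>R W' w b c)) (at z)"
    by (rule has_derivative_transform_within_open[OF _ K]) (rule bilinear_eq_sum_Basis[OF bil, symmetric])
  from has_derivative_unique[OF W' this] show ?thesis
    by (rule fun_cong)
qed

text \<open>The product rule in three factors. Expansion in a basis turns it into finitely many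
  products of scalar functions with the coefficients of the form.\<close>

lemma has_vector_derivative_bilinear_family:
  fixes W :: "'e::euclidean_space \<Rightarrow> 'e \<Rightarrow> 'e \<Rightarrow> 'f::real_normed_vector"
  assumes K: "open K" "\<gamma> s \<in> K" and bil: "\<And>z. z \<in> K \<Longrightarrow> bilinear (W z)"
    and W': "\<And>u v. ((\<lambda>z. W z u v) has_derivative (\<lambda>w. W' w u v)) (at (\<gamma> s))"
    and \<gamma>: "(\<gamma> has_vector_derivative \<gamma>') (at s)"
    and X: "(X has_vector_derivative X') (at s)" and Y: "(Y has_vector_derivative Y') (at s)"
  shows "((\<lambda>r. W (\<gamma> r) (X r) (Y r)) has_vector_derivative
      W' \<gamma>' (X s) (Y s) + W (\<gamma> s) X' (Y s) + W (\<gamma> s) (X s) Y') (at s)"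
proof -
  let ?S = "\<lambda>r. \<Sum>b\<in>Basis. \<Sum>c\<in>Basis. ((X r \<bullet> b) * (Y r \<bullet> c)) *\<^sub>R W (\<gamma> r) b c"
  let ?d = "\<lambda>b c. ((X s \<bullet> b) * (Y s \<bullet> c)) *\<^sub>R W' \<gamma>' b c +
      ((X' \<bullet> b) * (Y s \<bullet> c) + (X s \<bullet> b) * (Y' \<bullet> c)) *\<^sub>R W (\<gamma> s) b c"
  have "(?S has_vector_derivative (\<Sum>b\<in>Basis. \<Sum>c\<in>Basis. ?d b c)) (at s)"
  proof (intro has_vector_derivative_sum)
    fix b c :: 'e
    have inner: "((\<lambda>r. Z r \<bullet> b) has_field_derivative (Z' \<bullet> b)) (at s)"
      if "(Z has_vector_derivative Z') (at s)" for Z Z' b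
      using bounded_linear.has_vector_derivative[OF bounded_linear_inner_left that]
      by (simp add: has_real_derivative_iff_has_vector_derivative)
    have 1: "((\<lambda>r. (X r \<bullet> b) * (Y r \<bullet> c)) has_field_derivative
        ((X' \<bullet> b) * (Y s \<bullet> c) + (X s \<bullet> b) * (Y' \<bullet> c))) (at s)"
      using DERIV_mult[OF inner[OF X] inner[OF Y], of b c] by (simp add: algebra_simps)
    have 2: "((\<lambda>r. W (\<gamma> r) b c) has_vector_derivative W' \<gamma>' b c) (at s)"
      using diff_chain_at[OF \<gamma>[unfolded has_vector_derivative_def] W'[of b c]]
        linear_scale[OF has_derivative_linear[OF W'[of b c]]]
      by (simp add: has_vector_derivative_def o_def)
    show "((\<lambda>r. ((X r \<bullet> b) * (Y r \<bullet> c)) *\<^sub>R W (\<gamma> r) b c) has_vector_derivative ?d b c) (at s)"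
      by (rule has_vector_derivative_scaleR[OF 1 2])
  qed
  also have "(\<Sum>b\<in>Basis. \<Sum>c\<in>Basis. ?d b c) =
      W' \<gamma>' (X s) (Y s) + W (\<gamma> s) X' (Y s) + W (\<gamma> s) (X s) Y'"
  proof -
    have "W' \<gamma>' (X s) (Y s) = (\<Sum>b\<in>Basis. \<Sum>c\<in>Basis. ((X s \<bullet> b) * (Y s \<bullet> c)) *\<^sub>R W' \<gamma>' b c)"
      by (rule bilinear_family_derivative[OF K bil W'])
    then show ?thesis
      unfolding bilinear_eq_sum_Basis[OF bil[OF K(2)], of X' "Y s"] bilinear_eq_sum_Basis[OF bil[OF K(2)], of "X s" Y']
      by (simp add: sum.distrib scaleR_add_left add.assoc)
  qed
  finally have S: "(?S has_vector_derivative
      W' \<gamma>' (X s) (Y s) + W (\<gamma> s) X' (Y s) + W (\<gamma> s) (X s) Y') (at s)" .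
  have "isCont \<gamma> s"
    using \<gamma> has_vector_derivative_continuous by blast
  then obtain T where T: "open T" "s \<in> T" "\<And>r. r \<in> T \<Longrightarrow> \<gamma> r \<in> K"
    using K continuous_at_open[of s \<gamma>] by blast
  show ?thesis
    by (rule has_vector_derivative_transform_within_open[OF S T(1,2)])
       (rule bilinear_eq_sum_Basis[OF bil[OF T(3)], symmetric])
qed

text \<open>Cartan's formula in coordinates: the Lie derivative of W along V is the contraction of
  dW with V plus d of the contraction of W with V. The former vanishes by closedness of W; the
  latter is d\<alpha>, which vanishes by \<open>sym\<close>.\<close>

lemma Lie_derivative_Hamiltonian:
  fixes W :: "'e::euclidean_space \<Rightarrow> 'e \<Rightarrow> 'e \<Rightarrow> 'f::real_normed_vector"
  assumes K: "open K" "z \<in> K" and bil: "\<And>z. z \<in> K \<Longrightarrow> bilinear (W z)"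
    and skew: "\<And>z u v. z \<in> K \<Longrightarrow> W z u v = - W z v u"
    and W': "\<And>u v. ((\<lambda>z. W z u v) has_derivative (\<lambda>w. W' w u v)) (at z)"
    and closed: "\<And>u v w. W' u v w + W' v w u + W' w u v = 0"
    and ham: "\<And>z u. z \<in> K \<Longrightarrow> W z (V z) u = \<alpha> z u"
    and V: "(V has_derivative V') (at z)"
    and \<alpha>: "\<And>u. ((\<lambda>z. \<alpha> z u) has_derivative (\<lambda>w. \<alpha>' w u)) (at z)"
    and sym: "\<And>u w. \<alpha>' w u = \<alpha>' u w"
  shows "W' (V z) u v + W z (V' u) v + W z u (V' v) = 0"
proof -
  have skew': "W' w u v = - W' w v u" for w u v
  proof -
    have "((\<lambda>z. - W z v u) has_derivative (\<lambda>w. - W' w v u)) (at z)"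
      by (intro has_derivative_minus W')
    then have "((\<lambda>z. W z u v) has_derivative (\<lambda>w. - W' w v u)) (at z)"
      by (rule has_derivative_transform_within_open[OF _ K]) (metis skew)
    from has_derivative_unique[OF W' this] show ?thesis
      by (rule fun_cong)
  qed
  \<comment> \<open>The Hamiltonian identity \<open>ham\<close> is differentiated in direction w,
    along a straight line through z with v kept constant.\<close>
  have eq: "W' w (V z) v + W z (V' w) v = \<alpha>' w v" for w v
  proof -
    have line: "((\<lambda>r. z + r *\<^sub>R w) has_vector_derivative w) (at 0)"
      by (auto intro!: derivative_eq_intros simp: has_vector_derivative_def)
    have comp: "((\<lambda>r. F (z + r *\<^sub>R w)) has_vector_derivative F' w) (at 0)"
      if "(F has_derivative F') (at z)" for F :: "'e \<Rightarrow> 'g::real_normed_vector" and F'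
      using diff_chain_at[OF line[unfolded has_vector_derivative_def], of F F'] that
        linear_scale[OF has_derivative_linear[OF that]]
      by (simp add: has_vector_derivative_def o_def)
    have "((\<lambda>r. W (z + r *\<^sub>R w) (V (z + r *\<^sub>R w)) v) has_vector_derivative
        W' w (V (z + 0 *\<^sub>R w)) v + W (z + 0 *\<^sub>R w) (V' w) v + W (z + 0 *\<^sub>R w) (V (z + 0 *\<^sub>R w)) 0) (at 0)"
      using K W' by (intro has_vector_derivative_bilinear_family[OF K(1) _ bil] line comp[OF V]) auto
    then have 1: "((\<lambda>r. W (z + r *\<^sub>R w) (V (z + r *\<^sub>R w)) v) has_vector_derivative
        W' w (V z) v + W z (V' w) v) (at 0)"
      using bilinear_rzero[OF bil[OF K(2)]] by simp
    have "isCont (\<lambda>r. z + r *\<^sub>R w) 0"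
      by (intro continuous_intros)
    then have "open ((\<lambda>r. z + r *\<^sub>R w) -` K)"
      using K(1) by (intro open_vimage) (auto intro!: continuous_intros)
    then have "((\<lambda>r. \<alpha> (z + r *\<^sub>R w) v) has_vector_derivative W' w (V z) v + W z (V' w) v) (at 0)"
      by (rule has_vector_derivative_transform_within_open[OF 1]) (use K ham in auto)
    from vector_derivative_unique_at[OF this comp[OF \<alpha>]]
    show ?thesis .
  qed
  have eq': "W' u (V z) v + W z (V' u) v = W' v (V z) u + W z (V' v) u"
    unfolding eq by (rule sym)
  have "W' (V z) u v = W' u (V z) v - W' v (V z) u"
    using closed[of "V z" u v] skew'[of u v "V z"] by (simp add: algebra_simps add_eq_0_iff)
  then have "W' (V z) u v + W z (V' u) v + W z u (V' v) =
      (W' u (V z) v + W z (V' u) v) - (W' v (V z) u + W z (V' v) u)"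
    unfolding skew[OF K(2), of u "V' v"] by (simp add: algebra_simps)
  then show ?thesis
    unfolding eq' by simp
qed

text \<open>The Lipschitz bound is Gronwall's inequality for a difference of two orbits. For
  differentiability the linear map \<open>A\<close> interpolates the displacements of the flow at
  the points x + d b, b in the basis; its error at time 0 vanishes and later obeys the linearised
  equation up to terms that are small with d.\<close>

lemma local_flow_approximation:
  fixes z :: "'e::euclidean_space \<Rightarrow> real \<Rightarrow> 'e"
  assumes L: "L \<ge> 0" and C: "C \<ge> 0"
    and lip: "\<And>z w. z \<in> K \<Longrightarrow> w \<in> K \<Longrightarrow> norm (V w - V z) \<le> L * norm (w - z)"
    and V': "\<And>z. z \<in> K \<Longrightarrow> linear (V' z)" "\<And>z u. z \<in> K \<Longrightarrow> norm (V' z u) \<le> L * norm u"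
    and quad: "\<And>z w. z \<in> K \<Longrightarrow> w \<in> K \<Longrightarrow> norm (V w - V z - V' z (w - z)) \<le> C * (norm (w - z))\<^sup>2"
    and z: "\<And>y s. y \<in> U \<Longrightarrow> s \<in> closed_segment 0 \<delta> \<Longrightarrow> (z y has_vector_derivative V (z y s)) (at s)"
      "\<And>y s. y \<in> U \<Longrightarrow> s \<in> closed_segment 0 \<delta> \<Longrightarrow> z y s \<in> K"
      "\<And>y. y \<in> U \<Longrightarrow> z y 0 = y"
  defines "G \<equiv> exp ((L + 1) * \<bar>\<delta>\<bar>)"
  shows "\<And>x y s. x \<in> U \<Longrightarrow> y \<in> U \<Longrightarrow> s \<in> closed_segment 0 \<delta> \<Longrightarrow> norm (z y s - z x s) \<le> norm (y - x) * G"
    and "\<And>x. open U \<Longrightarrow> x \<in> U \<Longrightarrow> (\<lambda>y. z y \<delta>) differentiable (at x)"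
proof -
  have G: "G > 0" by (simp add: G_def)
  have mono: "exp ((L + 1) * \<bar>s - 0\<bar>) \<le> G" if "s \<in> closed_segment 0 \<delta>" for s
    unfolding G_def using that L by (auto simp: closed_segment_eq_real_ivl split: if_splits intro!: mult_left_mono)
  have sub: "closed_segment 0 s \<subseteq> closed_segment 0 \<delta>" if "s \<in> closed_segment 0 \<delta>" for s
    using that by (simp add: subset_closed_segment)
  show lipz: "norm (z y s - z x s) \<le> norm (y - x) * G"
    if x: "x \<in> U" and y: "y \<in> U" and s: "s \<in> closed_segment 0 \<delta>" for x y s
  proof -
    have "norm (z y s - z x s) \<le> (norm (z y 0 - z x 0) + 0) * exp ((L + 1) * \<bar>s - 0\<bar>)"
    proof (rule gronwall[OF L])
      fix r assume "r \<in> closed_segment 0 s"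
      then have r: "r \<in> closed_segment 0 \<delta>" using sub[OF s] by blast
      show "((\<lambda>s. z y s - z x s) has_vector_derivative (V (z y r) - V (z x r))) (at r)"
        by (intro has_vector_derivative_diff z x y r)
      show "norm (V (z y r) - V (z x r)) \<le> L * norm (z y r - z x r) + 0"
        using lip z(2) x y r by simp
    qed simp
    also have "\<dots> \<le> norm (y - x) * G"
      using mono[OF s] by (simp add: z(3) x y mult_left_mono)
    finally show ?thesis .
  qed
  show "(\<lambda>y. z y \<delta>) differentiable (at x)" if U: "open U" and x: "x \<in> U" for x
  proof (rule differentiable_of_linear_approximations)
    fix \<epsilon> :: real assume \<epsilon>: "\<epsilon> > 0"
    obtain \<rho> where \<rho>: "\<rho> > 0" "ball x \<rho> \<subseteq> U"
      using U x open_contains_ball by blast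
    define N where "N = real DIM('e)"
    \<comment> \<open>Two factors G come from squaring the Lipschitz bound in the quadratic
      remainder, the third from the final use of Gronwall's inequality.\<close>
    define Q where "Q = C * G^3"
    have N: "N > 0" and Q: "Q \<ge> 0" using C G by (auto simp: N_def Q_def)
    \<comment> \<open>Small enough that all points x + d b lie in U and that the total relative
      error \<open>Q * (d + N * d)\<close> is at most \<epsilon>; the summands 1 avoid a zero
      denominator.\<close>
    define d where "d = min (\<rho> / 2) (\<epsilon> / ((Q + 1) * (N + 1)))"
    have d: "d > 0" "d < \<rho>" using \<rho> \<epsilon> N Q by (auto simp: d_def)
    have dQ: "Q * (d + N * d) \<le> \<epsilon>"
    proof -
      have "Q * (d + N * d) \<le> (Q + 1) * (N + 1) * d"
        using Q N d by (simp add: algebra_simps)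
      also have "\<dots> \<le> (Q + 1) * (N + 1) * (\<epsilon> / ((Q + 1) * (N + 1)))"
        using Q N by (intro mult_left_mono) (auto simp: d_def)
      also have "\<dots> = \<epsilon>" using Q N by simp
      finally show ?thesis .
    qed
    define R where "R y s = z y s - z x s" for y s
    have xb: "x + d *\<^sub>R b \<in> U" if "b \<in> Basis" for b
      using \<rho>(2) d that by (auto simp: subset_iff dist_norm)
    define A where "A w = (\<Sum>b\<in>Basis. ((w \<bullet> b) / d) *\<^sub>R R (x + d *\<^sub>R b) \<delta>)" for w
    have "linear A"
      by (rule linearI) (auto simp: A_def inner_add_left add_divide_distrib scaleR_add_left sum.distrib scaleR_sum_right)
    moreover have "norm (z y \<delta> - z x \<delta> - A (y - x)) \<le> \<epsilon> * norm (y - x)" if yd: "norm (y - x) < d" for y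
    proof -
      have y: "y \<in> U" using \<rho>(2) d yd by (auto simp: subset_iff dist_norm norm_minus_commute)
      let ?w = "y - x"
      define E where "E s = R y s - (\<Sum>b\<in>Basis. ((?w \<bullet> b) / d) *\<^sub>R R (x + d *\<^sub>R b) s)" for s
      define E' where "E' s = (V (z y s) - V (z x s)) -
          (\<Sum>b\<in>Basis. ((?w \<bullet> b) / d) *\<^sub>R (V (z (x + d *\<^sub>R b) s) - V (z x s)))" for s
      \<comment> \<open>The remainder of y contributes at most a multiple of norm ?w times d, since
        norm ?w < d. Each of the N basis points contributes (norm ?w / d) times d squared, which is
        the same amount.\<close>
      define e where "e = C * G\<^sup>2 * (norm ?w * (d + N * d))"
      have e: "e \<ge> 0" using C N d by (simp add: e_def)
      define r where "r v s = V (z (x + v) s) - V (z x s) - V' (z x s) (R (x + v) s)" for v s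
      have r: "norm (r v s) \<le> C * G\<^sup>2 * (norm v)\<^sup>2" if "x + v \<in> U" "s \<in> closed_segment 0 \<delta>" for v s
      proof -
        have "norm (r v s) \<le> C * (norm (R (x + v) s))\<^sup>2"
          unfolding r_def R_def by (intro quad z x that)
        also have "\<dots> \<le> C * (norm v * G)\<^sup>2"
          using lipz[OF x that] C by (intro mult_left_mono power_mono) (auto simp: R_def)
        finally show ?thesis by (simp add: power_mult_distrib mult_ac)
      qed
      have "norm (E \<delta>) \<le> (norm (E 0) + e) * exp ((L + 1) * \<bar>\<delta> - 0\<bar>)"
      proof (rule gronwall[OF L e])
        fix s assume s: "s \<in> closed_segment 0 \<delta>"
        show "(E has_vector_derivative E' s) (at s)"
          unfolding E_def E'_def R_def
          by (intro has_vector_derivative_diff has_vector_derivative_sum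
              bounded_linear.has_vector_derivative[OF bounded_linear_scaleR_right] z x y xb s)
        have lin: "linear (V' (z x s))" by (rule V'(1)[OF z(2)[OF x s]])
        \<comment> \<open>Linearity of \<open>V'\<close> along the base orbit assembles the linear
          parts into \<open>V' (z x s) (E s)\<close>; only quadratic remainders are left
          over.\<close>
        have E'_eq: "E' s = V' (z x s) (E s) +
            (r ?w s - (\<Sum>b\<in>Basis. ((?w \<bullet> b) / d) *\<^sub>R r (d *\<^sub>R b) s))"
          unfolding E_def E'_def r_def
          by (simp add: linear_diff[OF lin] linear_sum[OF lin] linear_scale[OF lin] scaleR_diff_right sum_subtractf)
        have "norm (r ?w s - (\<Sum>b\<in>Basis. ((?w \<bullet> b) / d) *\<^sub>R r (d *\<^sub>R b) s)) \<le>
            norm (r ?w s) + (\<Sum>b\<in>Basis. norm (((?w \<bullet> b) / d) *\<^sub>R r (d *\<^sub>R b) s))"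
          by (intro order_trans[OF norm_triangle_ineq4] add_left_mono norm_sum)
        also have "\<dots> \<le> C * G\<^sup>2 * (norm ?w * d) + (\<Sum>b::'e\<in>Basis. C * G\<^sup>2 * (norm ?w * d))"
        proof (intro add_mono sum_mono)
          have "norm (r ?w s) \<le> C * G\<^sup>2 * (norm ?w)\<^sup>2"
            using r[of ?w s] y s by simp
          also have "\<dots> \<le> C * G\<^sup>2 * (norm ?w * d)"
            using C yd by (intro mult_left_mono) (auto simp: power2_eq_square intro!: mult_left_mono)
          finally show "norm (r ?w s) \<le> C * G\<^sup>2 * (norm ?w * d)" .
          fix b :: 'e assume b: "b \<in> Basis"
          have "norm (((?w \<bullet> b) / d) *\<^sub>R r (d *\<^sub>R b) s) \<le> (norm ?w / d) * (C * G\<^sup>2 * (norm (d *\<^sub>R b))\<^sup>2)"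
            unfolding norm_scaleR
            using r[OF xb[OF b] s] Basis_le_norm[OF b, of ?w] d
            by (intro mult_mono) (auto simp: divide_right_mono)
          also have "\<dots> = C * G\<^sup>2 * (norm ?w * d)"
            using b d by (simp add: power2_eq_square)
          finally show "norm (((?w \<bullet> b) / d) *\<^sub>R r (d *\<^sub>R b) s) \<le> C * G\<^sup>2 * (norm ?w * d)" .
        qed
        also have "\<dots> = e" by (simp add: e_def N_def algebra_simps)
        finally have "norm (r ?w s - (\<Sum>b\<in>Basis. ((?w \<bullet> b) / d) *\<^sub>R r (d *\<^sub>R b) s)) \<le> e" .
        then show "norm (E' s) \<le> L * norm (E s) + e"
          unfolding E'_eq using V'(2)[OF z(2)[OF x s], of "E s"]
          by (intro order_trans[OF norm_triangle_ineq] add_mono)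
      qed
      \<comment> \<open>At time 0 the displacements are d b themselves, so interpolation is
        exact.\<close>
      moreover have "E 0 = 0"
      proof -
        have "((?w \<bullet> b) / d) *\<^sub>R R (x + d *\<^sub>R b) 0 = (?w \<bullet> b) *\<^sub>R b" if "b \<in> Basis" for b
          using d by (simp add: R_def z(3) x xb that)
        then have "(\<Sum>b\<in>Basis. ((?w \<bullet> b) / d) *\<^sub>R R (x + d *\<^sub>R b) 0) = ?w"
          by (simp add: euclidean_representation)
        then show ?thesis by (simp add: E_def R_def z(3) x y)
      qed
      moreover have "E \<delta> = z y \<delta> - z x \<delta> - A ?w"
        by (simp add: E_def A_def R_def)
      ultimately have "norm (z y \<delta> - z x \<delta> - A ?w) \<le> e * G"
        by (simp add: G_def)
      also have "\<dots> = (Q * (d + N * d)) * norm ?w"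
        by (simp add: e_def Q_def power2_eq_square power3_eq_cube)
      also have "\<dots> \<le> \<epsilon> * norm ?w"
        using dQ by (intro mult_right_mono) auto
      finally show ?thesis .
    qed
    ultimately show "\<exists>A. linear A \<and> (\<exists>d>0. \<forall>y. norm (y - x) < d \<longrightarrow>
        norm (z y \<delta> - z x \<delta> - A (y - x)) \<le> \<epsilon> * norm (y - x))"
      using d(1) by blast
  qed
qed

text \<open>Difference quotients of the flow solve the variational equation up to \<open>O(h)\<close>, so the form
  evaluated on two of them is constant in time up to \<open>O(h)\<close>.\<close>

lemma local_flow_preserves_form:
  fixes z :: "'e::euclidean_space \<Rightarrow> real \<Rightarrow> 'e" and W :: "'e \<Rightarrow> 'e \<Rightarrow> 'e \<Rightarrow> 'f::real_inner"
  assumes L: "L \<ge> 0" and C: "C \<ge> 0"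
    and lip: "\<And>z w. z \<in> K \<Longrightarrow> w \<in> K \<Longrightarrow> norm (V w - V z) \<le> L * norm (w - z)"
    and V': "\<And>z. z \<in> K \<Longrightarrow> linear (V' z)" "\<And>z u. z \<in> K \<Longrightarrow> norm (V' z u) \<le> L * norm u"
    and quad: "\<And>z w. z \<in> K \<Longrightarrow> w \<in> K \<Longrightarrow> norm (V w - V z - V' z (w - z)) \<le> C * (norm (w - z))\<^sup>2"
    and z: "\<And>y s. y \<in> U \<Longrightarrow> s \<in> closed_segment 0 \<delta> \<Longrightarrow> (z y has_vector_derivative V (z y s)) (at s)"
      "\<And>y s. y \<in> U \<Longrightarrow> s \<in> closed_segment 0 \<delta> \<Longrightarrow> z y s \<in> K"
      "\<And>y. y \<in> U \<Longrightarrow> z y 0 = y"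
    and U: "open U" "x \<in> U" and K: "open K" and bil: "\<And>z. z \<in> K \<Longrightarrow> bilinear (W z)"
    and W': "\<And>z u v. z \<in> K \<Longrightarrow> ((\<lambda>z. W z u v) has_derivative (\<lambda>w. W' z w u v)) (at z)"
    and Lie: "\<And>z u v. z \<in> K \<Longrightarrow> W' z (V z) u v + W z (V' z u) v + W z u (V' z v) = 0"
    and D: "((\<lambda>y. z y \<delta>) has_derivative D) (at x)"
  shows "W (z x \<delta>) (D u) (D v) = W x u v"
proof -
  define G where "G = exp ((L + 1) * \<bar>\<delta>\<bar>)"
  have G: "G > 0" by (simp add: G_def)
  have lipz: "norm (z y s - z x s) \<le> norm (y - x) * G" if "y \<in> U" "s \<in> closed_segment 0 \<delta>" for y s
    unfolding G_def
    by (rule local_flow_approximation(1)[OF L C lip V' quad z]) (use that U in auto)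
  let ?I = "closed_segment 0 \<delta>"
  have xK: "z x s \<in> K" if "s \<in> ?I" for s using z(2) U that by blast
  have "\<exists>M. \<forall>s\<in>?I. norm (W (z x s) b c) \<le> M" for b c
  proof -
    have "continuous_on ?I (\<lambda>s. W (z x s) b c)"
    proof (rule continuous_on_compose2[where g = "\<lambda>z. W z b c" and t = K])
      show "continuous_on K (\<lambda>z. W z b c)"
        using W' by (meson continuous_at_imp_continuous_on has_derivative_continuous)
      show "continuous_on ?I (z x)"
        by (intro continuous_at_imp_continuous_on ballI has_vector_derivative_continuous[OF z(1)[OF U(2)]])
    qed (use xK in auto)
    then have "compact ((\<lambda>s. W (z x s) b c) ` ?I)"
      by (rule compact_continuous_image) simp
    then show ?thesis
      by (meson bounded_iff compact_imp_bounded imageI)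
  qed
  then obtain m where m: "\<And>b c s. s \<in> ?I \<Longrightarrow> norm (W (z x s) b c) \<le> m b c"
    by metis
  \<comment> \<open>The coefficients of the form are bounded along the compact orbit segment; their
    sum bounds the form there as a bilinear map.\<close>
  define M where "M = (\<Sum>b\<in>Basis. \<Sum>c\<in>Basis. m b c)"
  have m0: "m b c \<ge> 0" for b c
    using m[of 0 b c] norm_ge_zero order_trans ends_in_segment(1) by blast
  have M: "norm (W (z x s) a b) \<le> M * norm a * norm b" if s: "s \<in> ?I" for s a b
  proof -
    have "norm (W (z x s) a b) \<le> (\<Sum>i\<in>Basis. norm (\<Sum>j\<in>Basis. ((a \<bullet> i) * (b \<bullet> j)) *\<^sub>R W (z x s) i j))"
      unfolding bilinear_eq_sum_Basis[OF bil[OF xK[OF s]], of a b] by (rule norm_sum)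
    also have "\<dots> \<le> (\<Sum>i\<in>Basis. \<Sum>j\<in>Basis. norm (((a \<bullet> i) * (b \<bullet> j)) *\<^sub>R W (z x s) i j))"
      by (intro sum_mono norm_sum)
    also have "\<dots> \<le> (\<Sum>i\<in>Basis. \<Sum>j\<in>Basis. (norm a * norm b) * m i j)"
      unfolding norm_scaleR abs_mult
      by (intro sum_mono mult_mono Basis_le_norm m s) auto
    finally show ?thesis
      by (simp add: M_def sum_distrib_left[symmetric] mult_ac)
  qed
  have M0: "M \<ge> 0" by (simp add: M_def sum_nonneg m0)
  obtain \<rho> where \<rho>: "\<rho> > 0" "ball x \<rho> \<subseteq> U"
    using U open_contains_ball by blast
  \<comment> \<open>Keeps x + h u and x + h v inside the ball of radius \<rho>; the summand 1 keeps
    the denominator positive when u = v = 0.\<close>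
  define h where "h n = \<rho> / (norm u + norm v + 1) / real (Suc n)" for n
  have uv: "norm u + norm v + 1 > 0" by (simp add: add_nonneg_pos)
  have h: "h n > 0" for n using \<rho> uv by (simp add: h_def)
  have hlim: "h \<longlonglongrightarrow> 0"
    unfolding h_def by (intro tendsto_divide_0[OF tendsto_const] filterlim_at_top_imp_at_infinity
        filterlim_compose[OF filterlim_real_sequentially] filterlim_Suc)
  have hU: "x + h n *\<^sub>R a \<in> U" if "a = u \<or> a = v" for a n
  proof -
    have "norm a * \<rho> < (norm u + norm v + 1) * \<rho>"
      using that \<rho> by (auto intro!: mult_strict_right_mono add_nonneg_pos add_pos_nonneg simp: add_nonneg_pos)
    also have "\<dots> \<le> (norm u + norm v + 1) * \<rho> * real (Suc n)"
      using mult_left_mono[of 1 "real (Suc n)" "(norm u + norm v + 1) * \<rho>"] \<rho> uv by simp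
    finally have "h n * norm a < \<rho>"
      using uv by (simp add: h_def divide_less_eq mult_ac del: of_nat_Suc)
    then show ?thesis
      using \<rho> h[of n] by (auto simp: subset_iff dist_norm)
  qed
  define X where "X a n s = (1 / h n) *\<^sub>R (z (x + h n *\<^sub>R a) s - z x s)" for a n s
  define X' where "X' a n s = (1 / h n) *\<^sub>R (V (z (x + h n *\<^sub>R a) s) - V (z x s))" for a n s
  \<comment> \<open>The defect of the difference quotient as a solution of the variational equation;
    it is of order \<open>h n\<close>.\<close>
  define r where "r a n s = X' a n s - V' (z x s) (X a n s)" for a n s
  have X': "(X a n has_vector_derivative X' a n s) (at s)" if "a = u \<or> a = v" "s \<in> ?I" for a n s
    unfolding X_def X'_def
    by (intro bounded_linear.has_vector_derivative[OF bounded_linear_scaleR_right] has_vector_derivative_diff z hU U that)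
  have XG: "norm (X a n s) \<le> G * norm a" if "a = u \<or> a = v" "s \<in> ?I" for a n s
    using lipz[OF hU[OF that(1), of n] that(2)] h[of n] by (simp add: X_def divide_simps mult_ac)
  have rG: "norm (r a n s) \<le> h n * (C * G\<^sup>2 * (norm a)\<^sup>2)" if a: "a = u \<or> a = v" and s: "s \<in> ?I" for a n s
  proof -
    let ?d = "z (x + h n *\<^sub>R a) s - z x s"
    have "r a n s = (1 / h n) *\<^sub>R (V (z (x + h n *\<^sub>R a) s) - V (z x s) - V' (z x s) ?d)"
      unfolding r_def X'_def X_def by (simp only: linear_scale[OF V'(1)[OF xK[OF s]]] scaleR_diff_right[symmetric])
    also have "norm \<dots> \<le> (1 / h n) * (C * (norm ?d)\<^sup>2)"
      using h[of n] quad[OF xK[OF s] z(2)[OF hU[OF a] s]] by (simp add: divide_right_mono)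
    also have "\<dots> \<le> (1 / h n) * (C * (h n * norm a * G)\<^sup>2)"
      using lipz[OF hU[OF a, of n] s] h[of n] C by (intro mult_left_mono power_mono) auto
    finally show ?thesis
      using h[of n] by (simp add: power_mult_distrib power2_eq_square mult_ac)
  qed
  define Q where "Q n s = W (z x s) (X u n s) (X v n s)" for n s
  define K1 where "K1 = M * (C * G\<^sup>2 * (norm u)\<^sup>2) * (G * norm v) + M * (G * norm u) * (C * G\<^sup>2 * (norm v)\<^sup>2)"
  have K1: "K1 \<ge> 0" using M0 C G by (simp add: K1_def)
  have Q: "norm (Q n \<delta> - Q n 0) \<le> (h n * K1) * exp ((0 + 1) * \<bar>\<delta> - 0\<bar>)" for n
  proof -
    \<comment> \<open>After writing each \<open>X'\<close> as \<open>V'\<close> applied to X plus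
      the defect r, the identity \<open>Lie\<close> cancels everything except the two terms that
      contain a defect.\<close>
    define Q' where "Q' s = W (z x s) (r u n s) (X v n s) + W (z x s) (X u n s) (r v n s)" for s
    \<comment> \<open>Gronwall's inequality with L = 0 acts as a mean value inequality here.\<close>
    have "norm (Q n \<delta> - Q n 0) \<le> (norm (Q n 0 - Q n 0) + h n * K1) * exp ((0 + 1) * \<bar>\<delta> - 0\<bar>)"
    proof (rule gronwall)
      fix s assume s: "s \<in> ?I"
      have lin1: "linear (\<lambda>a. W (z x s) a b)" and lin2: "linear (W (z x s) a)" for a b
        using bil[OF xK[OF s]] by (auto simp: bilinear_def)
      have "(Q n has_vector_derivative
          W' (z x s) (V (z x s)) (X u n s) (X v n s) + W (z x s) (X' u n s) (X v n s)
            + W (z x s) (X u n s) (X' v n s)) (at s)"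
        unfolding Q_def
        by (rule has_vector_derivative_bilinear_family[OF K xK[OF s] bil W'[OF xK[OF s]] z(1)[OF U(2) s] X' X'])
           (use s in auto)
      also have "W' (z x s) (V (z x s)) (X u n s) (X v n s) + W (z x s) (X' u n s) (X v n s)
            + W (z x s) (X u n s) (X' v n s) = Q' s"
        using Lie[OF xK[OF s], of "X u n s" "X v n s"]
        by (simp add: Q'_def r_def linear_diff[OF lin1] linear_diff[OF lin2] algebra_simps)
      finally show "((\<lambda>s. Q n s - Q n 0) has_vector_derivative Q' s) (at s)"
        by (auto intro!: derivative_eq_intros)
      have "norm (Q' s) \<le> M * norm (r u n s) * norm (X v n s) + M * norm (X u n s) * norm (r v n s)"
        unfolding Q'_def by (intro norm_triangle_le add_mono M s)
      also have "\<dots> \<le> M * (h n * (C * G\<^sup>2 * (norm u)\<^sup>2)) * (G * norm v) +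
          M * (G * norm u) * (h n * (C * G\<^sup>2 * (norm v)\<^sup>2))"
        using s M0 C G h[of n] by (intro add_mono mult_mono rG XG mult_nonneg_nonneg) auto
      also have "\<dots> = 0 * norm (Q n s - Q n 0) + h n * K1"
        by (simp add: K1_def algebra_simps)
      finally show "norm (Q' s) \<le> 0 * norm (Q n s - Q n 0) + h n * K1" .
    qed (use h[of n] K1 in auto)
    then show ?thesis by simp
  qed
  have "(\<lambda>n. Q n \<delta> - Q n 0) \<longlonglongrightarrow> 0"
  proof (rule Lim_null_comparison)
    show "\<forall>\<^sub>F n in sequentially. norm (Q n \<delta> - Q n 0) \<le> (h n * K1) * exp ((0 + 1) * \<bar>\<delta> - 0\<bar>)"
      using Q by simp
    show "(\<lambda>n. (h n * K1) * exp ((0 + 1) * \<bar>\<delta> - 0\<bar>)) \<longlonglongrightarrow> 0"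
      using tendsto_mult[OF tendsto_mult[OF hlim tendsto_const] tendsto_const] by simp
  qed
  moreover have "Q n 0 = W x u v" for n
    using h[of n] hU by (simp add: Q_def X_def z(3) U)
  moreover have "(\<lambda>n. Q n \<delta>) \<longlonglongrightarrow> W (z x \<delta>) (D u) (D v)"
  proof -
    have "bounded_bilinear (W (z x \<delta>))"
      using bil[OF xK] bilinear_conv_bounded_bilinear by auto
    then show ?thesis
      unfolding Q_def X_def
      by (rule bounded_bilinear.tendsto) (intro has_derivative_imp_directional_sequence[OF D hlim h])+
  qed
  ultimately show ?thesis
    using LIMSEQ_unique by (simp add: Lim_null[of _ "W x u v"]) (simp add: Lim_null[symmetric] LIMSEQ_unique)
qed

section \<open>Symplectic linear algebra\<close>

lemma nondegenerate_form_represents: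
  fixes \<sigma> :: "'e::euclidean_space \<Rightarrow> 'e \<Rightarrow> real"
  assumes bil: "bilinear \<sigma>" and nondeg: "\<And>u. (\<And>v. \<sigma> u v = 0) \<Longrightarrow> u = 0"
  obtains A where "linear A" "bij A" "\<And>u v. \<sigma> u v = A u \<bullet> v"
proof -
  define A where "A u = (\<Sum>b\<in>Basis. \<sigma> u b *\<^sub>R b)" for u
  have l1: "linear (\<lambda>u. \<sigma> u v)" and l2: "linear (\<sigma> u)" for u v
    using bil by (auto simp: bilinear_def)
  have A: "\<sigma> u v = A u \<bullet> v" for u v
  proof -
    have "\<sigma> u v = \<sigma> u (\<Sum>b\<in>Basis. (v \<bullet> b) *\<^sub>R b)"
      by (simp add: euclidean_representation)
    then show ?thesis
      by (simp add: linear_sum[OF l2] linear_scale[OF l2] A_def inner_sum_left inner_commute[of v] mult.commute)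
  qed
  have lin: "linear A"
    by (rule linearI)
       (simp_all add: A_def linear_add[OF l1] linear_scale[OF l1] scaleR_add_left sum.distrib scaleR_sum_right)
  have "inj A"
  proof (rule injI)
    fix u v assume "A u = A v"
    then have "\<sigma> (u - v) w = 0" for w
      by (simp add: A linear_diff[OF lin])
    then show "u = v" using nondeg[of "u - v"] by simp
  qed
  then show thesis
    using that[OF lin _ A] linear_inj_imp_surj[OF lin] by (simp add: bij_def)
qed

text \<open>Guarantees that the definite description in \<open>Hamilton_field\<close>
  denotes.\<close>

lemma nondegenerate_form_ex1:
  fixes \<sigma> :: "'e::euclidean_space \<Rightarrow> 'e \<Rightarrow> real"
  assumes bil: "bilinear \<sigma>" and nondeg: "\<And>u. (\<And>v. \<sigma> u v = 0) \<Longrightarrow> u = 0" and l: "linear l"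
  shows "\<exists>!v. \<forall>u. \<sigma> v u = l u"
proof -
  obtain A where A: "linear A" "bij A" "\<And>u v. \<sigma> u v = A u \<bullet> v"
    using nondegenerate_form_represents[OF bil nondeg] by blast
  define w where "w = (\<Sum>b\<in>Basis. l b *\<^sub>R b)"
  have l: "l u = w \<bullet> u" for u
  proof -
    have "l u = l (\<Sum>b\<in>Basis. (u \<bullet> b) *\<^sub>R b)"
      by (simp add: euclidean_representation)
    then show ?thesis
      by (simp add: linear_sum[OF l] linear_scale[OF l] w_def inner_sum_left inner_commute[of u] mult.commute)
  qed
  have "(\<forall>u. \<sigma> v u = l u) \<longleftrightarrow> A v = w" for v
    unfolding A(3) l by (metis vector_eq_rdot)
  then show ?thesis
    using A(2) by (metis bij_pointE)
qed

text \<open>The representing isomorphism \<open>A\<close> carries the \<sigma>-orthogonal of T onto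
  the Euclidean orthogonal complement of T.\<close>

lemma dim_form_orthogonal:
  fixes \<sigma> :: "'e::euclidean_space \<Rightarrow> 'e \<Rightarrow> real"
  assumes bil: "bilinear \<sigma>" and nondeg: "\<And>u. (\<And>v. \<sigma> u v = 0) \<Longrightarrow> u = 0" and T: "subspace T"
  shows "dim {u. \<forall>v\<in>T. \<sigma> u v = 0} + dim T = DIM('e)" and "subspace {u. \<forall>v\<in>T. \<sigma> u v = 0}"
proof -
  obtain A where A: "linear A" "bij A" "\<And>u v. \<sigma> u v = A u \<bullet> v"
    using nondegenerate_form_represents[OF bil nondeg] by blast
  let ?P = "{u. \<forall>v\<in>T. \<sigma> u v = 0}"
  show "subspace ?P"
    by (rule subspaceI) (auto simp: A(3) linear_0[OF A(1)] linear_add[OF A(1)] linear_scale[OF A(1)] inner_add_left)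
  have "A ` ?P = {y. \<forall>v\<in>T. orthogonal v y}"
  proof -
    have "y \<in> A ` ?P" if "\<forall>v\<in>T. orthogonal v y" for y
    proof -
      obtain u where "y = A u" using A(2) by (metis bij_pointE)
      then show ?thesis using that by (auto simp: A(3) orthogonal_def inner_commute)
    qed
    then show ?thesis by (auto simp: A(3) orthogonal_def inner_commute)
  qed
  moreover have "dim (A ` ?P) = dim ?P"
    by (rule dim_image_eq[OF A(1)]) (meson A(2) bij_is_inj inj_on_subset subset_UNIV)
  moreover have "dim {y. \<forall>v\<in>T. orthogonal v y} + dim T = DIM('e)"
    using dim_subspace_orthogonal_to_vectors[OF T subspace_UNIV] by simp
  ultimately show "dim ?P + dim T = DIM('e)" by simp
qed

text \<open>The kernel of P is the orthogonal complement of the range of the adjoint, and the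
  adjoint of a surjection is injective.\<close>

lemma dim_kernel_of_surj:
  fixes P :: "'e::euclidean_space \<Rightarrow> 'f::euclidean_space"
  assumes P: "linear P" "surj P"
  shows "dim {u. P u = 0} + DIM('f) = DIM('e)"
proof -
  have adj: "linear (adjoint P)" using adjoint_linear[OF P(1)] .
  have "inj (adjoint P)"
  proof (rule injI)
    fix a b assume "adjoint P a = adjoint P b"
    then have "a \<bullet> P u = b \<bullet> P u" for u
      by (metis adjoint_works[OF P(1)] inner_commute)
    then show "a = b"
      using P(2) by (metis surjD vector_eq_ldot inner_commute)
  qed
  then have "dim (range (adjoint P)) = DIM('f)"
    using dim_image_eq[OF adj, of UNIV] by (simp add: inj_on_subset)
  moreover have "{u. P u = 0} = {u \<in> UNIV. \<forall>v\<in>range (adjoint P). orthogonal v u}"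
  proof -
    have "P u = 0 \<longleftrightarrow> (\<forall>y. adjoint P y \<bullet> u = 0)" for u
      using adjoint_works[OF P(1)] by (metis inner_commute inner_eq_zero_iff inner_zero_right)
    then show ?thesis by (auto simp: orthogonal_def)
  qed
  ultimately show ?thesis
    using dim_subspace_orthogonal_to_vectors[OF linear_subspace_image[OF adj subspace_UNIV] subspace_UNIV]
    by simp
qed

text \<open>With K the kernel of P, T \<subseteq> K reverses to: the orthogonal of K lies in the
  orthogonal of T, which is T, hence in K. Both K and its orthogonal have half the dimension of the
  space, so they coincide. This upgrades a Lagrangian subspace of the kernel to the kernel
  itself.\<close>

lemma Lagrangian_in_kernel_imp_kernel_isotropic:
  fixes \<sigma> :: "'e::euclidean_space \<Rightarrow> 'e \<Rightarrow> real" and P :: "'e \<Rightarrow> 'f::euclidean_space"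
  assumes bil: "bilinear \<sigma>" and nondeg: "\<And>u. (\<And>v. \<sigma> u v = 0) \<Longrightarrow> u = 0"
    and P: "linear P" "surj P" and dims: "DIM('e) = 2 * DIM('f)"
    and T: "T = {u. \<forall>v\<in>T. \<sigma> u v = 0}" "\<And>u. u \<in> T \<Longrightarrow> P u = 0"
    and uv: "P u = 0" "P v = 0"
  shows "\<sigma> u v = 0"
proof -
  let ?K = "{u. P u = 0}"
  let ?K' = "{u. \<forall>v\<in>?K. \<sigma> u v = 0}"
  have K: "subspace ?K"
    using P(1) by (rule linear_subspace_kernel)
  have "dim ?K + DIM('f) = DIM('e)" by (rule dim_kernel_of_surj[OF P])
  moreover have "dim ?K' + dim ?K = DIM('e)" by (rule dim_form_orthogonal(1)[OF bil nondeg K])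
  ultimately have "dim ?K' \<ge> dim ?K" using dims by simp
  moreover have "?K' \<subseteq> T"
  proof
    fix a assume "a \<in> ?K'"
    then have "\<forall>b\<in>T. \<sigma> a b = 0" using T(2) by blast
    then show "a \<in> T" by (subst T(1)) blast
  qed
  then have "?K' \<subseteq> ?K" using T(2) by blast
  ultimately have "?K' = ?K"
    using subspace_dim_equal[OF dim_form_orthogonal(2)[OF bil nondeg K] K] by blast
  then show ?thesis using uv by blast
qed

section \<open>Real-analytic maps\<close>

text \<open>The derivative is the degree-one part of the series. Absolute convergence at one point
  with all coordinates equal to \<rho> dominates the terms of degree at least 2 by a quadratic
  factor.\<close>

lemma real_analytic_on_imp_differentiable_real:
  fixes f :: "'a::euclidean_space \<Rightarrow> real"
  assumes f: "real_analytic_on f S" and a: "a \<in> S"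
  shows "f differentiable (at a)"
proof -
  let ?I = "Basis \<rightarrow>\<^sub>E (UNIV :: nat set) :: ('a \<Rightarrow> nat) set"
  define P :: "('a \<Rightarrow> nat) \<Rightarrow> 'a \<Rightarrow> real" where "P \<alpha> w = (\<Prod>b\<in>Basis. (w \<bullet> b) ^ \<alpha> b)" for \<alpha> w
  obtain r c where r: "r > 0" and c': "\<And>x. x \<in> ball a r \<Longrightarrow>
      ((\<lambda>\<alpha>. (\<Prod>b\<in>Basis. ((x - a) \<bullet> b) ^ \<alpha> b) *\<^sub>R c \<alpha>) has_sum f x) ?I"
    using f a unfolding real_analytic_on_def by blast
  have c: "((\<lambda>\<alpha>. P \<alpha> (x - a) * c \<alpha>) has_sum f x) ?I" if "x \<in> ball a r" for x
    using c'[OF that] by (simp add: P_def)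
  \<comment> \<open>The vector with all coordinates \<rho> then has norm at most r/2 and lies in the
    domain of convergence.\<close>
  define \<rho> where "\<rho> = r / (2 * real DIM('a))"
  have \<rho>: "\<rho> > 0" using r by (simp add: \<rho>_def)
  define w0 :: 'a where "w0 = (\<Sum>b\<in>Basis. \<rho> *\<^sub>R b)"
  have w0b: "w0 \<bullet> b = \<rho>" if "b \<in> Basis" for b
    using that by (simp add: w0_def inner_sum_left inner_Basis if_distrib cong: if_cong)
  have "norm w0 \<le> (\<Sum>b\<in>(Basis::'a set). \<rho>)"
    unfolding w0_def by (rule sum_norm_le) (use \<rho> in simp)
  also have "\<dots> < r" using r by (simp add: \<rho>_def)
  finally have w0: "a + w0 \<in> ball a r" by (simp add: dist_norm)
  define m where "m \<alpha> = P \<alpha> w0 * \<bar>c \<alpha>\<bar>" for \<alpha>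
  have P0: "P \<alpha> w0 \<ge> 0" for \<alpha>
    unfolding P_def by (intro prod_nonneg) (use \<rho> in \<open>simp add: w0b\<close>)
  have "(\<lambda>\<alpha>. P \<alpha> w0 * c \<alpha>) summable_on ?I"
    using c[OF w0] by (auto simp: summable_on_def)
  \<comment> \<open>For real terms unconditional summability is absolute; this is why the scalar
    case is treated separately.\<close>
  then have "(\<lambda>\<alpha>. norm (P \<alpha> w0 * c \<alpha>)) summable_on ?I"
    by (rule summable_on_iff_abs_summable_on_real[THEN iffD1])
  moreover have "norm (P \<alpha> w0 * c \<alpha>) = m \<alpha>" for \<alpha>
    using P0[of \<alpha>] by (simp add: m_def abs_mult)
  ultimately have m: "m summable_on ?I" by simp
  \<comment> \<open>The multi-indices of degree 0 and 1. The restriction to \<open>Basis\<close>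
    gives them the value outside it that \<open>PiE\<close> prescribes.\<close>
  define z :: "'a \<Rightarrow> nat" where "z = restrict (\<lambda>_. 0) Basis"
  define \<delta> :: "'a \<Rightarrow> 'a \<Rightarrow> nat" where "\<delta> b = restrict (\<lambda>b'. if b' = b then 1 else 0) Basis" for b
  define A1 where "A1 = insert z (\<delta> ` Basis)"
  have zI: "z \<in> ?I" "\<And>b. \<delta> b \<in> ?I" by (auto simp: z_def \<delta>_def)
  have Pz: "P z w = 1" for w by (simp add: P_def z_def)
  have P\<delta>: "P (\<delta> b) w = w \<bullet> b" if "b \<in> Basis" for b w
  proof -
    have "P (\<delta> b) w = (\<Prod>b'\<in>Basis. if b' = b then w \<bullet> b' else 1)"
      unfolding P_def \<delta>_def by (intro prod.cong) auto
    then show ?thesis using that by simp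
  qed
  have \<delta>_inj: "inj_on \<delta> Basis"
  proof (rule inj_onI)
    fix b b' :: 'a assume "b \<in> Basis" "b' \<in> Basis" "\<delta> b = \<delta> b'"
    then have "\<delta> b b = \<delta> b' b" by simp
    then show "b = b'" using \<open>b \<in> Basis\<close> by (simp add: \<delta>_def split: if_splits)
  qed
  have z\<delta>: "z \<noteq> \<delta> b" if "b \<in> Basis" for b
  proof
    assume "z = \<delta> b"
    then have "z b = \<delta> b b" by simp
    then show False using that by (simp add: z_def \<delta>_def)
  qed
  have big: "(\<Sum>b\<in>Basis. \<alpha> b) \<ge> 2" if "\<alpha> \<in> ?I - A1" for \<alpha>
  proof (rule ccontr)
    assume "\<not> ?thesis"
    then consider "(\<Sum>b\<in>Basis. \<alpha> b) = 0" | "(\<Sum>b\<in>Basis. \<alpha> b) = 1" by linarith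
    then show False
    proof cases
      case 1
      then have "\<alpha> = z"
        using that by (intro ext) (auto simp: z_def PiE_def extensional_def)
      then show ?thesis using that by (simp add: A1_def)
    next
      case 2
      then obtain b where b: "b \<in> Basis" "\<alpha> b = 1" "\<And>b'. b' \<in> Basis \<Longrightarrow> b' \<noteq> b \<Longrightarrow> \<alpha> b' = 0"
        using sum_eq_1_iff[of Basis \<alpha>] by auto
      then have "\<alpha> = \<delta> b"
        using that by (intro ext) (auto simp: \<delta>_def PiE_def extensional_def)
      then show ?thesis using that b by (simp add: A1_def)
    qed
  qed
  define D where "D w = (\<Sum>b\<in>Basis. (w \<bullet> b) * c (\<delta> b))" for w
  define M where "M = infsum m ?I"
  have fa: "f a = c z"
  proof -
    have "P \<alpha> 0 * c \<alpha> = 0" if "\<alpha> \<in> ?I - {z}" for \<alpha>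
    proof -
      have "\<exists>b\<in>Basis. \<alpha> b \<noteq> 0"
      proof (rule ccontr)
        assume "\<not> ?thesis"
        then have "\<alpha> = z"
          using that by (intro ext) (auto simp: z_def PiE_def extensional_def)
        then show False using that by simp
      qed
      then show ?thesis by (auto simp: P_def)
    qed
    then have "((\<lambda>\<alpha>. P \<alpha> 0 * c \<alpha>) has_sum P z 0 * c z) ?I \<longleftrightarrow>
        ((\<lambda>\<alpha>. P \<alpha> 0 * c \<alpha>) has_sum P z 0 * c z) {z}"
      by (intro has_sum_cong_neutral) (use zI in auto)
    then have "((\<lambda>\<alpha>. P \<alpha> 0 * c \<alpha>) has_sum P z 0 * c z) ?I"
      by (simp add: has_sum_finiteI)
    moreover have "((\<lambda>\<alpha>. P \<alpha> 0 * c \<alpha>) has_sum f a) ?I"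
      using c[of a] r by simp
    ultimately show ?thesis
      using has_sum_unique[of "\<lambda>\<alpha>. P \<alpha> 0 * c \<alpha>" ?I "f a" "P z 0 * c z"] by (simp add: Pz)
  qed
  have est: "norm (f x - f a - D (x - a)) \<le> (norm (x - a) / \<rho>)\<^sup>2 * M" if x: "norm (x - a) < min \<rho> r" for x
  proof -
    let ?w = "x - a"
    let ?g = "\<lambda>\<alpha>. P \<alpha> ?w * c \<alpha>"
    have "x \<in> ball a r" using x by (simp add: dist_norm norm_minus_commute)
    then have "(?g has_sum f x) ?I" by (rule c)
    moreover have "(?g has_sum sum ?g A1) A1"
      by (rule has_sum_finite) (simp add: A1_def)
    moreover have "A1 \<subseteq> ?I" using zI by (auto simp: A1_def)
    ultimately have 1: "(?g has_sum (f x - sum ?g A1)) (?I - A1)"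
      by (rule has_sum_Diff)
    have "sum ?g A1 = c z + D ?w"
      unfolding A1_def using z\<delta> \<delta>_inj
      by (subst sum.insert) (auto simp: Pz sum.reindex P\<delta> D_def)
    with 1 fa have 2: "(?g has_sum (f x - f a - D ?w)) (?I - A1)"
      by (simp add: algebra_simps)
    \<comment> \<open>At \<open>w0\<close> a monomial has the value \<rho> to the power of its
      degree, so at ?w it is at most (norm ?w / \<rho>) to that power times the value at
      \<open>w0\<close>. The base is below 1 and the degree at least 2.\<close>
    have bound: "norm (?g \<alpha>) \<le> (norm ?w / \<rho>)\<^sup>2 * m \<alpha>" if \<alpha>: "\<alpha> \<in> ?I - A1" for \<alpha>
    proof -
      have "\<bar>P \<alpha> ?w\<bar> = (\<Prod>b\<in>Basis. \<bar>?w \<bullet> b\<bar> ^ \<alpha> b)"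
        by (simp add: P_def abs_prod power_abs)
      also have "\<dots> \<le> (\<Prod>b\<in>Basis. (norm ?w / \<rho>) ^ \<alpha> b * \<rho> ^ \<alpha> b)"
        using \<rho> by (intro prod_mono) (auto simp: power_mult_distrib[symmetric] intro!: power_mono Basis_le_norm)
      also have "\<dots> = (norm ?w / \<rho>) ^ (\<Sum>b\<in>Basis. \<alpha> b) * P \<alpha> w0"
        by (simp add: prod.distrib power_sum P_def w0b)
      also have "\<dots> \<le> (norm ?w / \<rho>)\<^sup>2 * P \<alpha> w0"
        using big[OF \<alpha>] x \<rho> P0 by (intro mult_right_mono power_decreasing) auto
      finally show ?thesis
        by (simp add: m_def abs_mult mult.assoc[symmetric] mult_right_mono)
    qed
    have ms: "(\<lambda>\<alpha>. (norm ?w / \<rho>)\<^sup>2 * m \<alpha>) summable_on ?I"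
      by (intro summable_on_cmult_right m)
    have ns: "(\<lambda>\<alpha>. norm (?g \<alpha>)) summable_on (?I - A1)"
      by (rule summable_on_iff_abs_summable_on_real[THEN iffD1]) (use 2 in \<open>auto simp: summable_on_def\<close>)
    have "norm (f x - f a - D ?w) \<le> infsum (\<lambda>\<alpha>. norm (?g \<alpha>)) (?I - A1)"
      by (rule norm_has_sum_bound[OF has_sum_infsum[OF ns] 2])
    also have "\<dots> \<le> infsum (\<lambda>\<alpha>. (norm ?w / \<rho>)\<^sup>2 * m \<alpha>) ?I"
      using bound P0 by (intro infsum_mono_neutral ns ms) (auto simp: m_def)
    also have "\<dots> = (norm ?w / \<rho>)\<^sup>2 * M"
      unfolding M_def by (rule infsum_cmult_right) (use m in simp)
    finally show ?thesis .
  qed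
  have M: "M \<ge> 0" unfolding M_def by (rule infsum_nonneg) (use P0 in \<open>simp add: m_def\<close>)
  have "(f has_derivative D) (at a)"
    unfolding has_derivative_at_alt
  proof (intro conjI allI impI)
    show "bounded_linear D"
      unfolding D_def by (intro bounded_linear_sum bounded_linear_mult_const bounded_linear_inner_left)
    fix e :: real assume e: "e > 0"
    define d where "d = min (min \<rho> r) (e * \<rho>\<^sup>2 / (M + 1))"
    have d: "d > 0" using \<rho> r e M by (simp add: d_def)
    show "\<exists>d>0. \<forall>x. norm (x - a) < d \<longrightarrow> norm (f x - f a - D (x - a)) \<le> e * norm (x - a)"
    proof (intro exI[of _ d] conjI allI impI d)
      fix x assume x: "norm (x - a) < d"
      then have "norm (f x - f a - D (x - a)) \<le> (norm (x - a) / \<rho>)\<^sup>2 * M"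
        by (intro est) (simp add: d_def)
      also have "\<dots> \<le> (norm (x - a) / \<rho>)\<^sup>2 * (M + 1)"
        by (intro mult_left_mono) auto
      also have "\<dots> = norm (x - a) * (norm (x - a) * (M + 1) / \<rho>\<^sup>2)"
        by (simp add: power_divide power2_eq_square)
      also have "\<dots> \<le> norm (x - a) * e"
      proof (rule mult_left_mono)
        have "norm (x - a) \<le> e * \<rho>\<^sup>2 / (M + 1)" using x by (simp add: d_def)
        then have "norm (x - a) * (M + 1) \<le> e * \<rho>\<^sup>2"
          using M by (simp add: pos_le_divide_eq)
        then show "norm (x - a) * (M + 1) / \<rho>\<^sup>2 \<le> e"
          using \<rho> by (simp add: pos_divide_le_eq)
      qed simp
      finally show "norm (f x - f a - D (x - a)) \<le> e * norm (x - a)" by (simp add: mult.commute)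
    qed
  qed
  then show ?thesis unfolding differentiable_def by blast
qed

lemma real_analytic_on_imp_differentiable:
  fixes f :: "'a::euclidean_space \<Rightarrow> 'b::euclidean_space"
  assumes f: "real_analytic_on f S" and a: "a \<in> S"
  shows "f differentiable (at a)"
proof -
  have "(\<lambda>x. f x \<bullet> i) differentiable (at a)" for i
  proof (rule real_analytic_on_imp_differentiable_real[OF _ a])
    show "real_analytic_on (\<lambda>x. f x \<bullet> i) S"
      unfolding real_analytic_on_def
    proof
      fix a assume "a \<in> S"
      then obtain r c where r: "r > 0" and c: "\<And>x. x \<in> ball a r \<Longrightarrow>
          ((\<lambda>\<alpha>. (\<Prod>b\<in>Basis. ((x - a) \<bullet> b) ^ \<alpha> b) *\<^sub>R c \<alpha>) has_sum f x) (Basis \<rightarrow>\<^sub>E (UNIV :: nat set))"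
        using f unfolding real_analytic_on_def by blast
      have "((\<lambda>\<alpha>. (\<Prod>b\<in>Basis. ((x - a) \<bullet> b) ^ \<alpha> b) *\<^sub>R (c \<alpha> \<bullet> i)) has_sum f x \<bullet> i) (Basis \<rightarrow>\<^sub>E (UNIV :: nat set))"
        if "x \<in> ball a r" for x
        using has_sum_bounded_linear[OF bounded_linear_inner_left c[OF that], of i] by (simp add: o_def)
      then show "\<exists>r>0. \<exists>c. \<forall>x\<in>ball a r.
          ((\<lambda>\<alpha>. (\<Prod>b\<in>Basis. ((x - a) \<bullet> b) ^ \<alpha> b) *\<^sub>R c \<alpha>) has_sum f x \<bullet> i) (Basis \<rightarrow>\<^sub>E (UNIV :: nat set))"
        using r by (intro exI[of _ r] conjI exI[of _ "\<lambda>\<alpha>. c \<alpha> \<bullet> i"]) auto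
    qed
  qed
  then show ?thesis
    by (simp add: differentiable_componentwise_within[of f a UNIV])
qed

section \<open>Derivatives of maps between manifolds\<close>

lemma has_derivative_cong_eventually:
  assumes "(f has_derivative D) (at x)" "\<forall>\<^sub>F y in nhds x. f y = g y"
  shows "(g has_derivative D) (at x)"
  using assms eventually_nhds_x_imp_x[OF assms(2)]
  by (auto intro!: has_derivative_transform_eventually[OF assms(1)] simp: eventually_at_filter elim: eventually_mono)

lemma has_vector_derivative_cong_eventually:
  assumes "(f has_vector_derivative D) (at x)" "\<forall>\<^sub>F y in nhds x. f y = g y"
  shows "(g has_vector_derivative D) (at x)"
  using assms has_derivative_cong_eventually unfolding has_vector_derivative_def by blast

lemma eventually_compose_isCont:
  assumes "isCont f p" "\<forall>\<^sub>F q in nhds (f p). P q"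
  shows "\<forall>\<^sub>F q in nhds p. P (f q)"
proof -
  have "filterlim f (nhds (f p)) (nhds p)"
    using isContD[OF assms(1)] by (simp add: tendsto_at_iff_tendsto_nhds)
  then show ?thesis
    using assms(2) unfolding filterlim_iff by blast
qed

lemma is_chartD:
  fixes c :: "('m::t2_space, 'e::t2_space) chart"
  assumes "is_chart c"
  shows "open (fst c)" "open (snd c ` fst c)"
    and "p \<in> fst c \<Longrightarrow> chart_inv c (snd c p) = p"
    and "z \<in> snd c ` fst c \<Longrightarrow> chart_inv c z \<in> fst c"
    and "z \<in> snd c ` fst c \<Longrightarrow> snd c (chart_inv c z) = z"
    and "p \<in> fst c \<Longrightarrow> isCont (snd c) p"
    and "z \<in> snd c ` fst c \<Longrightarrow> isCont (chart_inv c) z"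
proof -
  have hom: "homeomorphism (fst c) (snd c ` fst c) (snd c) (chart_inv c)"
    and o: "open (fst c)" "open (snd c ` fst c)"
    using assms by (auto simp: is_chart_def)
  show "open (fst c)" "open (snd c ` fst c)" by (fact o)+
  show "chart_inv c (snd c p) = p" if "p \<in> fst c"
    using hom that by (auto simp: homeomorphism_def)
  show "chart_inv c z \<in> fst c" "snd c (chart_inv c z) = z" if "z \<in> snd c ` fst c"
    using hom that by (auto simp: homeomorphism_def)
  show "isCont (snd c) p" if "p \<in> fst c"
    using hom o(1) that continuous_on_eq_continuous_at by (auto simp: homeomorphism_def)
  show "isCont (chart_inv c) z" if "z \<in> snd c ` fst c"
    using hom o(2) that continuous_on_eq_continuous_at by (auto simp: homeomorphism_def)
qed

lemma eventually_chart_inv: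
  fixes c :: "('m::t2_space, 'e::t2_space) chart"
  assumes c: "is_chart c" "p \<in> fst c" and P: "\<forall>\<^sub>F q in nhds p. P q"
  shows "\<forall>\<^sub>F z in nhds (snd c p). P (chart_inv c z)"
proof (rule eventually_compose_isCont[where f = "chart_inv c" and P = P])
  show "isCont (chart_inv c) (snd c p)"
    using is_chartD(7)[OF c(1)] c(2) by blast
  show "\<forall>\<^sub>F q in nhds (chart_inv c (snd c p)). P q"
    using P is_chartD(3)[OF c] by simp
qed

lemma eventually_in_chart:
  fixes c :: "('m::t2_space, 'e::t2_space) chart"
  assumes "is_chart c" "p \<in> fst c"
  shows "\<forall>\<^sub>F q in nhds p. q \<in> fst c"
  using is_chartD(1)[OF assms(1)] assms(2) by (rule eventually_nhds_in_open)

text \<open>The change of tangent coordinates at p. Taking the selected chart at p for c or d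
  converts between the fixed model of the tangent space and the coordinates of an arbitrary
  chart.\<close>

definition transition ::
    "('m, 'e::real_normed_vector) chart \<Rightarrow> ('m, 'f::real_normed_vector) chart \<Rightarrow> 'm \<Rightarrow> 'e \<Rightarrow> 'f" where
  "transition c d p = frechet_derivative (snd d \<circ> chart_inv c) (at (snd c p))"

lemma complex_manifold_holomorphic_chart:
  assumes "complex_manifold A" "c \<in> A"
  shows "holomorphic_chart A c"
proof -
  have "hol_map_on (snd c \<circ> chart_inv d) (snd d ` (fst c \<inter> fst d))" if "d \<in> A" for d
    using assms that by (subst Int_commute) (auto simp: complex_manifold_def)
  then show ?thesis
    using assms by (auto simp: complex_manifold_def holomorphic_chart_def)
qed

lemma complex_manifold_is_chart: "complex_manifold A \<Longrightarrow> c \<in> A \<Longrightarrow> is_chart c"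
  by (simp add: complex_manifold_def)

lemma holomorphic_chart_is_chart: "holomorphic_chart A c \<Longrightarrow> is_chart c"
  by (simp add: holomorphic_chart_def)

lemma chart_at:
  assumes "complex_manifold A"
  shows "chart_at A p \<in> A" "p \<in> fst (chart_at A p)"
proof -
  have "\<exists>c. c \<in> A \<and> p \<in> fst c"
    using assms unfolding complex_manifold_def by (metis UNIV_I UN_E)
  from someI_ex[OF this] show "chart_at A p \<in> A" "p \<in> fst (chart_at A p)"
    by (auto simp: chart_at_def)
qed

text \<open>The chart c may be any holomorphic chart compatible with the atlas: the slice charts of
  Lagrangian fibres need not belong to \<open>A\<close>.\<close>

lemma transition:
  assumes c: "holomorphic_chart A c" and d: "d \<in> A" and p: "p \<in> fst c" "p \<in> fst d"
  shows "((snd d \<circ> chart_inv c) has_derivative transition c d p) (at (snd c p))"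
    and "((snd c \<circ> chart_inv d) has_derivative transition d c p) (at (snd d p))"
    and "transition c d p (J_std v) = J_std (transition c d p v)"
    and "transition d c p (J_std w) = J_std (transition d c p w)"
  using assms CR_onD[of J_std J_std "snd d \<circ> chart_inv c" "snd c ` (fst c \<inter> fst d)" "snd c p"]
    CR_onD[of J_std J_std "snd c \<circ> chart_inv d" "snd d ` (fst c \<inter> fst d)" "snd d p"]
  by (auto simp: holomorphic_chart_def transition_def)

lemma transition_inverse:
  assumes M: "complex_manifold A" and c: "holomorphic_chart A c" and d: "d \<in> A"
    and p: "p \<in> fst c" "p \<in> fst d"
  shows "transition d c p (transition c d p v) = v"
    and "transition c d p (transition d c p w) = w"
proof -
  have inv: "transition d' c' p (transition c' d' p v) = v"
    if c': "is_chart c'" "p \<in> fst c'" and d': "is_chart d'" "p \<in> fst d'"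
      and 1: "((snd d' \<circ> chart_inv c') has_derivative transition c' d' p) (at (snd c' p))"
      and 2: "((snd c' \<circ> chart_inv d') has_derivative transition d' c' p) (at (snd d' p))"
    for c' d' :: "('a, complex^'n) chart" and v
  proof -
    have "(snd d' \<circ> chart_inv c') (snd c' p) = snd d' p"
      using is_chartD(3)[OF c'] by simp
    then have "((snd c' \<circ> chart_inv d') \<circ> (snd d' \<circ> chart_inv c') has_derivative
        transition d' c' p \<circ> transition c' d' p) (at (snd c' p))"
      using diff_chain_at[OF 1, of "snd c' \<circ> chart_inv d'" "transition d' c' p"] 2 by simp
    moreover have "\<forall>\<^sub>F z in nhds (snd c' p). z \<in> snd c' ` fst c'"
      using c'(2) by (intro eventually_nhds_in_open is_chartD(2)[OF c'(1)]) auto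
    then have "\<forall>\<^sub>F z in nhds (snd c' p). ((snd c' \<circ> chart_inv d') \<circ> (snd d' \<circ> chart_inv c')) z = id z"
      using eventually_chart_inv[OF c' eventually_in_chart[OF d']]
    proof eventually_elim
      case (elim z)
      then show ?case
        using is_chartD(3)[OF d'(1) elim(2)] is_chartD(5)[OF c'(1) elim(1)] by simp
    qed
    ultimately have "(id has_derivative transition d' c' p \<circ> transition c' d' p) (at (snd c' p))"
      by (rule has_derivative_cong_eventually)
    from has_derivative_unique[OF this has_derivative_id]
    show ?thesis by (simp add: fun_eq_iff)
  qed
  note ic = holomorphic_chart_is_chart[OF c] and id = complex_manifold_is_chart[OF M d]
  show "transition d c p (transition c d p v) = v"
    by (rule inv[OF ic p(1) id p(2) transition(1,2)[OF c d p]])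
  show "transition c d p (transition d c p w) = w"
    by (rule inv[OF id p(2) ic p(1) transition(2,1)[OF c d p]])
qed

text \<open>\<open>mderiv\<close> has a value even where no derivative exists, so existence is
  recorded separately. Continuity is included because coordinate maps are junk outside their
  domains: f must send a neighbourhood of p into the chart at \<open>f p\<close> for the chain rule
  to make sense.\<close>

definition has_mderiv :: "('m::t2_space, 'e::real_normed_vector) chart set \<Rightarrow>
    ('k::topological_space, 'f::real_normed_vector) chart set \<Rightarrow> ('m \<Rightarrow> 'k) \<Rightarrow> 'm \<Rightarrow> ('e \<Rightarrow> 'f) \<Rightarrow> bool" where
  "has_mderiv A B f p D \<longleftrightarrow> isCont f p \<and>
    ((coord_at B (f p) \<circ> f \<circ> chart_inv (chart_at A p)) has_derivative D) (at (coord_at A p p))"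

lemma has_mderiv_imp_mderiv: "has_mderiv A B f p D \<Longrightarrow> mderiv A B f p = D"
  unfolding has_mderiv_def mderiv_def using frechet_derivative_at by metis

lemma has_mderiv_linear: "has_mderiv A B f p D \<Longrightarrow> linear D"
  unfolding has_mderiv_def using has_derivative_linear by blast

text \<open>Passing through the chart d changes nothing near p, where f stays inside its domain. The
  map g is arbitrary, which covers functions as well as maps read in coordinates; f = id gives
  changes of charts.\<close>

lemma chart_rep_chain:
  fixes c :: "('m::t2_space, 'e::real_normed_vector) chart" and d :: "('k::t2_space, 'f::real_normed_vector) chart"
  assumes c: "is_chart c" "p \<in> fst c" and d: "is_chart d" "f p \<in> fst d"
    and cont: "isCont f p"
    and f: "((snd d \<circ> f \<circ> chart_inv c) has_derivative D) (at (snd c p))"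
    and g: "((g \<circ> chart_inv d) has_derivative E) (at (snd d (f p)))"
  shows "((g \<circ> f \<circ> chart_inv c) has_derivative E \<circ> D) (at (snd c p))"
proof (rule has_derivative_cong_eventually)
  have "(snd d \<circ> f \<circ> chart_inv c) (snd c p) = snd d (f p)"
    using is_chartD(3)[OF c] by simp
  then show "((g \<circ> chart_inv d) \<circ> (snd d \<circ> f \<circ> chart_inv c) has_derivative E \<circ> D) (at (snd c p))"
    using diff_chain_at[OF f, of "g \<circ> chart_inv d" E] g by simp
  show "\<forall>\<^sub>F z in nhds (snd c p). ((g \<circ> chart_inv d) \<circ> (snd d \<circ> f \<circ> chart_inv c)) z = (g \<circ> f \<circ> chart_inv c) z"
    using eventually_chart_inv[OF c eventually_compose_isCont[OF cont eventually_in_chart[OF d]]]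
    by eventually_elim (simp add: is_chartD(3)[OF d(1)])
qed

text \<open>Lets a derivative be computed in whatever charts are convenient and be carried back to
  the selected ones.\<close>

lemma has_mderiv_of_charts:
  assumes A: "complex_manifold A" and B: "complex_manifold B"
    and c: "c \<in> A" "p \<in> fst c" and d: "d \<in> B" "f p \<in> fst d" and cont: "isCont f p"
    and f: "((snd d \<circ> f \<circ> chart_inv c) has_derivative D) (at (snd c p))"
  shows "has_mderiv A B f p
    (transition d (chart_at B (f p)) (f p) \<circ> D \<circ> transition (chart_at A p) c p)"
proof -
  let ?a = "chart_at A p" and ?b = "chart_at B (f p)"
  note a = chart_at[OF A, of p] and b = chart_at[OF B, of "f p"]
  note ia = complex_manifold_is_chart[OF A a(1)] and ic = complex_manifold_is_chart[OF A c(1)]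
    and id = complex_manifold_is_chart[OF B d(1)]
  have 1: "((snd c \<circ> id \<circ> chart_inv ?a) has_derivative transition ?a c p) (at (snd ?a p))"
    using transition(1)[OF complex_manifold_holomorphic_chart[OF A a(1)] c(1) a(2) c(2)] by simp
  have 2: "((snd ?b \<circ> chart_inv d) has_derivative transition d ?b (f p)) (at (snd d (f p)))"
    by (rule transition(1)[OF complex_manifold_holomorphic_chart[OF B d(1)] b(1) d(2) b(2)])
  have "((snd ?b \<circ> f \<circ> chart_inv c) has_derivative transition d ?b (f p) \<circ> D) (at (snd c p))"
    by (rule chart_rep_chain[OF ic c(2) id d(2) cont f 2])
  then have 3: "((snd ?b \<circ> f \<circ> chart_inv c) has_derivative transition d ?b (f p) \<circ> D) (at (snd c (id p)))"
    by simp
  have "((snd ?b \<circ> f) \<circ> id \<circ> chart_inv ?a has_derivative (transition d ?b (f p) \<circ> D) \<circ> transition ?a c p) (at (snd ?a p))"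
    by (rule chart_rep_chain[where f = id, OF ia a(2) ic _ _ 1 3]) (use c in auto)
  then have "((snd ?b \<circ> f \<circ> chart_inv ?a) has_derivative transition d ?b (f p) \<circ> D \<circ> transition ?a c p) (at (snd ?a p))"
    by (simp only: comp_id)
  then show ?thesis
    using cont by (simp add: has_mderiv_def coord_at_def comp_assoc)
qed

lemma has_mderiv_compose:
  assumes A: "complex_manifold A" and B: "complex_manifold B"
    and f: "has_mderiv A B f p D" and g: "has_mderiv B C g (f p) E"
  shows "has_mderiv A C (g \<circ> f) p (E \<circ> D)"
proof -
  let ?a = "chart_at A p" and ?b = "chart_at B (f p)"
  note a = chart_at[OF A, of p] and b = chart_at[OF B, of "f p"]
  have "((snd (chart_at C (g (f p))) \<circ> g) \<circ> f \<circ> chart_inv ?a has_derivative E \<circ> D) (at (snd ?a p))"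
    by (rule chart_rep_chain[where f = f and p = p, OF complex_manifold_is_chart[OF A a(1)] a(2)
          complex_manifold_is_chart[OF B b(1)] b(2)])
       (use f g in \<open>simp_all only: has_mderiv_def coord_at_def\<close>)
  moreover have "isCont (g \<circ> f) p"
    using f g by (auto simp: has_mderiv_def intro: continuous_at_compose)
  ultimately show ?thesis
    by (simp add: has_mderiv_def coord_at_def comp_assoc)
qed

definition has_fun_deriv :: "('m::topological_space, 'e::real_normed_vector) chart set \<Rightarrow>
    ('m \<Rightarrow> 'v::real_normed_vector) \<Rightarrow> 'm \<Rightarrow> ('e \<Rightarrow> 'v) \<Rightarrow> bool" where
  "has_fun_deriv A g p D \<longleftrightarrow> ((g \<circ> chart_inv (chart_at A p)) has_derivative D) (at (coord_at A p p))"

lemma has_fun_deriv_imp_fun_deriv: "has_fun_deriv A g p D \<Longrightarrow> fun_deriv A g p = D"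
  unfolding has_fun_deriv_def fun_deriv_def using frechet_derivative_at by metis

lemma has_fun_deriv_linear: "has_fun_deriv A g p D \<Longrightarrow> linear D"
  unfolding has_fun_deriv_def using has_derivative_linear by blast

lemma has_fun_deriv_compose:
  assumes A: "complex_manifold A" and B: "complex_manifold B"
    and f: "has_mderiv A B f p D" and g: "has_fun_deriv B g (f p) E"
  shows "has_fun_deriv A (g \<circ> f) p (E \<circ> D)"
proof -
  let ?a = "chart_at A p" and ?b = "chart_at B (f p)"
  note a = chart_at[OF A, of p] and b = chart_at[OF B, of "f p"]
  have "(g \<circ> f \<circ> chart_inv ?a has_derivative E \<circ> D) (at (snd ?a p))"
    by (rule chart_rep_chain[where f = f and p = p, OF complex_manifold_is_chart[OF A a(1)] a(2)
          complex_manifold_is_chart[OF B b(1)] b(2)])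
       (use f g in \<open>simp_all only: has_mderiv_def has_fun_deriv_def coord_at_def\<close>)
  then show ?thesis
    by (simp add: has_fun_deriv_def coord_at_def)
qed

lemma has_fun_deriv_bounded_linear:
  assumes "bounded_linear L" "has_fun_deriv A g p D"
  shows "has_fun_deriv A (\<lambda>q. L (g q)) p (\<lambda>u. L (D u))"
  using bounded_linear.has_derivative[OF assms(1)] assms(2)
  by (simp add: has_fun_deriv_def o_def)

lemma chartwise_fun_hol_has_fun_deriv:
  assumes A: "complex_manifold A" and g: "chartwise_fun hol_fun_on A g"
  shows "has_fun_deriv A g p (fun_deriv A g p)"
    and "fun_deriv A g p (J_std u) = \<i> * fun_deriv A g p u"
proof -
  let ?a = "chart_at A p"
  note a = chart_at[OF A, of p]
  have "hol_fun_on (g \<circ> chart_inv ?a) (snd ?a ` fst ?a)"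
    using g a(1) by (simp add: chartwise_fun_def)
  from hol_fun_onD(1,2)[OF this, of "snd ?a p"] a(2)
  show "has_fun_deriv A g p (fun_deriv A g p)" "fun_deriv A g p (J_std u) = \<i> * fun_deriv A g p u"
    by (auto simp: has_fun_deriv_def fun_deriv_def coord_at_def)
qed

section \<open>Velocities of curves\<close>

lemma curve_chain:
  fixes d :: "('m::t2_space, 'e::real_normed_vector) chart"
  assumes d: "is_chart d" "\<gamma> t \<in> fst d" and cont: "isCont \<gamma> t"
    and \<gamma>: "((snd d \<circ> \<gamma>) has_vector_derivative v) (at t)"
    and g: "((g \<circ> chart_inv d) has_derivative E) (at (snd d (\<gamma> t)))"
  shows "((g \<circ> \<gamma>) has_vector_derivative E v) (at t)"
proof (rule has_vector_derivative_cong_eventually)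
  show "((g \<circ> chart_inv d) \<circ> (snd d \<circ> \<gamma>) has_vector_derivative E v) (at t)"
    using diff_chain_at[OF \<gamma>[unfolded has_vector_derivative_def], of "g \<circ> chart_inv d" E] g
      linear_scale[OF has_derivative_linear[OF g]]
    by (simp add: has_vector_derivative_def o_def)
  show "\<forall>\<^sub>F s in nhds t. ((g \<circ> chart_inv d) \<circ> (snd d \<circ> \<gamma>)) s = (g \<circ> \<gamma>) s"
    using eventually_compose_isCont[OF cont eventually_in_chart[OF d]]
    by eventually_elim (simp add: is_chartD(3)[OF d(1)])
qed

lemma has_velocity_in_chart:
  assumes A: "complex_manifold A" and \<gamma>: "has_velocity A \<gamma> t v" and c: "c \<in> A" "\<gamma> t \<in> fst c"
  shows "((snd c \<circ> \<gamma>) has_vector_derivative transition (chart_at A (\<gamma> t)) c (\<gamma> t) v) (at t)"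
proof -
  let ?a = "chart_at A (\<gamma> t)"
  note a = chart_at[OF A, of "\<gamma> t"]
  show ?thesis
    by (rule curve_chain[where \<gamma> = \<gamma> and t = t, OF complex_manifold_is_chart[OF A a(1)] a(2) _ _
        transition(1)[OF complex_manifold_holomorphic_chart[OF A a(1)] c(1) a(2) c(2)]])
       (use \<gamma> in \<open>auto simp: has_velocity_def coord_at_def\<close>)
qed

lemma has_velocity_compose:
  assumes A: "complex_manifold A" and \<gamma>: "has_velocity A \<gamma> t v" and f: "has_mderiv A B f (\<gamma> t) D"
  shows "has_velocity B (f \<circ> \<gamma>) t (D v)"
proof -
  let ?a = "chart_at A (\<gamma> t)"
  note a = chart_at[OF A, of "\<gamma> t"]
  have "((snd (chart_at B (f (\<gamma> t))) \<circ> f) \<circ> \<gamma> has_vector_derivative D v) (at t)"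
    by (rule curve_chain[where \<gamma> = \<gamma> and t = t, OF complex_manifold_is_chart[OF A a(1)] a(2)])
       (use \<gamma> f in \<open>simp_all only: has_velocity_def has_mderiv_def coord_at_def\<close>)
  moreover have "isCont (f \<circ> \<gamma>) t"
    using \<gamma> f by (auto simp: has_velocity_def has_mderiv_def intro: continuous_at_compose)
  ultimately show ?thesis
    by (simp add: has_velocity_def coord_at_def comp_assoc)
qed

lemma has_fun_deriv_along_curve:
  assumes A: "complex_manifold A" and \<gamma>: "has_velocity A \<gamma> t v" and g: "has_fun_deriv A g (\<gamma> t) D"
  shows "((g \<circ> \<gamma>) has_vector_derivative D v) (at t)"
proof -
  let ?a = "chart_at A (\<gamma> t)"
  note a = chart_at[OF A, of "\<gamma> t"]
  show ?thesis
    by (rule curve_chain[where \<gamma> = \<gamma> and t = t, OF complex_manifold_is_chart[OF A a(1)] a(2)])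
       (use \<gamma> g in \<open>auto simp: has_velocity_def has_fun_deriv_def coord_at_def\<close>)
qed

lemma chartwise_map_has_mderiv:
  assumes A: "complex_manifold A" and B: "complex_manifold B" and f: "chartwise_map P A B f"
    and P: "\<And>g S z. P g S \<Longrightarrow> z \<in> S \<Longrightarrow> g differentiable (at z)"
  shows "has_mderiv A B f p (mderiv A B f p)"
proof -
  let ?a = "chart_at A p" and ?b = "chart_at B (f p)"
  note a = chart_at[OF A, of p] and b = chart_at[OF B, of "f p"]
  have "P (snd ?b \<circ> f \<circ> chart_inv ?a) (snd ?a ` (fst ?a \<inter> f -` fst ?b))"
    using f a b by (simp add: chartwise_map_def)
  then have "(snd ?b \<circ> f \<circ> chart_inv ?a) differentiable (at (snd ?a p))"
    by (rule P) (use a b in auto)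
  moreover have "isCont f p"
    using f continuous_on_eq_continuous_at[OF open_UNIV, of f] by (auto simp: chartwise_map_def)
  ultimately show ?thesis
    by (simp add: has_mderiv_def mderiv_def coord_at_def frechet_derivative_works)
qed

lemma hol_map_mderiv_J:
  assumes A: "complex_manifold A" and B: "complex_manifold B" and f: "chartwise_map hol_map_on A B f"
  shows "has_mderiv A B f p (mderiv A B f p)"
    and "mderiv A B f p (J_std u) = J_std (mderiv A B f p u)"
proof -
  let ?a = "chart_at A p" and ?b = "chart_at B (f p)"
  note a = chart_at[OF A, of p] and b = chart_at[OF B, of "f p"]
  show "has_mderiv A B f p (mderiv A B f p)"
    by (rule chartwise_map_has_mderiv[OF A B f]) (auto simp: CR_on_def differentiable_def)
  have "hol_map_on (snd ?b \<circ> f \<circ> chart_inv ?a) (snd ?a ` (fst ?a \<inter> f -` fst ?b))"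
    using f a b by (simp add: chartwise_map_def)
  from CR_onD(2)[OF this, of "snd ?a p"] a b
  show "mderiv A B f p (J_std u) = J_std (mderiv A B f p u)"
    by (auto simp: mderiv_def coord_at_def)
qed

section \<open>The flow of a holomorphic Hamiltonian\<close>

lemma Hamilton_field:
  assumes "nondegenerate_alternating \<sigma>" and "has_fun_deriv A f p D"
  shows "\<sigma> p (Hamilton_field A \<sigma> f p :: 'e::euclidean_space) u = D u"
proof -
  have bil: "bilinear (\<sigma> p)" and nondeg: "\<And>u. (\<And>v. \<sigma> p u v = 0) \<Longrightarrow> u = 0"
    using assms(1) by (auto simp: nondegenerate_alternating_def)
  have "\<exists>!v. \<forall>u. \<sigma> p v u = D u"
    by (rule nondegenerate_form_ex1[OF bil nondeg has_fun_deriv_linear[OF assms(2)]])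
  then show ?thesis
    unfolding Hamilton_field_def has_fun_deriv_imp_fun_deriv[OF assms(2)]
    using theI'[of "\<lambda>v. \<forall>u. \<sigma> p v u = D u"] by blast
qed

lemma alternating_imp_skew:
  fixes B :: "'a::real_vector \<Rightarrow> 'a \<Rightarrow> 'b::real_vector"
  assumes "bilinear B" "\<And>u. B u u = 0"
  shows "B u v = - B v u"
proof -
  have "B (u + v) (u + v) = B u u + B u v + (B v u + B v v)"
    using assms(1) by (simp add: bilinear_ladd bilinear_radd add_ac)
  then have "B u v + B v u = 0" by (simp add: assms(2))
  then show ?thesis by (simp add: eq_neg_iff_add_eq_0)
qed

locale holomorphic_Hamiltonian_system =
  fixes A :: "('x::{t2_space,second_countable_topology}, complex^'d) chart set"
    and \<Omega> :: "('x, complex^'d, complex) two_form" and H :: "'x \<Rightarrow> complex"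
  assumes manifold: "complex_manifold A" and form: "holomorphic_symplectic_form A \<Omega>"
    and hol: "chartwise_fun hol_fun_on A H"
begin

definition V :: "'x \<Rightarrow> complex^'d" where
  "V = Hamilton_field A (\<lambda>p u v. Re (\<Omega> p u v)) (\<lambda>p. Re (H p))"

lemma form_bilinear: "bilinear (\<Omega> p)"
  and form_alternating: "\<Omega> p u u = 0"
  and form_nondegenerate: "(\<And>v. \<Omega> p u v = 0) \<Longrightarrow> u = 0"
  and form_J1: "\<Omega> p (J_std u) v = \<i> * \<Omega> p u v"
  using form by (auto simp: holomorphic_symplectic_form_def nondegenerate_alternating_def)

lemma form_skew: "\<Omega> p u v = - \<Omega> p v u"
  by (rule alternating_imp_skew[OF form_bilinear form_alternating])

lemma form_J2: "\<Omega> p u (J_std v) = \<i> * \<Omega> p u v"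
  using form_skew[of p u "J_std v"] form_J1[of p v u] form_skew[of p v u] by simp

lemma form_linear: "linear (\<lambda>u. \<Omega> p u v)" "linear (\<Omega> p u)"
  using form_bilinear[of p] by (auto simp: bilinear_def)

lemma Re_form_nondegenerate:
  assumes "\<And>v. Re (\<Omega> p u v) = 0" shows "u = 0"
proof (rule form_nondegenerate)
  fix v
  have "Im (\<Omega> p u v) = 0"
    using assms[of "J_std v"] by (simp add: form_J2)
  then show "\<Omega> p u v = 0"
    using assms by (simp add: complex_eq_iff)
qed

lemma Re_form_bilinear: "bilinear (\<lambda>u v. Re (\<Omega> p u v))"
  using form_linear[of p] linear_compose[OF _ bounded_linear.linear[OF bounded_linear_Re]]
  by (auto simp: bilinear_def o_def)

text \<open>The real parts agree by the definition of the field. Both sides are complex linear in u,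
  the right one because H is holomorphic, so inserting \<open>J_std u\<close> gives the imaginary
  parts.\<close>

lemma form_V: "\<Omega> p (V p) u = fun_deriv A H p u"
proof -
  have nd: "nondegenerate_alternating (\<lambda>p u v. Re (\<Omega> p u v))"
    using Re_form_bilinear Re_form_nondegenerate by (auto simp: nondegenerate_alternating_def form_alternating)
  have "Re (\<Omega> p (V p) u) = Re (fun_deriv A H p u)" for u
    unfolding V_def
    by (rule Hamilton_field[OF nd has_fun_deriv_bounded_linear[OF bounded_linear_Re
          chartwise_fun_hol_has_fun_deriv(1)[OF manifold hol]]])
  from this[of u] this[of "J_std u"] show ?thesis
    by (simp add: form_J2 chartwise_fun_hol_has_fun_deriv(2)[OF manifold hol] complex_eq_iff)
qed

section \<open>The Hamilton field and the form in a chart\<close>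

definition V_rep :: "('x, complex^'d) chart \<Rightarrow> complex^'d \<Rightarrow> complex^'d" where
  "V_rep c z = transition (chart_at A (chart_inv c z)) c (chart_inv c z) (V (chart_inv c z))"

context
  fixes c assumes c: "c \<in> A"
begin

lemma in_chart:
  assumes "z \<in> snd c ` fst c"
  shows "chart_inv c z \<in> fst c" "snd c (chart_inv c z) = z"
  using is_chartD(4,5)[OF complex_manifold_is_chart[OF manifold c]] assms by auto

lemmas transition_to_chart_at =
  transition[OF complex_manifold_holomorphic_chart[OF manifold c] chart_at(1)[OF manifold] _ chart_at(2)[OF manifold]]
lemmas transition_to_chart_at_inverse =
  transition_inverse[OF manifold complex_manifold_holomorphic_chart[OF manifold c] chart_at(1)[OF manifold] _ chart_at(2)[OF manifold]]

lemma form_rep_eq: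
  assumes "z \<in> snd c ` fst c"
  shows "form_rep A \<Omega> c z u v = \<Omega> (chart_inv c z) (transition c (chart_at A (chart_inv c z)) (chart_inv c z) u)
    (transition c (chart_at A (chart_inv c z)) (chart_inv c z) v)"
  using in_chart[OF assms] by (simp add: form_rep_def transition_def coord_at_def Let_def)

lemma form_rep_bilinear:
  assumes z: "z \<in> snd c ` fst c" shows "bilinear (form_rep A \<Omega> c z)"
proof -
  let ?p = "chart_inv c z"
  let ?T = "transition c (chart_at A ?p) ?p"
  have T: "linear ?T"
    using transition_to_chart_at(1)[OF in_chart(1)[OF z]] has_derivative_linear by blast
  have "linear (\<lambda>u. \<Omega> ?p (?T u) (?T v))" "linear (\<lambda>v. \<Omega> ?p (?T u) (?T v))" for u v
    using linear_compose[OF T form_linear(1)[of ?p "?T v"]] linear_compose[OF T form_linear(2)[of ?p "?T u"]]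
    by (simp_all add: o_def)
  then show ?thesis
    unfolding bilinear_def form_rep_eq[OF z] by blast
qed

lemma form_rep_skew:
  assumes z: "z \<in> snd c ` fst c" shows "form_rep A \<Omega> c z u v = - form_rep A \<Omega> c z v u"
  unfolding form_rep_eq[OF z] by (rule form_skew)

lemma form_rep_hol: "hol_fun_on (\<lambda>z. form_rep A \<Omega> c z u v) (snd c ` fst c)"
  using form c by (simp add: holomorphic_symplectic_form_def chartwise_form_def)

lemma H_rep_hol: "hol_fun_on (H \<circ> chart_inv c) (snd c ` fst c)"
  using hol c by (simp add: chartwise_fun_def)

lemma open_chart_image: "open (snd c ` fst c)"
  by (rule is_chartD(2)[OF complex_manifold_is_chart[OF manifold c]])

text \<open>The transition inside \<open>form_rep\<close> undoes the one in \<open>V_rep\<close>,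
  which leaves \<open>form_V\<close>; the remaining transition turns the differential of H into its
  coordinate expression.\<close>

lemma form_rep_V_rep:
  assumes z: "z \<in> snd c ` fst c"
  shows "form_rep A \<Omega> c z (V_rep c z) u = frechet_derivative (H \<circ> chart_inv c) (at z) u"
proof -
  let ?p = "chart_inv c z"
  let ?a = "chart_at A ?p"
  note p = in_chart[OF z]
  have "form_rep A \<Omega> c z (V_rep c z) u = \<Omega> ?p (V ?p) (transition c ?a ?p u)"
    unfolding form_rep_eq[OF z] V_rep_def by (simp add: transition_to_chart_at_inverse(2)[OF p(1)])
  also have "\<dots> = fun_deriv A H ?p (transition c ?a ?p u)"
    by (rule form_V)
  also have "\<dots> = frechet_derivative (H \<circ> chart_inv c) (at z) u"
  proof -
    have "((H \<circ> id \<circ> chart_inv c) has_derivative fun_deriv A H ?p \<circ> transition c ?a ?p) (at (snd c ?p))"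
    proof (rule chart_rep_chain[where f = id and d = ?a])
      show "((snd ?a \<circ> id \<circ> chart_inv c) has_derivative transition c ?a ?p) (at (snd c ?p))"
        using transition_to_chart_at(1)[OF p(1)] by simp
      show "((H \<circ> chart_inv ?a) has_derivative fun_deriv A H ?p) (at (snd ?a (id ?p)))"
        using chartwise_fun_hol_has_fun_deriv(1)[OF manifold hol, of ?p]
        by (simp add: has_fun_deriv_def coord_at_def)
    qed (use p chart_at[OF manifold] complex_manifold_is_chart[OF manifold] c in auto)
    then have "((H \<circ> chart_inv c) has_derivative fun_deriv A H ?p \<circ> transition c ?a ?p) (at z)"
      by (simp only: comp_id p(2))
    from frechet_derivative_at[OF this] show ?thesis
      by (simp add: fun_eq_iff)
  qed
  finally show ?thesis .
qed

text \<open>The sole source of regularity of the field: in coordinates it solves a nondegenerate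
  linear system whose coefficients and right-hand side are holomorphic.\<close>

lemma V_rep_hol: "hol_fun_on (\<lambda>z. V_rep c z $ k) (snd c ` fst c)"
proof (rule hol_fun_on_form_solution[where W = "form_rep A \<Omega> c" and b = "\<lambda>z. frechet_derivative (H \<circ> chart_inv c) (at z)"])
  fix z u v assume z: "z \<in> snd c ` fst c"
  let ?p = "chart_inv c z"
  note p = in_chart(1)[OF z]
  show "form_rep A \<Omega> c z (J_std u) v = \<i> * form_rep A \<Omega> c z u v"
    unfolding form_rep_eq[OF z] transition_to_chart_at(3)[OF p] by (rule form_J1)
  show "form_rep A \<Omega> c z u (J_std v) = \<i> * form_rep A \<Omega> c z u v"
    unfolding form_rep_eq[OF z] transition_to_chart_at(3)[OF p] by (rule form_J2)
next
  fix z u assume z: "z \<in> snd c ` fst c" and 0: "\<And>v. form_rep A \<Omega> c z u v = 0"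
  let ?p = "chart_inv c z"
  let ?a = "chart_at A ?p"
  note p = in_chart(1)[OF z]
  have "\<Omega> ?p (transition c ?a ?p u) v = 0" for v
    using 0[of "transition ?a c ?p v"] unfolding form_rep_eq[OF z] transition_to_chart_at_inverse(2)[OF p] .
  then have "transition c ?a ?p u = 0" by (rule form_nondegenerate)
  then have "transition ?a c ?p (transition c ?a ?p u) = transition ?a c ?p 0" by simp
  then show "u = 0"
    using transition_to_chart_at_inverse(1)[OF p] has_derivative_linear[OF transition_to_chart_at(2)[OF p]]
    by (simp add: linear_0)
qed (use open_chart_image form_rep_hol form_rep_bilinear form_rep_V_rep hol_fun_on_frechet_derivative[OF H_rep_hol] in auto)

lemma Lie_derivative_form_rep:
  assumes z: "z \<in> snd c ` fst c" and V': "(V_rep c has_derivative V') (at z)"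
  shows "frechet_derivative (\<lambda>z. form_rep A \<Omega> c z u v) (at z) (V_rep c z) +
    form_rep A \<Omega> c z (V' u) v + form_rep A \<Omega> c z u (V' v) = 0"
proof (rule Lie_derivative_Hamiltonian[OF open_chart_image z form_rep_bilinear form_rep_skew
      hol_fun_onD(1)[OF form_rep_hol z] _ form_rep_V_rep V'])
  show "((\<lambda>z. frechet_derivative (H \<circ> chart_inv c) (at z) u) has_derivative
      frechet_derivative (\<lambda>z. frechet_derivative (H \<circ> chart_inv c) (at z) u) (at z)) (at z)" for u
    by (rule hol_fun_onD(1)[OF hol_fun_on_frechet_derivative[OF H_rep_hol open_chart_image] z])
  show "frechet_derivative (\<lambda>z. frechet_derivative (H \<circ> chart_inv c) (at z) u) (at z) w =
      frechet_derivative (\<lambda>z. frechet_derivative (H \<circ> chart_inv c) (at z) w) (at z) u" for u w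
    by (rule hol_fun_on_second_derivative_symmetric[OF H_rep_hol open_chart_image z])
  show "frechet_derivative (\<lambda>z. form_rep A \<Omega> c z v w) (at z) u +
      frechet_derivative (\<lambda>z. form_rep A \<Omega> c z w u) (at z) v +
      frechet_derivative (\<lambda>z. form_rep A \<Omega> c z u v) (at z) w = 0" for u v w
    using form c z unfolding holomorphic_symplectic_form_def closed_form_def by blast
qed

lemma integral_curve_in_chart:
  assumes "has_velocity A \<gamma> s (V (\<gamma> s))" "\<gamma> s \<in> fst c"
  shows "((\<lambda>s. snd c (\<gamma> s)) has_vector_derivative V_rep c (snd c (\<gamma> s))) (at s)"
  using has_velocity_in_chart[OF manifold assms(1) c assms(2)]
    is_chartD(3)[OF complex_manifold_is_chart[OF manifold c] assms(2)]
  by (simp add: V_rep_def o_def)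

lemma eventually_in_chart_ball:
  assumes "p \<in> fst c" "r > 0"
  shows "\<forall>\<^sub>F q in nhds p. q \<in> fst c \<and> snd c q \<in> ball (snd c p) r"
proof -
  note ic = complex_manifold_is_chart[OF manifold c]
  have "\<forall>\<^sub>F z in nhds (snd c p). z \<in> ball (snd c p) r"
    using assms(2) by (intro eventually_nhds_in_open) auto
  from eventually_compose_isCont[OF is_chartD(6)[OF ic assms(1)] this]
  show ?thesis
    using eventually_in_chart[OF ic assms(1)] by (rule eventually_conj[rotated])
qed

end

text \<open>Around each time there is a ball on which agreement at one point forces agreement at
  all. Where the curves differ, the Hausdorff property makes this vacuous nearby; where they meet,
  both stay in one chart for a while and Gronwall's inequality with zero error applies.\<close>

lemma integral_curve_unique:
  assumes I: "open I" "connected I" and ab: "a \<in> I" "b \<in> I" and eq: "\<gamma>1 a = \<gamma>2 a"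
    and 1: "\<And>s. s \<in> I \<Longrightarrow> has_velocity A \<gamma>1 s (V (\<gamma>1 s))"
    and 2: "\<And>s. s \<in> I \<Longrightarrow> has_velocity A \<gamma>2 s (V (\<gamma>2 s))"
  shows "\<gamma>1 b = \<gamma>2 b"
proof (rule connected_induction_simple[where P = "\<lambda>s. \<gamma>1 s = \<gamma>2 s", OF I(2) ab eq])
  fix s assume s: "s \<in> I"
  have cont: "isCont \<gamma>1 s" "isCont \<gamma>2 s"
    using 1[OF s] 2[OF s] by (auto simp: has_velocity_def)
  have "\<exists>e>0. ball s e \<subseteq> I \<and> (\<forall>x\<in>ball s e. \<forall>y\<in>ball s e. \<gamma>1 x = \<gamma>2 x \<longrightarrow> \<gamma>1 y = \<gamma>2 y)"
  proof (cases "\<gamma>1 s = \<gamma>2 s")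
    case False
    then obtain U1 U2 where U: "open U1" "open U2" "\<gamma>1 s \<in> U1" "\<gamma>2 s \<in> U2" "U1 \<inter> U2 = {}"
      using hausdorff[OF False] by blast
    note eventually_compose_isCont[OF cont(1) eventually_nhds_in_open[OF U(1,3)]]
      eventually_compose_isCont[OF cont(2) eventually_nhds_in_open[OF U(2,4)]]
      eventually_nhds_in_open[OF I(1) s]
    then have "\<forall>\<^sub>F r in nhds s. r \<in> I \<and> \<gamma>1 r \<noteq> \<gamma>2 r"
      by eventually_elim (use U(5) in auto)
    then obtain e where "e > 0" "\<And>r. dist r s < e \<Longrightarrow> r \<in> I \<and> \<gamma>1 r \<noteq> \<gamma>2 r"
      unfolding eventually_nhds_metric by blast
    then show ?thesis by (intro exI[of _ e]) (auto simp: dist_commute)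
  next
    case True
    define c where "c = chart_at A (\<gamma>1 s)"
    have c: "c \<in> A" "\<gamma>1 s \<in> fst c" using chart_at[OF manifold] by (auto simp: c_def)
    obtain r L C V' where r: "r > 0" and L: "L \<ge> 0"
      and lip: "\<And>z w. z \<in> ball (snd c (\<gamma>1 s)) r \<Longrightarrow> w \<in> ball (snd c (\<gamma>1 s)) r \<Longrightarrow>
        norm (V_rep c w - V_rep c z) \<le> L * norm (w - z)"
      by (rule hol_fun_components_local_estimates[OF V_rep_hol[OF c(1)] open_chart_image[OF c(1)] imageI[OF c(2)]]) blast
    have ev: "\<forall>\<^sub>F q in nhds (\<gamma>1 s). q \<in> fst c \<and> snd c q \<in> ball (snd c (\<gamma>1 s)) r"
      by (rule eventually_in_chart_ball[OF c r])
    have "\<forall>\<^sub>F r in nhds s. r \<in> I"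
      by (rule eventually_nhds_in_open[OF I(1) s])
    then have "\<forall>\<^sub>F t in nhds s. t \<in> I \<and> (\<gamma>1 t \<in> fst c \<and> snd c (\<gamma>1 t) \<in> ball (snd c (\<gamma>1 s)) r) \<and>
        (\<gamma>2 t \<in> fst c \<and> snd c (\<gamma>2 t) \<in> ball (snd c (\<gamma>1 s)) r)"
      using eventually_compose_isCont[OF cont(1) ev] eventually_compose_isCont[OF cont(2) ev[unfolded True]]
      unfolding True by eventually_elim simp
    then obtain e where e: "e > 0" and near: "\<And>t. t \<in> ball s e \<Longrightarrow> t \<in> I"
        "\<And>t. t \<in> ball s e \<Longrightarrow> \<gamma>1 t \<in> fst c" "\<And>t. t \<in> ball s e \<Longrightarrow> snd c (\<gamma>1 t) \<in> ball (snd c (\<gamma>1 s)) r"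
        "\<And>t. t \<in> ball s e \<Longrightarrow> \<gamma>2 t \<in> fst c" "\<And>t. t \<in> ball s e \<Longrightarrow> snd c (\<gamma>2 t) \<in> ball (snd c (\<gamma>1 s)) r"
      unfolding eventually_nhds_metric by (auto simp: dist_commute)
    have "\<gamma>1 y = \<gamma>2 y" if x: "x \<in> ball s e" and y: "y \<in> ball s e" and eq: "\<gamma>1 x = \<gamma>2 x" for x y
    proof -
      let ?u = "\<lambda>t. snd c (\<gamma>1 t) - snd c (\<gamma>2 t)"
      have seg: "closed_segment x y \<subseteq> ball s e"
        using x y by (intro closed_segment_subset convex_ball)
      have "norm (?u y) \<le> (norm (?u x) + 0) * exp ((L + 1) * \<bar>y - x\<bar>)"
      proof (rule gronwall[OF L])
        fix t assume "t \<in> closed_segment x y"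
        then have t: "t \<in> ball s e" using seg by blast
        show "(?u has_vector_derivative (V_rep c (snd c (\<gamma>1 t)) - V_rep c (snd c (\<gamma>2 t)))) (at t)"
          by (intro has_vector_derivative_diff integral_curve_in_chart[OF c(1)] 1 2 near t)
        show "norm (V_rep c (snd c (\<gamma>1 t)) - V_rep c (snd c (\<gamma>2 t))) \<le> L * norm (?u t) + 0"
          using lip[OF near(5)[OF t] near(3)[OF t]] by simp
      qed simp
      then have "snd c (\<gamma>1 y) = snd c (\<gamma>2 y)" using eq by simp
      then show ?thesis
        using near(2,4)[OF y] is_chartD(3)[OF complex_manifold_is_chart[OF manifold c(1)]] by metis
    qed
    then show ?thesis using e near(1) by blast
  qed
  then show "\<exists>T. openin (top_of_set I) T \<and> s \<in> T \<and> (\<forall>x\<in>T. \<forall>y\<in>T. \<gamma>1 x = \<gamma>2 x \<longrightarrow> \<gamma>1 y = \<gamma>2 y)"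
    using I(1) by (meson open_ball centre_in_ball open_subset)
qed

text \<open>Differentiability and invariance of the form are bundled because the induction along an
  orbit has to propagate both.\<close>

definition preserves_form_at :: "('x \<Rightarrow> 'x) \<Rightarrow> 'x \<Rightarrow> bool" where
  "preserves_form_at f p \<longleftrightarrow> (\<exists>D. has_mderiv A A f p D \<and> (\<forall>u v. \<Omega> (f p) (D u) (D v) = \<Omega> p u v))"

lemma preserves_form_at_compose:
  assumes "preserves_form_at f p" "preserves_form_at g (f p)"
  shows "preserves_form_at (g \<circ> f) p"
proof -
  obtain D E where "has_mderiv A A f p D" "\<And>u v. \<Omega> (f p) (D u) (D v) = \<Omega> p u v"
    and "has_mderiv A A g (f p) E" "\<And>u v. \<Omega> (g (f p)) (E u) (E v) = \<Omega> (f p) u v"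
    using assms unfolding preserves_form_at_def by metis
  then show ?thesis
    unfolding preserves_form_at_def using has_mderiv_compose[OF manifold manifold]
    by (intro exI[of _ "E \<circ> D"]) auto
qed

end

section \<open>Group law, conservation laws and differentiability of the flow\<close>

locale holomorphic_Hamiltonian_flow = holomorphic_Hamiltonian_system A \<Omega> H
  for A :: "('x::{t2_space,second_countable_topology}, complex^'d) chart set"
    and \<Omega> :: "('x, complex^'d, complex) two_form" and H :: "'x \<Rightarrow> complex" +
  fixes T :: "real set" and \<Phi> :: "real \<Rightarrow> 'x \<Rightarrow> 'x"
  assumes T: "open T" "is_interval T" "0 \<in> T" and flow: "is_flow_on A V T \<Phi>"
begin

lemma flow_0: "\<Phi> 0 p = p"
  and flow_velocity: "t \<in> T \<Longrightarrow> has_velocity A (\<lambda>s. \<Phi> s p) t (V (\<Phi> t p))"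
  using flow by (auto simp: is_flow_on_def)

text \<open>As functions of a, both sides are integral curves that start at
  \<open>\<Phi> b p\<close>. Uniqueness is applied on the set of s for which s and s + b both lie in
  T, an interval as the intersection of two translates of one.\<close>

lemma flow_add:
  assumes a: "a \<in> T" and b: "b \<in> T" and ab: "a + b \<in> T"
  shows "\<Phi> (a + b) p = \<Phi> a (\<Phi> b p)"
proof -
  define I where "I = T \<inter> (\<lambda>s. s + b) -` T"
  have "open I"
    unfolding I_def using T by (intro open_Int open_vimage continuous_intros) auto
  moreover have "is_interval I"
    unfolding I_def is_interval_1
    using T(2)[unfolded is_interval_1] by (auto; smt (verit))
  then have "connected I" by (rule is_interval_connected)
  moreover have "0 \<in> I" "a \<in> I" using T a b ab by (auto simp: I_def)
  moreover have "has_velocity A (\<lambda>s. \<Phi> (s + b) p) s (V (\<Phi> (s + b) p))" if "s \<in> I" for s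
  proof -
    have v: "has_velocity A (\<lambda>s. \<Phi> s p) (s + b) (V (\<Phi> (s + b) p))"
      using flow_velocity that by (auto simp: I_def)
    have shift: "((\<lambda>s. s + b) has_derivative (\<lambda>h. h)) (at s)"
      by (auto intro!: derivative_eq_intros)
    have "((coord_at A (\<Phi> (s + b) p) \<circ> (\<lambda>s. \<Phi> (s + b) p)) has_vector_derivative V (\<Phi> (s + b) p)) (at s)"
      using v diff_chain_at[OF shift, of "coord_at A (\<Phi> (s + b) p) \<circ> (\<lambda>s. \<Phi> s p)"]
      by (simp add: has_velocity_def has_vector_derivative_def o_def)
    moreover have "isCont (\<lambda>s. \<Phi> (s + b) p) s"
      using v continuous_at_compose[of s "\<lambda>s. s + b" "\<lambda>s. \<Phi> s p"]
      by (simp add: has_velocity_def o_def)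
    ultimately show ?thesis by (simp add: has_velocity_def)
  qed
  moreover have "has_velocity A (\<lambda>s. \<Phi> s (\<Phi> b p)) s (V (\<Phi> s (\<Phi> b p)))" if "s \<in> I" for s
    using flow_velocity that by (auto simp: I_def)
  ultimately show ?thesis
    using integral_curve_unique[of I 0 a "\<lambda>s. \<Phi> (s + b) p" "\<lambda>s. \<Phi> s (\<Phi> b p)"]
    by (simp add: flow_0)
qed

lemma Hamiltonian_conserved:
  assumes t: "t \<in> T" shows "H (\<Phi> t p) = H p"
proof -
  have der: "((\<lambda>s. H (\<Phi> s p)) has_derivative (\<lambda>h. 0)) (at s)" if "s \<in> T" for s
  proof -
    have "((H \<circ> (\<lambda>s. \<Phi> s p)) has_vector_derivative fun_deriv A H (\<Phi> s p) (V (\<Phi> s p))) (at s)"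
      by (rule has_fun_deriv_along_curve[OF manifold flow_velocity[OF that]
            chartwise_fun_hol_has_fun_deriv(1)[OF manifold hol]])
    then show ?thesis
      by (simp add: form_V[symmetric] form_alternating has_vector_derivative_def o_def)
  qed
  have "H (\<Phi> t p) = H (\<Phi> 0 p)"
    by (rule has_derivative_zero_unique_connected[OF T(1) is_interval_connected[OF T(2)] _ t T(3)])
       (use der T(1) in \<open>auto\<close>)
  then show ?thesis by (simp add: flow_0)
qed

text \<open>Before leaving the chart, the curve stays in a smaller closed ball whose preimage is compact,
  hence closed in the manifold.\<close>

lemma flow_stays_in_chart:
  assumes c: "c \<in> A" and r: "ball z0 r \<subseteq> snd c ` fst c"
    and B: "\<And>z. z \<in> ball z0 r \<Longrightarrow> norm (V_rep c z) \<le> B" "B \<ge> 0"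
    and y: "y \<in> fst c" "snd c y \<in> ball z0 (r / 2)" and \<delta>: "\<delta> \<in> T" "B * \<bar>\<delta>\<bar> \<le> r / 4"
    and s: "s \<in> closed_segment 0 \<delta>"
  shows "\<Phi> s y \<in> fst c \<and> snd c (\<Phi> s y) \<in> ball z0 r"
proof (rule ccontr)
  note ic = complex_manifold_is_chart[OF manifold c]
  define N where "N = {p \<in> fst c. snd c p \<in> ball z0 r}"
  assume "\<not> ?thesis"
  then have sN: "\<Phi> s y \<notin> N" by (simp add: N_def)
  have r0: "r > 0" using y(2) zero_le_dist[of z0 "snd c y"] unfolding mem_ball by linarith
  have "continuous_on (fst c) (snd c)"
    using is_chartD(6)[OF ic] by (auto intro: continuous_at_imp_continuous_on)
  then have "open (fst c \<inter> snd c -` ball z0 r)"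
    using is_chartD(1)[OF ic] by (intro continuous_open_preimage) auto
  moreover have "fst c \<inter> snd c -` ball z0 r = N" by (auto simp: N_def)
  ultimately have N: "open N" by simp
  let ?I = "closed_segment 0 \<delta>"
  have IT: "?I \<subseteq> T"
    using T \<delta> by (intro closed_segment_subset is_interval_convex) auto
  have cont: "isCont (\<lambda>s. \<Phi> s y) s" if "s \<in> ?I" for s
    using flow_velocity[of s y] IT that by (auto simp: has_velocity_def)
  define Bad where "Bad = ?I \<inter> (\<lambda>s. \<Phi> s y) -` (- N)"
  have "closed Bad"
    unfolding Bad_def using N cont
    by (intro continuous_closed_preimage continuous_at_imp_continuous_on) auto
  moreover have "Bad \<subseteq> ?I" by (auto simp: Bad_def)
  ultimately have "compact Bad"
    using closed_Int_compact[OF _ compact_segment] by (metis inf.absorb_iff1)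
  moreover have "s \<in> Bad" using s sN by (simp add: Bad_def)
  \<comment> \<open>The earliest time of failure; minimising the absolute value treats both signs of
    \<delta> at once.\<close>
  ultimately obtain t where t: "t \<in> Bad" and min: "\<And>s. s \<in> Bad \<Longrightarrow> \<bar>t\<bar> \<le> \<bar>s\<bar>"
    using continuous_attains_inf[of Bad abs] continuous_on_rabs[OF continuous_on_id, of Bad] by auto
  have tI: "t \<in> ?I" and tN: "\<Phi> t y \<notin> N" using t by (auto simp: Bad_def)
  have "t \<noteq> 0" using tN y r0 by (auto simp: flow_0 N_def)
  have subI: "closed_segment 0 u \<subseteq> ?I" if "u \<in> ?I" for u
    using that by (simp add: subset_closed_segment)
  \<comment> \<open>Starting within r/2 of the centre and travelling at most r/4 leaves the curve
    within 3r/4 of it.\<close>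
  define K where "K = chart_inv c ` cball z0 (3 * r / 4)"
  have K_sub: "cball z0 (3 * r / 4) \<subseteq> ball z0 r" using r0 by auto
  have "continuous_on (cball z0 (3 * r / 4)) (chart_inv c)"
    using is_chartD(7)[OF ic] K_sub r by (intro continuous_at_imp_continuous_on) blast
  then have "compact K"
    unfolding K_def by (rule compact_continuous_image) simp
  then have "closed K" by (rule compact_imp_closed)
  have in_K: "\<Phi> u y \<in> K" if u: "u \<in> closed_segment 0 t" "u \<noteq> t" for u
  proof -
    have "\<bar>v\<bar> < \<bar>t\<bar>" if "v \<in> closed_segment 0 u" for v
      using that u by (auto simp: closed_segment_eq_real_ivl split: if_splits)
    moreover have uI: "u \<in> ?I" using subI[OF tI] u(1) by blast
    ultimately have vN: "\<Phi> v y \<in> N" if "v \<in> closed_segment 0 u" for v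
      using that min subI[OF uI] by (force simp: Bad_def)
    have "norm (snd c (\<Phi> 0 y) - snd c (\<Phi> u y)) \<le> B * norm (0 - u)"
    proof (rule differentiable_bound[OF convex_closed_segment, where f = "\<lambda>s. snd c (\<Phi> s y)"])
      fix v assume v: "v \<in> closed_segment 0 u"
      then have "v \<in> T" using subI[OF uI] IT by blast
      then have "((\<lambda>s. snd c (\<Phi> s y)) has_vector_derivative V_rep c (snd c (\<Phi> v y))) (at v)"
        using vN[OF v] by (intro integral_curve_in_chart[OF c] flow_velocity) (auto simp: N_def)
      then show "((\<lambda>s. snd c (\<Phi> s y)) has_derivative (\<lambda>h. h *\<^sub>R V_rep c (snd c (\<Phi> v y)))) (at v within closed_segment 0 u)"
        by (auto simp: has_vector_derivative_def intro: has_derivative_at_withinI)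
      show "onorm (\<lambda>h. h *\<^sub>R V_rep c (snd c (\<Phi> v y))) \<le> B"
      proof (rule onorm_bound[OF B(2)])
        have "norm (V_rep c (snd c (\<Phi> v y))) \<le> B"
          using B(1) vN[OF v] by (simp add: N_def)
        from mult_right_mono[OF this abs_ge_zero]
        show "norm (h *\<^sub>R V_rep c (snd c (\<Phi> v y))) \<le> B * norm h" for h
          by (simp add: mult.commute)
      qed
    qed auto
    also have "\<dots> \<le> r / 4"
    proof -
      have "\<bar>u\<bar> \<le> \<bar>\<delta>\<bar>" using uI by (auto simp: closed_segment_eq_real_ivl split: if_splits)
      then show ?thesis using \<delta>(2) B(2) mult_left_mono[of "\<bar>u\<bar>" "\<bar>\<delta>\<bar>" B] by simp
    qed
    finally have "dist (snd c y) (snd c (\<Phi> u y)) \<le> r / 4"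
      by (simp add: flow_0 dist_norm)
    then have "dist z0 (snd c (\<Phi> u y)) \<le> 3 * r / 4"
      using y(2) dist_triangle[of z0 "snd c (\<Phi> u y)" "snd c y"] by simp
    moreover have "\<Phi> u y \<in> fst c" using vN[of u] by (simp add: N_def)
    ultimately show ?thesis
      unfolding K_def using is_chartD(3)[OF ic] by (metis image_eqI mem_cball)
  qed
  \<comment> \<open>Times that tend to t and precede it. The orbit at these times lies in the closed
    set K, hence so does its limit at t, which is therefore no failure.\<close>
  define \<sigma> where "\<sigma> n = (1 - inverse (real (Suc n))) * t" for n
  have lim: "\<sigma> \<longlonglongrightarrow> t"
    unfolding \<sigma>_def using tendsto_mult[OF tendsto_diff[OF tendsto_const LIMSEQ_inverse_real_of_nat] tendsto_const, of 1 t]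
    by simp
  have "\<sigma> n \<in> closed_segment 0 t" for n
    unfolding closed_segment_def \<sigma>_def
    by (auto intro!: exI[of _ "1 - inverse (real (Suc n))"] simp: inverse_le_1_iff)
  moreover have "\<sigma> n \<noteq> t" for n
    using \<open>t \<noteq> 0\<close> by (simp add: \<sigma>_def)
  ultimately have "\<Phi> (\<sigma> n) y \<in> K" for n using in_K by blast
  moreover have "(\<lambda>n. \<Phi> (\<sigma> n) y) \<longlonglongrightarrow> \<Phi> t y"
    by (rule isCont_tendsto_compose[OF cont[OF tI] lim])
  ultimately have "\<Phi> t y \<in> K"
    using \<open>closed K\<close> by (intro Lim_in_closed_set[of K _ sequentially]) auto
  then obtain z where z: "z \<in> cball z0 (3 * r / 4)" "\<Phi> t y = chart_inv c z"
    by (auto simp: K_def)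
  then have "z \<in> ball z0 r" using K_sub by blast
  then have "\<Phi> t y \<in> N"
    using z(2) in_chart[OF c, of z] r by (auto simp: N_def)
  then show False using tN by simp
qed

text \<open>For a short time, uniform near q, orbits remain in one chart, where the coordinate
  results on local flows apply. Their conclusions are conjugated back by transition maps.\<close>

lemma flow_locally_preserves_form:
  "\<exists>N e. open N \<and> q \<in> N \<and> e > 0 \<and> (\<forall>y\<in>N. \<forall>\<delta>\<in>T. \<bar>\<delta>\<bar> < e \<longrightarrow> preserves_form_at (\<Phi> \<delta>) y)"
proof -
  define c where "c = chart_at A q"
  have c: "c \<in> A" "q \<in> fst c" using chart_at[OF manifold] by (auto simp: c_def)
  note ic = complex_manifold_is_chart[OF manifold c(1)]
  define z0 where "z0 = snd c q"
  have z0: "z0 \<in> snd c ` fst c" using c by (simp add: z0_def)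
  obtain r L C V' where r: "r > 0" "ball z0 r \<subseteq> snd c ` fst c" and L: "L \<ge> 0" and C: "C \<ge> 0"
    and V': "\<And>z. z \<in> ball z0 r \<Longrightarrow> (V_rep c has_derivative V' z) (at z)"
      "\<And>z u. z \<in> ball z0 r \<Longrightarrow> norm (V' z u) \<le> L * norm u"
    and quad: "\<And>z w. z \<in> ball z0 r \<Longrightarrow> w \<in> ball z0 r \<Longrightarrow>
      norm (V_rep c w - V_rep c z - V' z (w - z)) \<le> C * (norm (w - z))\<^sup>2"
    and lip: "\<And>z w. z \<in> ball z0 r \<Longrightarrow> w \<in> ball z0 r \<Longrightarrow> norm (V_rep c w - V_rep c z) \<le> L * norm (w - z)"
    using hol_fun_components_local_estimates[OF V_rep_hol[OF c(1)] open_chart_image[OF c(1)] z0] by blast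
  \<comment> \<open>A speed bound on the ball, from the speed at its centre and the Lipschitz
    constant.\<close>
  define B where "B = norm (V_rep c z0) + L * r"
  have B0: "B \<ge> 0" using L r by (simp add: B_def)
  have B: "norm (V_rep c z) \<le> B" if z: "z \<in> ball z0 r" for z
  proof -
    have "norm (V_rep c z) \<le> norm (V_rep c z0) + norm (V_rep c z - V_rep c z0)"
      using norm_triangle_ineq[of "V_rep c z0" "V_rep c z - V_rep c z0"] by simp
    also have "\<dots> \<le> norm (V_rep c z0) + L * norm (z - z0)"
      using lip[of z0 z] z r by simp
    also have "\<dots> \<le> B"
      unfolding B_def using z L by (intro add_left_mono mult_left_mono) (auto simp: dist_norm norm_minus_commute)
    finally show ?thesis .
  qed
  \<comment> \<open>Within this time an orbit travels at most r/4, as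
    \<open>flow_stays_in_chart\<close> requires.\<close>
  define e where "e = r / 4 / (B + 1)"
  have e: "e > 0" using r B0 by (simp add: e_def)
  define N where "N = fst c \<inter> snd c -` ball z0 (r / 2)"
  have "continuous_on (fst c) (snd c)"
    using is_chartD(6)[OF ic] by (auto intro: continuous_at_imp_continuous_on)
  then have N: "open N"
    unfolding N_def using is_chartD(1)[OF ic] by (intro continuous_open_preimage) auto
  have qN: "q \<in> N" using c r by (simp add: N_def z0_def)
  have "preserves_form_at (\<Phi> \<delta>) y" if y: "y \<in> N" and \<delta>: "\<delta> \<in> T" "\<bar>\<delta>\<bar> < e" for y \<delta>
  proof -
    let ?U = "ball z0 (r / 2)"
    define z where "z w s = snd c (\<Phi> s (chart_inv c w))" for w s
    have U_sub: "?U \<subseteq> snd c ` fst c" using r by (auto intro!: subsetD[OF r(2)])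
    have B\<delta>: "B * \<bar>\<delta>\<bar> \<le> r / 4"
    proof -
      have "B * \<bar>\<delta>\<bar> \<le> (B + 1) * e"
        using \<delta>(2) B0 e by (intro mult_mono) auto
      also have "\<dots> = r / 4"
        using nonzero_eq_divide_eq[of "B + 1" e "r / 4"] B0 e_def by (simp add: mult.commute)
      finally show ?thesis .
    qed
    have stay: "\<Phi> s (chart_inv c w) \<in> fst c \<and> z w s \<in> ball z0 r" if "w \<in> ?U" "s \<in> closed_segment 0 \<delta>" for w s
      unfolding z_def using in_chart[OF c(1), of w] U_sub that B B0 B\<delta> \<delta>(1) r(2)
      by (intro flow_stays_in_chart[OF c(1)]) auto
    have segT: "closed_segment 0 \<delta> \<subseteq> T"
      using T \<delta> by (intro closed_segment_subset is_interval_convex) auto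
    have z1: "(z w has_vector_derivative V_rep c (z w s)) (at s)" if "w \<in> ?U" "s \<in> closed_segment 0 \<delta>" for w s
      unfolding z_def using stay[OF that] segT that
      by (intro integral_curve_in_chart[OF c(1)] flow_velocity) auto
    have z2: "z w s \<in> ball z0 r" if "w \<in> ?U" "s \<in> closed_segment 0 \<delta>" for w s
      using stay[OF that] by blast
    have z3: "z w 0 = w" if "w \<in> ?U" for w
      using in_chart(2)[OF c(1)] U_sub that by (auto simp: z_def flow_0)
    have lin: "linear (V' z)" if "z \<in> ball z0 r" for z
      using V'(1)[OF that] has_derivative_linear by blast
    define x where "x = snd c y"
    have x: "x \<in> ?U" and yc: "y \<in> fst c" and xy: "chart_inv c x = y"
      using y is_chartD(3)[OF ic] by (auto simp: x_def N_def)
    have "(\<lambda>w. z w \<delta>) differentiable (at x)"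
      by (rule local_flow_approximation(2)[OF L C lip lin V'(2) quad z1 z2 z3 open_ball x])
    then obtain D where D: "((\<lambda>w. z w \<delta>) has_derivative D) (at x)"
      unfolding differentiable_def by blast
    have W: "form_rep A \<Omega> c (z x \<delta>) (D u) (D v) = form_rep A \<Omega> c x u v" for u v
    proof (rule local_flow_preserves_form[OF L C lip lin V'(2) quad z1 z2 z3 open_ball x open_ball _ _ _ D,
          where W' = "\<lambda>z w u v. frechet_derivative (\<lambda>z. form_rep A \<Omega> c z u v) (at z) w"])
      fix z assume "z \<in> ball z0 r"
      then have z: "z \<in> snd c ` fst c" using r by blast
      show "bilinear (form_rep A \<Omega> c z)" by (rule form_rep_bilinear[OF c(1) z])
      show "((\<lambda>z. form_rep A \<Omega> c z u v) has_derivative frechet_derivative (\<lambda>z. form_rep A \<Omega> c z u v) (at z)) (at z)" for u v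
        by (rule hol_fun_onD(1)[OF form_rep_hol[OF c(1)] z])
      show "frechet_derivative (\<lambda>z. form_rep A \<Omega> c z u v) (at z) (V_rep c z) +
          form_rep A \<Omega> c z (V' z u) v + form_rep A \<Omega> c z u (V' z v) = 0" for u v
        by (rule Lie_derivative_form_rep[OF c(1) z V'(1)[OF \<open>z \<in> ball z0 r\<close>]])
    qed
    let ?y' = "\<Phi> \<delta> y"
    let ?a = "chart_at A y" and ?b = "chart_at A ?y'"
    have y'c: "?y' \<in> fst c" and zx: "z x \<delta> = snd c ?y'"
      using stay[OF x, of \<delta>] xy by (auto simp: z_def)
    have rep: "(snd c \<circ> \<Phi> \<delta> \<circ> chart_inv c) = (\<lambda>w. z w \<delta>)"
      by (simp add: z_def fun_eq_iff)
    \<comment> \<open>\<open>is_flow_on\<close> supplies continuity in time only. Continuity in the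
      initial value is read off from the differentiable coordinate expression, which represents the
      flow on all of N.\<close>
    have cont: "isCont (\<Phi> \<delta>) y"
    proof -
      have 1: "isCont (snd c) y" by (rule is_chartD(6)[OF ic yc])
      have 2: "isCont (\<lambda>w. z w \<delta>) (snd c y)"
        using has_derivative_continuous[OF D] by (simp add: x_def)
      have 3: "isCont (chart_inv c) (z (snd c y) \<delta>)"
        using is_chartD(7)[OF ic, of "snd c ?y'"] y'c zx by (simp add: x_def)
      have comp: "isCont (\<lambda>q. chart_inv c (z (snd c q) \<delta>)) y"
        using continuous_at_compose[OF continuous_at_compose[OF 1 2], of "chart_inv c"] 3
        by (simp add: o_def)
      have "\<forall>\<^sub>F q in nhds y. q \<in> N"
        by (rule eventually_nhds_in_open[OF N y])
      then have "\<forall>\<^sub>F q in nhds y. chart_inv c (z (snd c q) \<delta>) = \<Phi> \<delta> q"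
      proof eventually_elim
        case (elim q)
        then have "snd c q \<in> ?U" "chart_inv c (snd c q) = q"
          using is_chartD(3)[OF ic] by (auto simp: N_def)
        then show ?case
          using stay[of "snd c q" \<delta>] is_chartD(3)[OF ic] by (auto simp: z_def)
      qed
      then show ?thesis
        using comp isCont_cong by fast
    qed
    define D' where "D' = transition c ?b ?y' \<circ> D \<circ> transition ?a c y"
    have m: "has_mderiv A A (\<Phi> \<delta>) y D'"
      unfolding D'_def
      by (rule has_mderiv_of_charts[OF manifold manifold c(1) yc c(1) y'c cont])
         (use D in \<open>simp add: rep x_def\<close>)
    have "\<Omega> ?y' (D' u) (D' v) = \<Omega> y u v" for u v
    proof -
      have "\<Omega> ?y' (D' u) (D' v) = form_rep A \<Omega> c (snd c ?y') (D (transition ?a c y u)) (D (transition ?a c y v))"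
        using form_rep_eq[OF c(1), of "snd c ?y'"] y'c is_chartD(3)[OF ic y'c] by (simp add: D'_def)
      also have "\<dots> = form_rep A \<Omega> c x (transition ?a c y u) (transition ?a c y v)"
        using W by (simp add: zx)
      also have "\<dots> = \<Omega> y u v"
        using form_rep_eq[OF c(1), of x] xy yc transition_to_chart_at_inverse(1,2)[OF c(1) yc] by (simp add: x_def)
      finally show ?thesis .
    qed
    with m show ?thesis unfolding preserves_form_at_def by blast
  qed
  then show ?thesis using N qN e by blast
qed

text \<open>Induction over the connected set of times: near \<Phi>(s, p) all short flow maps
  preserve the form, and the group law writes the map at a time r' near s as the one at r followed
  by such a short map.\<close>

lemma flow_preserves_form:
  assumes t: "t \<in> T" shows "preserves_form_at (\<Phi> t) p"
proof (rule connected_induction_simple[where P = "\<lambda>t. preserves_form_at (\<Phi> t) p", OF is_interval_connected[OF T(2)] T(3) t])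
  have "\<Phi> 0 = id" by (simp add: flow_0 fun_eq_iff)
  have "has_mderiv A A id p id"
  proof -
    note a = chart_at[OF manifold, of p]
    note ia = complex_manifold_is_chart[OF manifold a(1)]
    have "\<forall>\<^sub>F z in nhds (snd (chart_at A p) p). z \<in> snd (chart_at A p) ` fst (chart_at A p)"
      using is_chartD(2)[OF ia] a(2) by (intro eventually_nhds_in_open) auto
    then have "\<forall>\<^sub>F z in nhds (snd (chart_at A p) p). id z = (snd (chart_at A p) \<circ> id \<circ> chart_inv (chart_at A p)) z"
      by eventually_elim (simp add: is_chartD(5)[OF ia])
    from has_derivative_cong_eventually[OF has_derivative_id this]
    show ?thesis by (simp add: has_mderiv_def coord_at_def id_def o_def)
  qed
  then show "preserves_form_at (\<Phi> 0) p"
    unfolding \<open>\<Phi> 0 = id\<close> preserves_form_at_def by (intro exI[of _ id]) auto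
  fix s assume s: "s \<in> T"
  obtain N e where N: "open N" "\<Phi> s p \<in> N" "e > 0"
    and pres: "\<And>y \<delta>. y \<in> N \<Longrightarrow> \<delta> \<in> T \<Longrightarrow> \<bar>\<delta>\<bar> < e \<Longrightarrow> preserves_form_at (\<Phi> \<delta>) y"
    using flow_locally_preserves_form[of "\<Phi> s p"] by blast
  have "isCont (\<lambda>s. \<Phi> s p) s"
    using flow_velocity[OF s] by (simp add: has_velocity_def)
  from eventually_compose_isCont[OF this eventually_nhds_in_open[OF N(1,2)]]
  have "\<forall>\<^sub>F r in nhds s. \<Phi> r p \<in> N \<and> r \<in> T"
    using eventually_nhds_in_open[OF T(1) s] by (rule eventually_conj)
  then obtain d1 where d1: "d1 > 0" "\<And>r. dist r s < d1 \<Longrightarrow> \<Phi> r p \<in> N \<and> r \<in> T"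
    unfolding eventually_nhds_metric by blast
  obtain d2 where d2: "d2 > 0" "ball 0 d2 \<subseteq> T"
    using T open_contains_ball by blast
  \<comment> \<open>Times in \<open>ball s d\<close> differ by less than 2d; the halves put their
    difference both into T and below e.\<close>
  define d where "d = min d1 (min (d2 / 2) (e / 2))"
  have d: "d > 0" using d1 d2 N by (simp add: d_def)
  have "preserves_form_at (\<Phi> r') p" if r: "r \<in> ball s d" and r': "r' \<in> ball s d" and P: "preserves_form_at (\<Phi> r) p" for r r'
  proof -
    have rr: "\<bar>r' - r\<bar> < 2 * d" using r r' by (simp add: dist_real_def)
    have rT: "r \<in> T" "r' \<in> T" "\<Phi> r p \<in> N"
      using d1(2)[of r] d1(2)[of r'] r r' by (auto simp: d_def dist_commute)
    have \<delta>: "r' - r \<in> T" using rr d2 by (auto simp: d_def subset_iff dist_real_def)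
    have "preserves_form_at (\<Phi> (r' - r)) (\<Phi> r p)"
      using rr by (intro pres rT \<delta>) (simp add: d_def)
    with P have "preserves_form_at (\<Phi> (r' - r) \<circ> \<Phi> r) p"
      by (rule preserves_form_at_compose)
    moreover have "\<Phi> (r' - r) \<circ> \<Phi> r = \<Phi> r'"
      using flow_add[OF \<delta> rT(1)] rT(2) by (simp add: fun_eq_iff)
    ultimately show ?thesis by simp
  qed
  moreover have "openin (top_of_set T) (ball s d)"
    using d1 by (intro open_subset) (auto simp: d_def dist_commute)
  moreover have "s \<in> ball s d" using d by simp
  ultimately show "\<exists>U. openin (top_of_set T) U \<and> s \<in> U \<and>
      (\<forall>x\<in>U. \<forall>y\<in>U. preserves_form_at (\<Phi> x) p \<longrightarrow> preserves_form_at (\<Phi> y) p)"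
    by (intro exI[of _ "ball s d"] conjI ballI impI)
qed

end

section \<open>The moving section\<close>

text \<open>Differentiability at a single point says nothing about the continuity of the inverse, which is
  supplied by invariance of domain.\<close>

lemma has_mderiv_inv:
  fixes A :: "('m::{t2_space,second_countable_topology}, complex^'n) chart set"
  assumes A: "complex_manifold A" and f: "bij f" "\<And>q. isCont f q"
    and F: "has_mderiv A A f p F" "inj F"
  obtains G where "has_mderiv A A (inv f) (f p) G" "\<And>u. F (G u) = u"
proof -
  let ?a = "chart_at A p" and ?b = "chart_at A (f p)"
  note a = chart_at[OF A, of p] and b = chart_at[OF A, of "f p"]
  note ia = complex_manifold_is_chart[OF A a(1)] and ib = complex_manifold_is_chart[OF A b(1)]
  have inv: "inv f (f q) = q" for q
    using f(1) by (simp add: bij_is_inj)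
  define rep where "rep = snd ?b \<circ> f \<circ> chart_inv ?a"
  \<comment> \<open>The coordinate domain over N on which f lands in the chart at
    \<open>f p\<close>, so that \<open>rep\<close> is a genuine coordinate expression there.\<close>
  define S where "S N = snd ?a ` fst ?a \<inter> chart_inv ?a -` (N \<inter> f -` fst ?b)" for N
  have S_open: "open (S N)" if "open N" for N
  proof -
    have "open (f -` fst ?b)"
      using is_chartD(1)[OF ib] f(2) by (intro open_vimage continuous_at_imp_continuous_on) auto
    then show ?thesis
      unfolding S_def using is_chartD(2,7)[OF ia] that
      by (intro continuous_open_preimage open_Int continuous_at_imp_continuous_on) auto
  qed
  have rep_cont: "continuous_on (S N) rep" for N
  proof (intro continuous_at_imp_continuous_on ballI)
    fix z assume "z \<in> S N"
    then have "z \<in> snd ?a ` fst ?a" "f (chart_inv ?a z) \<in> fst ?b" by (auto simp: S_def)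
    then show "isCont rep z"
      unfolding rep_def using is_chartD(7)[OF ia] is_chartD(6)[OF ib] f(2)
      by (intro continuous_at_compose) auto
  qed
  have rep_inv: "chart_inv ?b (rep z) = f (chart_inv ?a z)" if "z \<in> S N" for z N
    using that is_chartD(3)[OF ib] by (simp add: rep_def S_def)
  have rep_inj: "inj_on rep (S N)" for N
  proof (rule inj_onI)
    fix z w assume zw: "z \<in> S N" "w \<in> S N" "rep z = rep w"
    then have "f (chart_inv ?a z) = f (chart_inv ?a w)"
      using rep_inv by metis
    then have "chart_inv ?a z = chart_inv ?a w" using inv by metis
    then show "z = w" using zw(1,2) is_chartD(5)[OF ia] by (metis IntD1 S_def)
  qed
  have p_in: "snd ?a p \<in> S N" if "p \<in> N" for N
    using that a(2) b(2) is_chartD(3)[OF ia] by (simp add: S_def)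
  have rep_p: "rep (snd ?a p) = snd ?b (f p)"
    using is_chartD(3)[OF ia a(2)] by (simp add: rep_def)
  have cont: "isCont (inv f) (f p)"
    unfolding continuous_at_open
  proof (intro allI impI)
    fix N assume "open N \<and> inv f (f p) \<in> N"
    then have N: "open N" "p \<in> N" by (auto simp: inv)
    \<comment> \<open>A continuous injection between open sets of equal dimension is open; this
      yields the neighbourhoods that continuity of the inverse asks for.\<close>
    have "open (rep ` S N)"
      by (rule invariance_of_domain[OF rep_cont S_open[OF N(1)] rep_inj])
    moreover have "rep (snd ?a p) \<in> rep ` S N" using p_in[OF N(2)] by blast
    ultimately have "\<forall>\<^sub>F z in nhds (snd ?b (f p)). z \<in> rep ` S N"
      unfolding rep_p by (rule eventually_nhds_in_open)
    from eventually_compose_isCont[OF is_chartD(6)[OF ib b(2)] this] eventually_in_chart[OF ib b(2)]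
    have "\<forall>\<^sub>F q in nhds (f p). inv f q \<in> N"
    proof eventually_elim
      case (elim q)
      then obtain z where z: "z \<in> S N" "snd ?b q = rep z" by blast
      then have "q = f (chart_inv ?a z)"
        using rep_inv[OF z(1)] is_chartD(3)[OF ib elim(2)] by simp
      then show ?case using z(1) by (simp add: inv S_def)
    qed
    then show "\<exists>s. open s \<and> f p \<in> s \<and> (\<forall>x'\<in>s. inv f x' \<in> N)"
      unfolding eventually_nhds by blast
  qed
  have linF: "linear F" by (rule has_mderiv_linear[OF F(1)])
  then have "surj F" using F(2) by (rule linear_inj_imp_surj)
  then have FG: "F (inv F u) = u" for u by (simp add: surj_f_inv_f)
  define g where "g = snd ?a \<circ> inv f \<circ> chart_inv ?b"
  have "(g has_derivative inv F) (at (rep (snd ?a p)))"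
  proof (rule has_derivative_inverse_strong[OF S_open[OF open_UNIV] p_in[of UNIV] rep_cont])
    show "g (rep z) = z" if "z \<in> S UNIV" for z
      using rep_inv[OF that] that is_chartD(5)[OF ia] by (simp add: g_def inv S_def)
    show "(rep has_derivative F) (at (snd ?a p))"
      using F(1) by (simp add: has_mderiv_def rep_def coord_at_def)
    show "F \<circ> inv F = id" using FG by auto
  qed simp
  then have "has_mderiv A A (inv f) (f p) (inv F)"
    using cont by (simp add: has_mderiv_def coord_at_def inv g_def rep_p)
  then show thesis using FG that by blast
qed

text \<open>Since \<open>S\<close> is complex linear modulo \<open>ker P\<close>, and the form vanishes on \<open>ker P\<close>, the functional
  \<open>u \<mapsto> \<Omega> (v - S (P v)) (S u)\<close> is complex linear, and \<open>\<omega>\<close> is of type \<open>(1,1)\<close>.\<close>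

lemma section_projection_of_vector:
  fixes \<Omega> :: "complex^'d \<Rightarrow> complex^'d \<Rightarrow> complex" and \<omega> :: "complex^'n \<Rightarrow> complex^'n \<Rightarrow> real"
    and S :: "complex^'n \<Rightarrow> complex^'d" and P :: "complex^'d \<Rightarrow> complex^'n"
  assumes \<Omega>: "bilinear \<Omega>" "\<And>u v. \<Omega> (J_std u) v = \<i> * \<Omega> u v" "\<And>u v. \<Omega> u (J_std v) = \<i> * \<Omega> u v"
    and \<omega>: "bilinear \<omega>" "\<And>u. (\<And>v. \<omega> u v = 0) \<Longrightarrow> u = 0"
    and P: "linear P" "\<And>v. P (J_std v) = J_std (P v)" and S: "\<And>u. P (S u) = u"
    and isotropic: "\<And>a b. P a = 0 \<Longrightarrow> P b = 0 \<Longrightarrow> \<Omega> a b = 0"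
    and pullback: "\<And>u v. \<Omega> (S u) (S v) = complex_of_real (\<omega> u v)"
    and X: "\<And>u. \<omega> X u = Re (\<Omega> v (S u))" and Y: "\<And>u. \<omega> Y u = Im (\<Omega> v (S u))"
  shows "P v = X + J_std Y"
proof -
  have l1: "linear (\<lambda>u. \<Omega> u v)" and l2: "linear (\<Omega> u)" for u v
    using \<Omega>(1) by (auto simp: bilinear_def)
  have m1: "linear (\<lambda>u. \<omega> u v)" and m2: "linear (\<omega> u)" for u v
    using \<omega>(1) by (auto simp: bilinear_def)
  have JJ: "J_std (J_std u) = - u" for u :: "complex^'n"
    by (simp add: J_std_def vec_eq_iff mult.assoc[symmetric])
  \<comment> \<open>The failure of S to be complex linear. As P is complex linear and inverts S from
    the left, it takes values in the kernel of P.\<close>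
  define k where "k u = S (J_std u) - J_std (S u)" for u
  have Pk: "P (k u) = 0" for u
    by (simp add: k_def linear_diff[OF P(1)] P(2) S)
  have SJ: "S (J_std u) = J_std (S u) + k u" for u by (simp add: k_def)
  have 1: "\<Omega> (S a) (k b) = \<omega> a (J_std b) - \<i> * \<omega> a b" for a b
    using pullback[of a "J_std b"] by (simp add: SJ linear_add[OF l2] \<Omega>(3) pullback algebra_simps)
  have 2: "\<Omega> (k a) (S b) = \<omega> (J_std a) b - \<i> * \<omega> a b" for a b
    using pullback[of "J_std a" b] by (simp add: SJ linear_add[OF l1] \<Omega>(2) pullback algebra_simps)
  \<comment> \<open>In the expansion of \<Omega> on \<open>S (J_std a)\<close> and
    \<open>S (J_std b)\<close> the term with two kernel vectors vanishes. The left side is real, so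
    comparing real parts gives the claim.\<close>
  have type11: "\<omega> (J_std a) (J_std b) = \<omega> a b" for a b
  proof -
    have "complex_of_real (\<omega> (J_std a) (J_std b)) = \<Omega> (J_std (S a) + k a) (J_std (S b) + k b)"
      by (simp add: pullback[symmetric] SJ)
    also have "\<dots> = - \<Omega> (S a) (S b) + \<i> * \<Omega> (S a) (k b) + \<i> * \<Omega> (k a) (S b)"
      by (simp add: linear_add[OF l1] linear_add[OF l2] \<Omega>(2,3) isotropic Pk algebra_simps)
    also have "\<dots> = complex_of_real (\<omega> a b) + \<i> * complex_of_real (\<omega> a (J_std b) + \<omega> (J_std a) b)"
      by (simp add: 1 2 pullback algebra_simps)
    finally show ?thesis by (simp add: complex_eq_iff)
  qed
  \<comment> \<open>The part of v tangent to the fibre; P v is the part along the section.\<close>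
  define l where "l = v - S (P v)"
  have Pl: "P l = 0" by (simp add: l_def linear_diff[OF P(1)] S)
  have v: "\<Omega> v (S u) = \<omega> (P v) u + \<Omega> l (S u)" for u
    using linear_add[OF l1, of "S (P v)" l "S u"] by (simp add: l_def pullback)
  have lJ: "\<Omega> l (S (J_std u)) = \<i> * \<Omega> l (S u)" for u
    by (simp add: SJ linear_add[OF l2] \<Omega>(3) isotropic Pl Pk)
  \<comment> \<open>The real part of the identity \<open>v\<close> at u and its imaginary part at
    \<open>J_std u\<close> contain the same quantity \<open>Re (\<Omega> l (S u))\<close>, which is
    thereby eliminated.\<close>
  have "\<omega> (P v - (X + J_std Y)) u = 0" for u
  proof -
    have "\<omega> X u = \<omega> (P v) u + Re (\<Omega> l (S u))"
      using v[of u] by (simp add: X)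
    moreover have "\<omega> Y (J_std u) = Re (\<Omega> l (S u))"
      using v[of "J_std u"] by (simp add: Y lJ)
    moreover have "\<omega> (J_std Y) u = - \<omega> Y (J_std u)"
      using type11[of Y "J_std u"] by (simp add: JJ linear_neg[OF m2])
    ultimately show ?thesis
      by (simp add: linear_diff[OF m1] linear_add[OF m1])
  qed
  then have "P v - (X + J_std Y) = 0" by (rule \<omega>(2))
  then show ?thesis by simp
qed

text \<open>The tangent space T read off from a slice chart is Lagrangian, and \<pi> is constant
  along the slice, so T lies in the kernel of the differential. The dimension count for real forms,
  applied to the real part of \<Omega>, extends isotropy to the whole kernel.\<close>

lemma kernel_isotropic_of_Lagrangian_fibre:
  fixes AM :: "('m::{t2_space,second_countable_topology}, complex^'n) chart set"
    and AX :: "('x::{t2_space,second_countable_topology}, complex^'d) chart set"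
  assumes AM: "complex_manifold AM" and AX: "complex_manifold AX" and dims: "CARD('d) = 2 * CARD('n)"
    and \<Omega>: "holomorphic_symplectic_form AX \<Omega>"
    and \<pi>: "chartwise_map hol_map_on AX AM \<pi>" "submersive AX AM \<pi>"
    and Lagr: "holomorphic_lagrangian_submanifold AX \<Omega> (\<pi> -` {\<pi> y})"
    and ab: "mderiv AX AM \<pi> y a = 0" "mderiv AX AM \<pi> y b = 0"
  shows "\<Omega> y a b = 0"
proof -
  \<comment> \<open>The zero Hamiltonian serves only to make the algebraic facts about \<Omega>
    available.\<close>
  interpret holomorphic_Hamiltonian_system AX \<Omega> "\<lambda>_. 0"
    using AX \<Omega> hol_fun_on_const by unfold_locales (auto simp: chartwise_fun_def o_def)
  let ?S = "\<pi> -` {\<pi> y}"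
  let ?P = "mderiv AX AM \<pi> y"
  let ?e = "chart_at AX y"
  note e = chart_at[OF AX, of y]
  have P: "has_mderiv AX AM \<pi> y ?P" and PJ: "\<And>u. ?P (J_std u) = J_std (?P u)"
    using hol_map_mderiv_J[OF AX AM \<pi>(1)] by auto
  have linP: "linear ?P" by (rule has_mderiv_linear[OF P])
  have "\<exists>c W. holomorphic_chart AX c \<and> y \<in> fst c \<and> vec.subspace W \<and>
      snd c ` (?S \<inter> fst c) = {z \<in> snd c ` fst c. z - snd c y \<in> W} \<and>
      {u. transition ?e c y u \<in> W} = {u. \<forall>v\<in>{u. transition ?e c y u \<in> W}. \<Omega> y u v = 0}"
    using bspec[OF Lagr[unfolded holomorphic_lagrangian_submanifold_def], of y]
    by (simp only: transition_def coord_at_def Let_def vimage_singleton_eq simp_thms)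
  then obtain c W where c: "holomorphic_chart AX c" "y \<in> fst c" and W: "vec.subspace W"
    and slice: "snd c ` (?S \<inter> fst c) = {z \<in> snd c ` fst c. z - snd c y \<in> W}"
    and T: "{u. transition ?e c y u \<in> W} = {u. \<forall>v\<in>{u. transition ?e c y u \<in> W}. \<Omega> y u v = 0}"
    by (elim exE conjE)
  define T where "T = {u. transition ?e c y u \<in> W}"
  have T: "T = {u. \<forall>v\<in>T. \<Omega> y u v = 0}" using T unfolding T_def .
  note ic = holomorphic_chart_is_chart[OF c(1)]
  note tr = transition[OF c(1) e(1) c(2) e(2)] and tr_inv = transition_inverse[OF AX c(1) e(1) c(2) e(2)]
  have TP: "?P u = 0" if "u \<in> T" for u
  proof -
    define w where "w = transition ?e c y u"
    have w: "w \<in> W" using that by (simp add: w_def T_def)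
    define Q where "Q = coord_at AM (\<pi> y) \<circ> \<pi>"
    have "((Q \<circ> id \<circ> chart_inv c) has_derivative ?P \<circ> transition c ?e y) (at (snd c y))"
    proof (rule chart_rep_chain[where f = id and d = ?e])
      show "((snd ?e \<circ> id \<circ> chart_inv c) has_derivative transition c ?e y) (at (snd c y))"
        using tr(1) by simp
      show "((Q \<circ> chart_inv ?e) has_derivative ?P) (at (snd ?e (id y)))"
        using P by (simp add: has_mderiv_def Q_def coord_at_def)
    qed (use c ic e complex_manifold_is_chart[OF AX] in auto)
    then have Q: "((Q \<circ> chart_inv c) has_derivative ?P \<circ> transition c ?e y) (at (snd c y + 0 *\<^sub>R w))"
      by simp
    \<comment> \<open>A tangent vector of the fibre is, in slice coordinates, the direction of a
      line that stays in the fibre for small r; differentiating \<pi> along it gives 0.\<close>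
    have line: "((\<lambda>r. snd c y + r *\<^sub>R w) has_derivative (\<lambda>r. r *\<^sub>R w)) (at 0)"
      by (auto intro!: derivative_eq_intros)
    from diff_chain_at[OF line Q]
    have d1: "((\<lambda>r. Q (chart_inv c (snd c y + r *\<^sub>R w))) has_derivative
        (\<lambda>r. ?P (transition c ?e y (r *\<^sub>R w)))) (at 0)"
      by (simp add: o_def)
    have "isCont (\<lambda>r. snd c y + r *\<^sub>R w) 0" by (intro continuous_intros)
    moreover have "\<forall>\<^sub>F z in nhds (snd c y + 0 *\<^sub>R w). z \<in> snd c ` fst c"
      using is_chartD(2)[OF ic] c(2) by (intro eventually_nhds_in_open) auto
    ultimately have "\<forall>\<^sub>F r in nhds 0. snd c y + r *\<^sub>R w \<in> snd c ` fst c"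
      by (rule eventually_compose_isCont)
    then have "\<forall>\<^sub>F r in nhds 0. Q (chart_inv c (snd c y + r *\<^sub>R w)) = Q y"
    proof eventually_elim
      case (elim r)
      have "r *\<^sub>R w \<in> W"
        unfolding scaleR_eq_smult by (rule vec.subspace_scale[OF W w])
      then have "snd c y + r *\<^sub>R w \<in> snd c ` (?S \<inter> fst c)"
        unfolding slice using elim by simp
      then obtain q where q: "q \<in> ?S" "q \<in> fst c" "snd c y + r *\<^sub>R w = snd c q" by blast
      show ?case
        unfolding q(3) using is_chartD(3)[OF ic q(2)] q(1) by (simp add: Q_def)
    qed
    from has_derivative_cong_eventually[OF d1 this]
    have "((\<lambda>r. Q y) has_derivative (\<lambda>r. ?P (transition c ?e y (r *\<^sub>R w)))) (at 0)" .
    from has_derivative_unique[OF this has_derivative_const]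
    have "?P (transition c ?e y (1 *\<^sub>R w)) = 0" by (rule fun_cong)
    then show ?thesis by (simp add: w_def tr_inv(2))
  qed
  \<comment> \<open>Being its own orthogonal makes T stable under J, and therefore its orthogonals
    with respect to \<Omega> and to the real part of \<Omega> coincide.\<close>
  have TJ: "J_std v \<in> T" if "v \<in> T" for v
  proof -
    have "\<forall>v'\<in>T. \<Omega> y v v' = 0" using that T by blast
    then show ?thesis by (subst T) (auto simp: form_J1)
  qed
  have ReT: "T = {u. \<forall>v\<in>T. Re (\<Omega> y u v) = 0}"
  proof -
    have "\<Omega> y u v = 0" if "\<forall>v\<in>T. Re (\<Omega> y u v) = 0" "v \<in> T" for u v
      using that TJ[OF that(2)] by (force simp: complex_eq_iff form_J2)
    then show ?thesis by (subst T) auto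
  qed
  have iso: "Re (\<Omega> y a b) = 0" if "?P a = 0" "?P b = 0" for a b
  proof (rule Lagrangian_in_kernel_imp_kernel_isotropic[where \<sigma> = "\<lambda>u v. Re (\<Omega> y u v)" and P = ?P and T = T,
        OF Re_form_bilinear Re_form_nondegenerate linP _ _ ReT TP that])
    show "surj ?P" using \<pi>(2) by (simp add: submersive_def)
    show "DIM(complex^'d) = 2 * DIM(complex^'n)" using dims by simp
  qed auto
  \<comment> \<open>The kernel is stable under J, so the imaginary part of \<Omega> on it is again a
    value of the real part.\<close>
  have "?P (J_std b) = 0"
    unfolding PJ ab(2) by (simp add: J_std_def)
  then have "Re (\<Omega> y a (J_std b)) = 0" using iso ab(1) by blast
  then show ?thesis
    using iso[OF ab] by (simp add: form_J2 complex_eq_iff)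
qed

theorem corollary1p6:
  fixes AM :: "('m::{t2_space,second_countable_topology}, complex^'n) chart set"
    and AX :: "('x::{t2_space,second_countable_topology}, complex^'d) chart set"
    and \<omega> :: "('m, complex^'n, real) two_form"
    and \<Omega> :: "('x, complex^'d, complex) two_form"
    and \<iota> :: "'m \<Rightarrow> 'x" and \<tau> :: "'x \<Rightarrow> 'x" and \<pi> :: "'x \<Rightarrow> 'm"
    and h :: "'m \<Rightarrow> complex" and H :: "'x \<Rightarrow> complex"
    and \<Phi> :: "real \<Rightarrow> 'x \<Rightarrow> 'x" and E :: "real set" and Pr :: "real \<Rightarrow> 'x \<Rightarrow> 'm"
    and f :: "real \<Rightarrow> 'm \<Rightarrow> 'm" and t :: real and \<omega>\<^sub>t :: "('m, complex^'n, real) two_form"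
  assumes kaehler: "real_analytic_kaehler_manifold AM \<omega>"
    and X: "complex_manifold AX" and dim_X: "CARD('d) = 2 * CARD('n)"
    and Omega: "holomorphic_symplectic_form AX \<Omega>"
    and iota: "real_analytic_embedding AM AX \<iota>"
    and iota_Omega: "pullback_form AM AX \<iota> \<Omega> = (\<lambda>p u v. complex_of_real (\<omega> p u v))"
    and tau: "chartwise_map antihol_map_on AX AX \<tau>" "\<tau> \<circ> \<tau> = id" "{x. \<tau> x = x} = range \<iota>"
    and tau_Omega: "pullback_form AX AX \<tau> \<Omega> = (\<lambda>p u v. cnj (\<Omega> p u v))"
    and Pi: "chartwise_map hol_map_on AX AM \<pi>" "submersive AX AM \<pi>" "\<pi> \<circ> \<iota> = id"
    and Pi_fibers: "\<And>x. holomorphic_lagrangian_submanifold AX \<Omega> (\<pi> -` {x})"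
    and h: "chartwise_fun real_analytic_on AM (\<lambda>p. Re (h p))"
           "chartwise_fun real_analytic_on AM (\<lambda>p. Im (h p))"
    and H: "chartwise_fun hol_fun_on AX H" "H \<circ> \<iota> = h"
    and E: "open E" "is_interval E" "0 \<in> E"
    and flow: "is_flow_on AX (Hamilton_field AX (\<lambda>p u v. Re (\<Omega> p u v)) (\<lambda>p. Re (H p)))
                 (E \<union> uminus ` E) \<Phi>"
    and Pr: "\<And>s. s \<in> E \<Longrightarrow> chartwise_map smooth_on AX AM (Pr s)"
            "\<And>s. s \<in> E \<Longrightarrow> submersive AX AM (Pr s)"
            "\<And>s. s \<in> E \<Longrightarrow> Pr s \<circ> \<iota> = id"
            "\<And>s. s \<in> E \<Longrightarrow> range (\<lambda>x. \<Phi> s ` (\<pi> -` {x})) = range (\<lambda>y. Pr s -` {y})"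
            "Pr 0 = \<pi>"
    and f: "\<And>s. f s = Pr 0 \<circ> \<Phi> s \<circ> \<iota>"
    and t: "- t \<in> E"
    and omega_t: "symplectic_form AM \<omega>\<^sub>t" "\<omega> = pullback_form AM AM (f t) \<omega>\<^sub>t"
  shows "bij (f t) \<and>
    (\<forall>x. has_velocity AM (\<lambda>s. f s (inv (f t) x)) t
      (Hamilton_field AM \<omega>\<^sub>t (\<lambda>y. Re (h (inv (f t) y))) x +
       J_std (Hamilton_field AM \<omega>\<^sub>t (\<lambda>y. Im (h (inv (f t) y))) x)))"
proof -
  have AM: "complex_manifold AM" using kaehler by (simp add: real_analytic_kaehler_manifold_def)
  \<comment> \<open>Symmetric about 0, so that the flow at t and its inverse at -t are both covered,
    although only -t is known to lie in E.\<close>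
  define T where "T = E \<union> uminus ` E"
  have tT: "open T" "is_interval T" "0 \<in> T" "t \<in> T" "- t \<in> T"
  proof -
    show "open T" unfolding T_def using E(1) by (intro open_Un open_negations) auto
    have "connected (uminus ` E)"
      using E(2) is_interval_connected_1 by (intro connected_continuous_image) (auto intro!: continuous_intros)
    moreover have "0 \<in> E \<inter> uminus ` E" using E(3) by force
    ultimately have "connected T"
      unfolding T_def using E(2) is_interval_connected_1 by (intro connected_Un) auto
    then show "is_interval T" by (simp add: is_interval_connected_1)
    show "0 \<in> T" "- t \<in> T" using E(3) t by (auto simp: T_def)
    show "t \<in> T" using t by (auto simp: T_def intro!: image_eqI[of _ _ "- t"])
  qed
  interpret sys: holomorphic_Hamiltonian_system AX \<Omega> H
    by unfold_locales (fact X Omega H(1))+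
  interpret holomorphic_Hamiltonian_flow AX \<Omega> H T \<Phi>
    by unfold_locales (use tT flow in \<open>auto simp: T_def sys.V_def\<close>)
  have f_eq: "f s = \<pi> \<circ> \<Phi> s \<circ> \<iota>" for s using f Pr(5) by simp
  have \<pi>\<iota>: "\<pi> (\<iota> p) = p" for p using Pi(3) by (metis comp_apply id_apply)

  have \<Phi>_inv: "\<Phi> t (\<Phi> (- t) q) = q" "\<Phi> (- t) (\<Phi> t q) = q" for q
    using flow_add[OF tT(4,5), of q] flow_add[OF tT(5,4), of q] tT(3) by (simp_all add: flow_0)
  have bij: "bij (f t)"
  proof -
    have "\<exists>!p. f t p = x" for x
    proof -
      have "\<Phi> (- t) ` (\<pi> -` {x}) \<in> range (\<lambda>y. Pr (- t) -` {y})"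
        using Pr(4)[OF t] by blast
      then obtain y where y: "\<Phi> (- t) ` (\<pi> -` {x}) = Pr (- t) -` {y}" by blast
      have "f t p = x \<longleftrightarrow> p = y" for p
      proof -
        have "f t p = x \<longleftrightarrow> \<iota> p \<in> \<Phi> (- t) ` (\<pi> -` {x})"
        proof
          assume "f t p = x"
          then have "\<Phi> t (\<iota> p) \<in> \<pi> -` {x}" by (simp add: f_eq)
          from imageI[OF this, of "\<Phi> (- t)"] show "\<iota> p \<in> \<Phi> (- t) ` (\<pi> -` {x})"
            by (simp only: \<Phi>_inv)
        qed (auto simp: f_eq \<Phi>_inv)
        also have "\<dots> \<longleftrightarrow> Pr (- t) (\<iota> p) = y" unfolding y by simp
        also have "Pr (- t) (\<iota> p) = p" using Pr(3)[OF t] by (metis comp_apply id_apply)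
        finally show ?thesis .
      qed
      then show ?thesis by auto
    qed
    then show ?thesis by (metis bij_iff)
  qed

  have d\<iota>: "has_mderiv AM AX \<iota> p (mderiv AM AX \<iota> p)" for p
    using iota unfolding real_analytic_embedding_def
    by (intro chartwise_map_has_mderiv[OF AM X, of real_analytic_on]) (auto intro: real_analytic_on_imp_differentiable)
  note d\<pi> = hol_map_mderiv_J[OF X AM Pi(1)]
  obtain d\<Phi> where d\<Phi>: "\<And>q. has_mderiv AX AX (\<Phi> t) q (d\<Phi> q)"
    and d\<Phi>_form: "\<And>q u v. \<Omega> (\<Phi> t q) (d\<Phi> q u) (d\<Phi> q v) = \<Omega> q u v"
    using flow_preserves_form[OF tT(4)] unfolding sys.preserves_form_at_def by metis
  have df: "has_mderiv AM AM (f t) p (mderiv AX AM \<pi> (\<Phi> t (\<iota> p)) \<circ> (d\<Phi> (\<iota> p) \<circ> mderiv AM AX \<iota> p))" for p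
    unfolding f_eq comp_assoc
    using has_mderiv_compose[OF AM X has_mderiv_compose[OF AM X d\<iota> d\<Phi>], of AM \<pi> p] d\<pi>(1) by simp
  have \<omega>_eq: "\<omega> p u v = \<omega>\<^sub>t (f t p) (mderiv AM AM (f t) p u) (mderiv AM AM (f t) p v)" for p u v
    using omega_t(2) by (metis pullback_form_def)
  have \<iota>_form: "\<Omega> (\<iota> p) (mderiv AM AX \<iota> p u) (mderiv AM AX \<iota> p v) = complex_of_real (\<omega> p u v)" for p u v
    using fun_cong[OF fun_cong[OF fun_cong[OF iota_Omega]], of p u v] by (simp add: pullback_form_def)
  have nd: "nondegenerate_alternating \<omega>\<^sub>t" using omega_t(1) by (simp add: symplectic_form_def)
  have nd0: "\<And>p u. (\<And>v. \<omega> p u v = 0) \<Longrightarrow> u = 0"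
    using kaehler by (auto simp: real_analytic_kaehler_manifold_def symplectic_form_def nondegenerate_alternating_def)

  have "has_velocity AM (\<lambda>s. f s (inv (f t) x)) t
      (Hamilton_field AM \<omega>\<^sub>t (\<lambda>y. Re (h (inv (f t) y))) x +
       J_std (Hamilton_field AM \<omega>\<^sub>t (\<lambda>y. Im (h (inv (f t) y))) x))" for x
  proof -
    define p where "p = inv (f t) x"
    have x: "x = f t p" using bij by (simp add: p_def bij_is_surj surj_f_inv_f)
    define q where "q = \<Phi> t (\<iota> p)"
    have \<pi>q: "\<pi> q = x" by (simp add: x f_eq q_def)
    define F where "F = mderiv AM AM (f t) p"
    have F: "F = mderiv AX AM \<pi> q \<circ> (d\<Phi> (\<iota> p) \<circ> mderiv AM AX \<iota> p)"
      unfolding F_def q_def by (rule has_mderiv_imp_mderiv[OF df])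
    have F': "has_mderiv AM AM (f t) p F" using df by (simp add: F q_def)
    \<comment> \<open>The pullback of \<open>\<omega>\<^sub>t\<close> under F is the nondegenerate
      form \<omega>, so F has no kernel.\<close>
    have "inj F"
    proof (rule injI)
      fix u v assume eq: "F u = F v"
      have "\<omega> p (u - v) w = 0" for w
      proof -
        have "linear (\<lambda>u. \<omega>\<^sub>t x u (F w))"
          using nd by (auto simp: nondegenerate_alternating_def bilinear_def)
        from linear_diff[OF this, of "F u" "F v"] show ?thesis
          using eq unfolding \<omega>_eq F_def[symmetric] x[symmetric]
          by (simp add: linear_diff[OF has_mderiv_linear[OF F']])
      qed
      then show "u = v" using nd0[of p "u - v"] by simp
    qed
    then obtain G where G: "has_mderiv AM AM (inv (f t)) x G" "\<And>u. F (G u) = u"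
      using has_mderiv_inv[OF AM bij _ F'] df unfolding x has_mderiv_def by metis
    \<comment> \<open>The differential of the section at x, that is, of the flow map after \<iota>
      after the inverse of \<open>f t\<close>.\<close>
    define S where "S = d\<Phi> (\<iota> p) \<circ> (mderiv AM AX \<iota> p \<circ> G)"
    have s: "has_mderiv AM AX (\<Phi> t \<circ> (\<iota> \<circ> inv (f t))) x S"
      unfolding S_def
      by (rule has_mderiv_compose[OF AM X has_mderiv_compose[OF AM AM G(1)]])
         (use d\<iota> d\<Phi> in \<open>simp_all add: p_def\<close>)
    \<comment> \<open>Conservation of H along the flow makes h after the inverse of
      \<open>f t\<close> the restriction of H to the moved section. Its differential is therefore
      \<Omega>(V, S u).\<close>
    have hG: "h \<circ> inv (f t) = H \<circ> (\<Phi> t \<circ> (\<iota> \<circ> inv (f t)))"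
      using H(2) Hamiltonian_conserved[OF tT(4)] by (auto simp: fun_eq_iff)
    have dh: "has_fun_deriv AM (h \<circ> inv (f t)) x (\<lambda>u. \<Omega> q (sys.V q) (S u))"
    proof -
      have "has_fun_deriv AM (H \<circ> (\<Phi> t \<circ> (\<iota> \<circ> inv (f t)))) x (fun_deriv AX H q \<circ> S)"
        by (rule has_fun_deriv_compose[OF AM X s])
           (use chartwise_fun_hol_has_fun_deriv(1)[OF X H(1), of q] in \<open>simp add: q_def p_def\<close>)
      then show ?thesis unfolding hG by (simp add: sys.form_V o_def)
    qed
    let ?XR = "Hamilton_field AM \<omega>\<^sub>t (\<lambda>y. Re (h (inv (f t) y))) x"
    let ?XI = "Hamilton_field AM \<omega>\<^sub>t (\<lambda>y. Im (h (inv (f t) y))) x"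
    have "mderiv AX AM \<pi> q (sys.V q) = ?XR + J_std ?XI"
    proof (rule section_projection_of_vector[where S = S and \<Omega> = "\<Omega> q" and \<omega> = "\<omega>\<^sub>t x"])
      show "bilinear (\<omega>\<^sub>t x)" "\<And>u. (\<And>v. \<omega>\<^sub>t x u v = 0) \<Longrightarrow> u = 0"
        using nd by (auto simp: nondegenerate_alternating_def)
      show "mderiv AX AM \<pi> q (S u) = u" for u
        using G(2)[of u] by (simp add: F S_def)
      show "\<Omega> q a b = 0" if "mderiv AX AM \<pi> q a = 0" "mderiv AX AM \<pi> q b = 0" for a b
        by (rule kernel_isotropic_of_Lagrangian_fibre[OF AM X dim_X Omega Pi(1,2) Pi_fibers that])
      \<comment> \<open>Invariance of \<Omega> under the flow and its restriction to \<iota> give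
        \<omega>(G u, G v), which is \<open>\<omega>\<^sub>t\<close> on F (G u) = u and F (G v) =
        v.\<close>
      show "\<Omega> q (S u) (S v) = complex_of_real (\<omega>\<^sub>t x u v)" for u v
        using \<omega>_eq[of p "G u" "G v"] by (simp add: S_def q_def d\<Phi>_form \<iota>_form F_def[symmetric] G(2) x[symmetric])
      show "\<omega>\<^sub>t x ?XR u = Re (\<Omega> q (sys.V q) (S u))" for u
        by (rule Hamilton_field[OF nd]) (use has_fun_deriv_bounded_linear[OF bounded_linear_Re dh] in simp)
      show "\<omega>\<^sub>t x ?XI u = Im (\<Omega> q (sys.V q) (S u))" for u
        by (rule Hamilton_field[OF nd]) (use has_fun_deriv_bounded_linear[OF bounded_linear_Im dh] in simp)
    qed (use sys.form_bilinear sys.form_J1 sys.form_J2 d\<pi>(2) has_mderiv_linear[OF d\<pi>(1)] in auto)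
    \<comment> \<open>The inverse is taken at the fixed time t, so p is constant and the curve is
      the \<pi>-image of a single orbit of the flow.\<close>
    moreover have "has_velocity AM (\<pi> \<circ> (\<lambda>s. \<Phi> s (\<iota> p))) t (mderiv AX AM \<pi> q (sys.V q))"
      unfolding q_def by (rule has_velocity_compose[OF X flow_velocity[OF tT(4)] d\<pi>(1)])
    ultimately show ?thesis
      by (simp add: f_eq p_def o_def)
  qed
  with bij show ?thesis by blast
qed

end
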